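(* Let $n\ge 2$, and let $\mathcal{T}_c$, $G_1$, $\mathfrak{g}$, $\omega$, $\theta$, $\nabla$, $X_f$, $\varphi_\xi$ and the inner product $(\cdot,\cdot)$ be as defined in the context. For every $\xi\in\mathfrak{g}$ the operator $\rho(\xi)=\nabla_{X_{\varphi_\xi}}+2\pi i\,\varphi_\xi$ maps polarized sections to polarized sections, and the resulting Lie algebra representation $\rho$ exponentiates to a representation of $G_1$ on polarized sections, that is, a representation with $\frac{d}{dt}\big|_{t=0}(\exp(t\xi)\,s)=\rho(\xi)s$ pointwise for smooth polarized $s$ and $\xi\in\mathfrak{g}$. This representation satisfies $(gs,gs)=(s,s)$ for all $g\in G_1$ and all smooth polarized sections $s$ with $(s,s)<\infty$. Hence it gives a unitary representation of $G_1$ on the Hilbert space $\mathfrak{H}$ obtained by completing the space of smooth polarized sections $s$ with $(s,s)<\infty$. Moreover, there is a constant $C>0$, independent of $s$, with $$(s,s)=C\int_0^\infty\!\cdots\int_0^\infty |s(a_1,\ldots,a_{n-1})|^2\,\frac{da_1\cdots da_{n-1}}{a_1\cdots a_{n-1}}.$$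
   Context: Fix $c\in\mathbb{R}$. The Toda space $\mathcal{T}_c$ is the set of real $n\times n$ matrices $T$ with $T_{ii}=b_i\in\mathbb{R}$, $T_{i,i+1}=a_i>0$, all other entries zero, and $\sum_{i=1}^n b_i=c$. Put $p_i=\sum_{j=1}^i b_j$ for $1\le i\le n-1$; then $(a_1,\ldots,a_{n-1},p_1,\ldots,p_{n-1})\in(0,\infty)^{n-1}\times\mathbb{R}^{n-1}$ are global coordinates on $\mathcal{T}_c$. The symplectic form is $\omega=\sum_{i=1}^{n-1}\frac{1}{a_i}\,da_i\wedge dp_i$. $G_1$ is the group of real lower triangular $n\times n$ matrices with positive diagonal entries and determinant $1$, with Lie algebra $\mathfrak{g}$ the real lower triangular matrices of trace zero. $G_1$ acts on $\mathcal{T}_c$ by $g\cdot T=[gTg^{-1}]_+$, where $[\cdot]_+$ sets all entries strictly below the diagonal to zero. For $\xi\in\mathfrak{g}$, $\varphi_\xi(T)=\mathrm{Tr}(\xi T)$ is the corresponding Hamiltonian function on $\mathcal{T}_c$. The prequantum line bundle on $\mathcal{T}_c$ is trivial, so sections are complex-valued functions $s(a,p)$. The symplectic potential is $\theta=\sum_{i=1}^{n-1}p_i\frac{da_i}{a_i}$, the connection is $\nabla_X s=X(s)+2\pi i\,\theta(X)s$, and the Hamiltonian vector field of a smooth function $f$ is $X_f=\sum_{i=1}^{n-1}a_i\left(\frac{\partial f}{\partial a_i}\frac{\partial}{\partial p_i}-\frac{\partial f}{\partial p_i}\frac{\partial}{\partial a_i}\right)$. The polarization is spanned by $\partial_{p_1},\ldots,\partial_{p_{n-1}}$;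 polarized sections are the sections $s$ with $\nabla_{\partial_{p_i}}s=0$ for all $i$, i.e. the functions $s=s(a_1,\ldots,a_{n-1})$ of the $a_i$ only. The inner product on polarized sections is determined by $(s,s)=\int_{\mathcal{T}_c}|s|^2\,e^{-\sum_{i=1}^{n-1}p_i^2}\,\omega^{n-1}$, where $\omega^{n-1}$ is oriented so as to be a positive volume form. *)

theory Defs
  imports "HOL-Analysis.Analysis" "Jordan_Normal_Form.Determinant"
begin

text \<open>
  Matrices are those of Jordan_Normal_Form, so all indices start at 0: the entries
  \<open>a\<^sub>1, \<dots>, a\<^sub>n\<^sub>-\<^sub>1\<close> and the partial sums \<open>p\<^sub>1, \<dots>, p\<^sub>n\<^sub>-\<^sub>1\<close> become \<open>a i\<close> and \<open>p i\<close> with \<open>i < n - 1\<close>.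
\<close>

definition mat_trace :: "'a::comm_monoid_add mat \<Rightarrow> 'a" where
  "mat_trace A = (\<Sum>i<dim_row A. A $$ (i, i))"

definition lower_triangular :: "'a::zero mat \<Rightarrow> bool" where
  "lower_triangular A \<longleftrightarrow> upper_triangular (transpose_mat A)"

definition G1 :: "nat \<Rightarrow> real mat set" where
  "G1 n = {g \<in> carrier_mat n n. lower_triangular g \<and> (\<forall>i<n. 0 < g $$ (i, i)) \<and> Determinant.det g = 1}"

definition g1_alg :: "nat \<Rightarrow> real mat set" where
  "g1_alg n = {\<xi> \<in> carrier_mat n n. lower_triangular \<xi> \<and> mat_trace \<xi> = 0}"

definition mat_exp :: "nat \<Rightarrow> real mat \<Rightarrow> real mat" where
  "mat_exp n \<xi> = mat n n (\<lambda>(i, j). \<Sum>k. (\<xi> ^\<^sub>m k) $$ (i, j) / fact k)"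


section \<open>The Toda space and its coordinates\<close>

definition toda_space :: "real \<Rightarrow> nat \<Rightarrow> real mat set" where
  "toda_space c n = {T \<in> carrier_mat n n.
     (\<forall>i. Suc i < n \<longrightarrow> 0 < T $$ (i, Suc i)) \<and>
     (\<forall>i<n. \<forall>j<n. j \<noteq> i \<and> j \<noteq> Suc i \<longrightarrow> T $$ (i, j) = 0) \<and>
     (\<Sum>i<n. T $$ (i, i)) = c}"

type_synonym coords = "(nat \<Rightarrow> real) \<times> (nat \<Rightarrow> real)"

text \<open>
  A pair \<open>(a, p)\<close> consists of functions on \<open>{..<n - 1}\<close> (extensional, as for points of \<open>Pi\<^sub>M\<close>).
  With the product topology on \<open>nat \<Rightarrow> real\<close>, the set \<open>toda_dom n\<close> is the usual
  \<open>(0,\<infinity>)\<^sup>n\<^sup>-\<^sup>1 \<times> \<real>\<^sup>n\<^sup>-\<^sup>1\<close>.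
\<close>

definition toda_dom_a :: "nat \<Rightarrow> (nat \<Rightarrow> real) set" where
  "toda_dom_a n = ({..<n - 1} \<rightarrow>\<^sub>E {0<..})"

definition toda_dom_p :: "nat \<Rightarrow> (nat \<Rightarrow> real) set" where
  "toda_dom_p n = ({..<n - 1} \<rightarrow>\<^sub>E UNIV)"

definition toda_dom :: "nat \<Rightarrow> coords set" where
  "toda_dom n = toda_dom_a n \<times> toda_dom_p n"

definition toda_coords :: "nat \<Rightarrow> real mat \<Rightarrow> coords" where
  "toda_coords n T = (restrict (\<lambda>i. T $$ (i, Suc i)) {..<n - 1},
                      restrict (\<lambda>i. \<Sum>j\<le>i. T $$ (j, j)) {..<n - 1})"

definition toda_point :: "real \<Rightarrow> nat \<Rightarrow> coords \<Rightarrow> real mat" where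
  "toda_point c n = inv_into (toda_space c n) (toda_coords n)"

definition toda_mat :: "real \<Rightarrow> nat \<Rightarrow> coords \<Rightarrow> real mat" where
  "toda_mat c n x = mat n n (\<lambda>(i, j).
     if j = i then (if i = n - 1 then c else snd x i) - (if i = 0 then 0 else snd x (i - 1))
     else if j = Suc i then fst x i else 0)"

lemma toda_mat_diag_sum:
  assumes "i < n"
  shows "(\<Sum>j\<le>i. toda_mat c n x $$ (j, j)) = (if i = n - 1 then c else snd x i)"
  using assms
proof (induction i)
  case 0
  then show ?case by (simp add: toda_mat_def)
next
  case (Suc i)
  have "toda_mat c n x $$ (Suc i, Suc i) = (if Suc i = n - 1 then c else snd x (Suc i)) - snd x i"
    using Suc.prems by (simp add: toda_mat_def)
  moreover have "i < n" "i \<noteq> n - 1" using Suc.prems by auto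
  then have "(\<Sum>j\<le>i. toda_mat c n x $$ (j, j)) = snd x i"
    using Suc.IH by simp
  ultimately show ?case by simp
qed

lemma toda_mat_in_space:
  assumes "0 < n" "x \<in> toda_dom n"
  shows "toda_mat c n x \<in> toda_space c n"
proof -
  have "(\<Sum>i<n. toda_mat c n x $$ (i, i)) = (\<Sum>i\<le>n - 1. toda_mat c n x $$ (i, i))"
    using assms(1) by (intro sum.cong) auto
  also have "\<dots> = c"
    using assms(1) toda_mat_diag_sum[of "n - 1" n c x] by simp
  finally have "(\<Sum>i<n. toda_mat c n x $$ (i, i)) = c" .
  moreover have "0 < toda_mat c n x $$ (i, Suc i)" if "Suc i < n" for i
  proof -
    have "fst x \<in> {..<n - 1} \<rightarrow>\<^sub>E {0<..}"
      using assms(2) by (simp add: toda_dom_def toda_dom_a_def mem_Times_iff)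
    then have "0 < fst x i" using that by (simp add: PiE_iff)
    then show ?thesis using that by (simp add: toda_mat_def)
  qed
  moreover have "toda_mat c n x $$ (i, j) = 0" if "i < n" "j < n" "j \<noteq> i" "j \<noteq> Suc i" for i j
    using that by (simp add: toda_mat_def)
  moreover have "toda_mat c n x \<in> carrier_mat n n"
    by (simp add: toda_mat_def)
  ultimately show ?thesis
    unfolding toda_space_def by blast
qed

lemma toda_coords_toda_mat:
  assumes "x \<in> toda_dom n"
  shows "toda_coords n (toda_mat c n x) = x"
proof (rule prod_eqI)
  have a: "fst x \<in> extensional {..<n - 1}" and p: "snd x \<in> extensional {..<n - 1}"
    using assms by (simp_all add: toda_dom_def toda_dom_a_def toda_dom_p_def mem_Times_iff PiE_iff)
  show "fst (toda_coords n (toda_mat c n x)) = fst x"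
  proof
    fix i show "fst (toda_coords n (toda_mat c n x)) i = fst x i"
    proof (cases "i < n - 1")
      case True
      then show ?thesis by (simp add: toda_coords_def toda_mat_def)
    next
      case False
      then show ?thesis using extensional_arb[OF a, of i] by (simp add: toda_coords_def)
    qed
  qed
  show "snd (toda_coords n (toda_mat c n x)) = snd x"
  proof
    fix i show "snd (toda_coords n (toda_mat c n x)) i = snd x i"
    proof (cases "i < n - 1")
      case True
      then show ?thesis by (simp add: toda_coords_def toda_mat_diag_sum)
    next
      case False
      then show ?thesis using extensional_arb[OF p, of i] by (simp add: toda_coords_def)
    qed
  qed
qed

lemma toda_mat_toda_coords:
  assumes "T \<in> toda_space c n"
  shows "toda_mat c n (toda_coords n T) = T"
proof (rule eq_matI)
  show "dim_row (toda_mat c n (toda_coords n T)) = dim_row T"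
       "dim_col (toda_mat c n (toda_coords n T)) = dim_col T"
    using assms by (auto simp: toda_mat_def toda_space_def)
  fix i j assume ij: "i < dim_row T" "j < dim_col T"
  then have n: "i < n" "j < n" using assms by (auto simp: toda_space_def)
  have c: "(\<Sum>k<n. T $$ (k, k)) = c" using assms by (simp add: toda_space_def)
  have *: "(if i = n - 1 then c else \<Sum>k\<le>i. T $$ (k, k)) = (\<Sum>k\<le>i. T $$ (k, k))"
  proof (cases "i = n - 1")
    case True
    then have "{..i} = {..<n}" using n by auto
    with c True show ?thesis by simp
  qed simp
  have diag: "(\<Sum>k\<le>i. T $$ (k, k)) - (if i = 0 then 0 else \<Sum>k\<le>i - 1. T $$ (k, k)) = T $$ (i, i)"
    by (cases i) auto
  show "toda_mat c n (toda_coords n T) $$ (i, j) = T $$ (i, j)"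
  proof (cases "j = i")
    case True
    have "toda_mat c n (toda_coords n T) $$ (i, j) =
      (if i = n - 1 then c else \<Sum>k\<le>i. T $$ (k, k)) - (if i = 0 then 0 else \<Sum>k\<le>i - 1. T $$ (k, k))"
      using n True by (auto simp: toda_mat_def toda_coords_def)
    then show ?thesis by (simp only: * diag True)
  next
    case False
    show ?thesis
    proof (cases "j = Suc i")
      case True
      then have "i < n - 1" using n by simp
      then show ?thesis using n True by (simp add: toda_mat_def toda_coords_def)
    next
      case False
      then have "T $$ (i, j) = 0" using n assms \<open>j \<noteq> i\<close> by (simp add: toda_space_def)
      then show ?thesis using n False \<open>j \<noteq> i\<close> by (simp add: toda_mat_def)
    qed
  qed
qed

lemma toda_coords_in_dom:
  assumes "T \<in> toda_space c n"
  shows "toda_coords n T \<in> toda_dom n"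
  using assms
  by (auto simp: toda_coords_def toda_dom_def toda_dom_a_def toda_dom_p_def toda_space_def)

lemma bij_betw_toda_coords:
  assumes "0 < n"
  shows "bij_betw (toda_coords n) (toda_space c n) (toda_dom n)"
  by (rule bij_betw_byWitness[where f' = "toda_mat c n"])
    (use assms in \<open>auto simp: toda_mat_toda_coords toda_coords_toda_mat toda_coords_in_dom toda_mat_in_space\<close>)

lemma toda_point_eq:
  assumes "0 < n" "x \<in> toda_dom n"
  shows "toda_point c n x = toda_mat c n x"
  unfolding toda_point_def
proof (rule inv_into_f_eq)
  show "inj_on (toda_coords n) (toda_space c n)"
    using bij_betw_toda_coords[OF assms(1)] by (rule bij_betw_imp_inj_on)
  show "toda_mat c n x \<in> toda_space c n"
    using assms by (rule toda_mat_in_space)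
  show "toda_coords n (toda_mat c n x) = x"
    using assms(2) by (rule toda_coords_toda_mat)
qed

definition toda_phi :: "real \<Rightarrow> nat \<Rightarrow> real mat \<Rightarrow> coords \<Rightarrow> real" where
  "toda_phi c n \<xi> x = mat_trace (\<xi> * toda_point c n x)"


section \<open>Calculus on the Toda space\<close>

definition pd_a :: "nat \<Rightarrow> (coords \<Rightarrow> 'b::real_normed_vector) \<Rightarrow> coords \<Rightarrow> 'b" where
  "pd_a i f x = vector_derivative (\<lambda>t. f ((fst x)(i := t), snd x)) (at (fst x i))"

definition pd_p :: "nat \<Rightarrow> (coords \<Rightarrow> 'b::real_normed_vector) \<Rightarrow> coords \<Rightarrow> 'b" where
  "pd_p i f x = vector_derivative (\<lambda>t. f (fst x, (snd x)(i := t))) (at (snd x i))"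

definition diff_a :: "nat \<Rightarrow> (coords \<Rightarrow> 'b::real_normed_vector) \<Rightarrow> coords \<Rightarrow> bool" where
  "diff_a i f x \<longleftrightarrow> (\<lambda>t. f ((fst x)(i := t), snd x)) differentiable (at (fst x i))"

definition diff_p :: "nat \<Rightarrow> (coords \<Rightarrow> 'b::real_normed_vector) \<Rightarrow> coords \<Rightarrow> bool" where
  "diff_p i f x \<longleftrightarrow> (\<lambda>t. f (fst x, (snd x)(i := t))) differentiable (at (snd x i))"

primrec toda_Ck :: "nat \<Rightarrow> nat \<Rightarrow> (coords \<Rightarrow> 'b::real_normed_vector) \<Rightarrow> bool" where
  "toda_Ck n 0 f = continuous_on (toda_dom n) f"
| "toda_Ck n (Suc k) f = (continuous_on (toda_dom n) f \<and>
     (\<forall>i<n - 1. (\<forall>x\<in>toda_dom n. diff_a i f x \<and> diff_p i f x) \<and>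
        toda_Ck n k (pd_a i f) \<and> toda_Ck n k (pd_p i f)))"

definition toda_smooth :: "nat \<Rightarrow> (coords \<Rightarrow> 'b::real_normed_vector) \<Rightarrow> bool" where
  "toda_smooth n f \<longleftrightarrow> (\<forall>k. toda_Ck n k f)"

text \<open>
  A tangent vector is the pair \<open>(u, v)\<close> of its components with respect to the \<open>\<partial>/\<partial>a\<^sub>i\<close> and the
  \<open>\<partial>/\<partial>p\<^sub>i\<close>; only the components with \<open>i < n - 1\<close> matter.
\<close>

type_synonym tangent = "(nat \<Rightarrow> real) \<times> (nat \<Rightarrow> real)"
type_synonym vfield = "coords \<Rightarrow> tangent"

definition vec_a :: "nat \<Rightarrow> tangent" where
  "vec_a i = ((\<lambda>j. if j = i then 1 else 0), (\<lambda>_. 0))"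

definition vec_p :: "nat \<Rightarrow> tangent" where
  "vec_p i = ((\<lambda>_. 0), (\<lambda>j. if j = i then 1 else 0))"

definition toda_omega :: "nat \<Rightarrow> coords \<Rightarrow> tangent \<Rightarrow> tangent \<Rightarrow> real" where
  "toda_omega n x v w = (\<Sum>i<n - 1. 1 / fst x i * (fst v i * snd w i - fst w i * snd v i))"

text \<open>
  Powers of a 2-form \<open>\<omega>\<close> for the wedge product, evaluated on a list of tangent vectors: for a
  \<open>k\<close>-form \<open>\<beta>\<close>, the value of \<open>\<omega> \<and> \<beta>\<close> on \<open>v\<^sub>0, \<dots>, v\<^sub>k\<^sub>+\<^sub>1\<close> is the sum over all \<open>(2,k)\<close>-shuffles, i.e. over
  the pairs \<open>i < j\<close> with sign \<open>(-1)\<^sup>i\<^sup>+\<^sup>j\<^sup>+\<^sup>1\<close>, of \<open>\<omega>(v\<^sub>i, v\<^sub>j)\<close> times \<open>\<beta>\<close> on the remaining vectors.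
\<close>

primrec wedge_power :: "('v \<Rightarrow> 'v \<Rightarrow> real) \<Rightarrow> nat \<Rightarrow> 'v list \<Rightarrow> real" where
  "wedge_power \<omega> 0 vs = 1"
| "wedge_power \<omega> (Suc k) vs =
     (\<Sum>(i, j)\<in>{(i, j). i < j \<and> j < length vs}.
        (-1) ^ (i + j + 1) * \<omega> (vs ! i) (vs ! j) * wedge_power \<omega> k (nths vs (- {i, j})))"

text \<open>
  The density of \<open>\<omega>\<^sup>n\<^sup>-\<^sup>1\<close>, positively oriented, with respect to Lebesgue measure \<open>da dp\<close>;
  the absolute value makes it independent of the order of the coordinate frame.
\<close>

definition liouville_density :: "nat \<Rightarrow> coords \<Rightarrow> real" where
  "liouville_density n x =
     \<bar>wedge_power (toda_omega n x) (n - 1) (concat (map (\<lambda>i. [vec_a i, vec_p i]) [0..<n - 1]))\<bar>"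

definition lebesgue_coords :: "nat \<Rightarrow> (nat \<Rightarrow> real) measure" where
  "lebesgue_coords n = (\<Pi>\<^sub>M i\<in>{..<n - 1}. lborel)"

definition liouville_measure :: "nat \<Rightarrow> coords measure" where
  "liouville_measure n = density (lebesgue_coords n \<Otimes>\<^sub>M lebesgue_coords n)
     (\<lambda>x. ennreal (liouville_density n x) * indicator (toda_dom n) x)"

definition ham_vfield :: "(coords \<Rightarrow> real) \<Rightarrow> vfield" where
  "ham_vfield f x = ((\<lambda>i. - (fst x i * pd_p i f x)), (\<lambda>i. fst x i * pd_a i f x))"

definition toda_theta :: "nat \<Rightarrow> coords \<Rightarrow> tangent \<Rightarrow> real" where
  "toda_theta n x v = (\<Sum>i<n - 1. snd x i * (fst v i / fst x i))"


section \<open>Prequantization\<close>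

text \<open>A function on the Toda space is encoded by its extension by zero.\<close>

type_synonym toda_section = "coords \<Rightarrow> complex"

definition toda_sections :: "nat \<Rightarrow> toda_section set" where
  "toda_sections n = {s. \<forall>x. x \<notin> toda_dom n \<longrightarrow> s x = 0}"

definition vf_apply :: "nat \<Rightarrow> vfield \<Rightarrow> toda_section \<Rightarrow> toda_section" where
  "vf_apply n X s x = (\<Sum>i<n - 1. fst (X x) i *\<^sub>R pd_a i s x + snd (X x) i *\<^sub>R pd_p i s x)"

definition nabla :: "nat \<Rightarrow> vfield \<Rightarrow> toda_section \<Rightarrow> toda_section" where
  "nabla n X s x = (if x \<in> toda_dom n
     then vf_apply n X s x + 2 * complex_of_real pi * \<i> * complex_of_real (toda_theta n x (X x)) * s x
     else 0)"

text \<open>No smoothness is assumed here beyond the existence of the derivatives in the equations.\<close>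

definition polarized :: "nat \<Rightarrow> toda_section \<Rightarrow> bool" where
  "polarized n s \<longleftrightarrow> s \<in> toda_sections n \<and>
     (\<forall>i<n - 1. \<forall>x\<in>toda_dom n. diff_p i s x \<and> nabla n (\<lambda>_. vec_p i) s x = 0)"

definition toda_rho :: "real \<Rightarrow> nat \<Rightarrow> real mat \<Rightarrow> toda_section \<Rightarrow> toda_section" where
  "toda_rho c n \<xi> s x = nabla n (ham_vfield (toda_phi c n \<xi>)) s x +
     2 * complex_of_real pi * \<i> * complex_of_real (toda_phi c n \<xi> x) * s x"

definition toda_inner :: "nat \<Rightarrow> toda_section \<Rightarrow> toda_section \<Rightarrow> complex" where
  "toda_inner n s t =
     (\<integral>x. s x * cnj (t x) * complex_of_real (exp (- (\<Sum>i<n - 1. (snd x i)\<^sup>2))) \<partial>liouville_measure n)"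

text \<open>The value \<open>(s, s) \<in> [0, \<infinity>]\<close>.\<close>

definition toda_normsq :: "nat \<Rightarrow> toda_section \<Rightarrow> ennreal" where
  "toda_normsq n s =
     (\<integral>\<^sup>+x. ennreal ((cmod (s x))\<^sup>2 * exp (- (\<Sum>i<n - 1. (snd x i)\<^sup>2))) \<partial>liouville_measure n)"

definition smooth_polarized :: "nat \<Rightarrow> toda_section set" where
  "smooth_polarized n = {s. toda_smooth n s \<and> polarized n s}"

definition toda_prehilbert :: "nat \<Rightarrow> toda_section set" where
  "toda_prehilbert n = {s \<in> smooth_polarized n. toda_normsq n s < \<infinity>}"


section \<open>Representations\<close>

definition lie_algebra_rep :: "nat \<Rightarrow> ('x \<Rightarrow> complex) set \<Rightarrow> (real mat \<Rightarrow> ('x \<Rightarrow> complex) \<Rightarrow> 'x \<Rightarrow> complex) \<Rightarrow> bool"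
  where "lie_algebra_rep n V \<rho> \<longleftrightarrow>
     (\<forall>\<xi>\<in>g1_alg n. \<forall>s\<in>V. \<rho> \<xi> s \<in> V) \<and>
     (\<forall>\<xi>\<in>g1_alg n. \<forall>s\<in>V. \<forall>t\<in>V. \<forall>z w.
        \<rho> \<xi> (\<lambda>x. z * s x + w * t x) = (\<lambda>x. z * \<rho> \<xi> s x + w * \<rho> \<xi> t x)) \<and>
     (\<forall>\<xi>\<in>g1_alg n. \<forall>\<eta>\<in>g1_alg n. \<forall>s\<in>V. \<forall>\<alpha> \<beta> :: real.
        \<rho> (\<alpha> \<cdot>\<^sub>m \<xi> + \<beta> \<cdot>\<^sub>m \<eta>) s = (\<lambda>x. complex_of_real \<alpha> * \<rho> \<xi> s x + complex_of_real \<beta> * \<rho> \<eta> s x)) \<and>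
     (\<forall>\<xi>\<in>g1_alg n. \<forall>\<eta>\<in>g1_alg n. \<forall>s\<in>V.
        \<rho> (\<xi> * \<eta> - \<eta> * \<xi>) s = (\<lambda>x. \<rho> \<xi> (\<rho> \<eta> s) x - \<rho> \<eta> (\<rho> \<xi> s) x))"

definition group_rep :: "nat \<Rightarrow> ('x \<Rightarrow> complex) set \<Rightarrow> (real mat \<Rightarrow> ('x \<Rightarrow> complex) \<Rightarrow> 'x \<Rightarrow> complex) \<Rightarrow> bool"
  where "group_rep n V R \<longleftrightarrow>
     (\<forall>g\<in>G1 n. \<forall>s\<in>V. R g s \<in> V) \<and>
     (\<forall>g\<in>G1 n. \<forall>s\<in>V. \<forall>t\<in>V. \<forall>z w.
        R g (\<lambda>x. z * s x + w * t x) = (\<lambda>x. z * R g s x + w * R g t x)) \<and>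
     (\<forall>s\<in>V. R (1\<^sub>m n) s = s) \<and>
     (\<forall>g\<in>G1 n. \<forall>h\<in>G1 n. \<forall>s\<in>V. R (g * h) s = R g (R h s))"

text \<open>
  The completion of a space \<open>V\<close> of complex functions with inner product \<open>ip\<close>: Cauchy sequences
  modulo null sequences, with the operations induced from \<open>V\<close>.
\<close>

definition ip_norm :: "(('x \<Rightarrow> complex) \<Rightarrow> ('x \<Rightarrow> complex) \<Rightarrow> complex) \<Rightarrow> ('x \<Rightarrow> complex) \<Rightarrow> real" where
  "ip_norm ip s = sqrt (Re (ip s s))"

definition cauchy_seqs ::
  "('x \<Rightarrow> complex) set \<Rightarrow> (('x \<Rightarrow> complex) \<Rightarrow> ('x \<Rightarrow> complex) \<Rightarrow> complex) \<Rightarrow> (nat \<Rightarrow> 'x \<Rightarrow> complex) set" where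
  "cauchy_seqs V ip = {f. (\<forall>k. f k \<in> V) \<and>
     (\<forall>\<epsilon>>0. \<exists>N. \<forall>j\<ge>N. \<forall>k\<ge>N. ip_norm ip (\<lambda>x. f j x - f k x) < \<epsilon>)}"

definition null_rel ::
  "('x \<Rightarrow> complex) set \<Rightarrow> (('x \<Rightarrow> complex) \<Rightarrow> ('x \<Rightarrow> complex) \<Rightarrow> complex) \<Rightarrow> (nat \<Rightarrow> 'x \<Rightarrow> complex) rel" where
  "null_rel V ip = {(f, g). f \<in> cauchy_seqs V ip \<and> g \<in> cauchy_seqs V ip \<and>
     (\<lambda>k. ip_norm ip (\<lambda>x. f k x - g k x)) \<longlonglongrightarrow> 0}"

type_synonym 'x compl = "(nat \<Rightarrow> 'x \<Rightarrow> complex) set"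

definition completion ::
  "('x \<Rightarrow> complex) set \<Rightarrow> (('x \<Rightarrow> complex) \<Rightarrow> ('x \<Rightarrow> complex) \<Rightarrow> complex) \<Rightarrow> 'x compl set" where
  "completion V ip = cauchy_seqs V ip // null_rel V ip"

definition compl_emb ::
  "('x \<Rightarrow> complex) set \<Rightarrow> (('x \<Rightarrow> complex) \<Rightarrow> ('x \<Rightarrow> complex) \<Rightarrow> complex) \<Rightarrow> ('x \<Rightarrow> complex) \<Rightarrow> 'x compl" where
  "compl_emb V ip s = null_rel V ip `` {\<lambda>_. s}"

definition compl_lin ::
  "('x \<Rightarrow> complex) set \<Rightarrow> (('x \<Rightarrow> complex) \<Rightarrow> ('x \<Rightarrow> complex) \<Rightarrow> complex) \<Rightarrow>
   complex \<Rightarrow> 'x compl \<Rightarrow> complex \<Rightarrow> 'x compl \<Rightarrow> 'x compl" where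
  "compl_lin V ip z A w B =
     (\<Union>f\<in>A. \<Union>g\<in>B. null_rel V ip `` {\<lambda>k x. z * f k x + w * g k x})"

definition compl_inner ::
  "(('x \<Rightarrow> complex) \<Rightarrow> ('x \<Rightarrow> complex) \<Rightarrow> complex) \<Rightarrow> 'x compl \<Rightarrow> 'x compl \<Rightarrow> complex" where
  "compl_inner ip A B = (THE l. \<forall>f\<in>A. \<forall>g\<in>B. (\<lambda>k. ip (f k) (g k)) \<longlonglongrightarrow> l)"

definition compl_dist ::
  "('x \<Rightarrow> complex) set \<Rightarrow> (('x \<Rightarrow> complex) \<Rightarrow> ('x \<Rightarrow> complex) \<Rightarrow> complex) \<Rightarrow> 'x compl \<Rightarrow> 'x compl \<Rightarrow> real" where
  "compl_dist V ip A B =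
     (let D = compl_lin V ip 1 A (- 1) B in sqrt (Re (compl_inner ip D D)))"

text \<open>
  Unitary representations of \<open>G\<^sub>1\<close> on the completion, including strong continuity. As \<open>G\<^sub>1\<close> carries
  the topology of entrywise convergence, which is metrizable, sequences suffice.
\<close>

definition unitary_rep ::
  "nat \<Rightarrow> ('x \<Rightarrow> complex) set \<Rightarrow> (('x \<Rightarrow> complex) \<Rightarrow> ('x \<Rightarrow> complex) \<Rightarrow> complex) \<Rightarrow>
   (real mat \<Rightarrow> 'x compl \<Rightarrow> 'x compl) \<Rightarrow> bool" where
  "unitary_rep n V ip U \<longleftrightarrow>
     (\<forall>g\<in>G1 n. bij_betw (U g) (completion V ip) (completion V ip)) \<and>
     (\<forall>g\<in>G1 n. \<forall>A\<in>completion V ip. \<forall>B\<in>completion V ip. \<forall>z w.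
        U g (compl_lin V ip z A w B) = compl_lin V ip z (U g A) w (U g B)) \<and>
     (\<forall>g\<in>G1 n. \<forall>A\<in>completion V ip. \<forall>B\<in>completion V ip.
        compl_inner ip (U g A) (U g B) = compl_inner ip A B) \<and>
     (\<forall>A\<in>completion V ip. U (1\<^sub>m n) A = A) \<and>
     (\<forall>g\<in>G1 n. \<forall>h\<in>G1 n. \<forall>A\<in>completion V ip. U (g * h) A = U g (U h A)) \<and>
     (\<forall>g\<in>G1 n. \<forall>\<gamma>. (\<forall>k. \<gamma> k \<in> G1 n) \<and>
          (\<forall>i<n. \<forall>j<n. (\<lambda>k. \<gamma> k $$ (i, j)) \<longlonglongrightarrow> g $$ (i, j)) \<longrightarrow>
        (\<forall>A\<in>completion V ip. (\<lambda>k. compl_dist V ip (U (\<gamma> k) A) (U g A)) \<longlonglongrightarrow> 0))"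

end

theory Submission
  imports Defs "HOL-Probability.Distributions"
begin

text \<open>
  In the coordinates \<open>(a, p)\<close> the Hamiltonian of \<open>\<xi>\<close> is affine in \<open>p\<close>, namely
  \<open>\<phi>\<^sub>\<xi> = (\<Sum>i. (\<xi>\<^sub>i\<^sub>i - \<xi>\<^sub>i\<^sub>+\<^sub>1\<^sub>,\<^sub>i\<^sub>+\<^sub>1) p\<^sub>i) + V\<^sub>\<xi>(a)\<close> with \<open>V\<^sub>\<xi>(a) = \<xi>\<^sub>n\<^sub>n c + (\<Sum>i. \<xi>\<^sub>i\<^sub>+\<^sub>1\<^sub>,\<^sub>i a\<^sub>i)\<close> (\<open>toda_phi_eq\<close>). In the operator
  \<open>\<rho>(\<xi>)\<close> the part linear in \<open>p\<close> cancels against \<open>\<theta>(X\<^sub>\<phi>)\<close>, and on functions of \<open>a\<close> there remains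
  \<open>\<rho>(\<xi>) = - (\<Sum>i. (\<xi>\<^sub>i\<^sub>i - \<xi>\<^sub>i\<^sub>+\<^sub>1\<^sub>,\<^sub>i\<^sub>+\<^sub>1) a\<^sub>i \<partial>/\<partial>a\<^sub>i) + 2\<pi>\<i> V\<^sub>\<xi>\<close> (\<open>toda_rho_eq\<close>): an Euler vector field plus a multiplication
  operator. Both the invariance of the polarization and the bracket relation (\<open>toda_rho_bracket\<close>) can be
  read off from this formula. Only the diagonal and the first subdiagonal of \<open>\<xi>\<close> enter.

  Such an operator integrates explicitly. The group acts by
  \<open>(g s)(a) = exp (2\<pi>\<i> (c ln g\<^sub>n\<^sub>n + (\<Sum>i. (g\<^sub>i\<^sub>+\<^sub>1\<^sub>,\<^sub>i / g\<^sub>i\<^sub>i) a\<^sub>i))) s(b)\<close> with \<open>b\<^sub>i = (g\<^sub>i\<^sub>+\<^sub>1\<^sub>,\<^sub>i\<^sub>+\<^sub>1 / g\<^sub>i\<^sub>i) a\<^sub>i\<close>.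
  Multiplicativity is the cocycle identity for \<open>g\<^sub>i\<^sub>+\<^sub>1\<^sub>,\<^sub>i / g\<^sub>i\<^sub>i\<close>, which holds because products of lower
  triangular matrices have the obvious diagonal and first subdiagonal (\<open>toda_rep_mult\<close>). Differentiating
  at the identity with the chain rule returns \<open>\<rho>\<close> (\<open>toda_rep_derivative\<close>).

  The density of the positively oriented \<open>\<omega>\<^sup>n\<^sup>-\<^sup>1\<close> is \<open>(n - 1)! / (a\<^sub>1 \<cdots> a\<^sub>n\<^sub>-\<^sub>1)\<close> (\<open>liouville_density_eq\<close>), so that
  integrating out \<open>p\<close> against the Gaussian gives the norm formula with \<open>C = (n - 1)! (sqrt \<pi>)\<^sup>n\<^sup>-\<^sup>1\<close>
  (\<open>toda_normsq_eq\<close>). The measure \<open>da / a\<close> is invariant under dilations and the phase has modulus one,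
  so the action is isometric (\<open>toda_normsq_rep\<close>). Isometries extend to the completion
  (\<open>unitary_rep_completion\<close>). For strong continuity, \<open>g\<^sub>k s\<close> converges to \<open>g s\<close> pointwise and with constant norm
  whenever \<open>g\<^sub>k\<close> converges to \<open>g\<close>, which forces convergence in \<open>L\<^sup>2\<close> (\<open>L2_convergence_of_norms\<close>).
\<close>

section \<open>Partial derivatives on the coordinate domain\<close>

lemma tendsto_fun_coordinatewise:
  fixes f :: "'c \<Rightarrow> 'a \<Rightarrow> 'b::topological_space"
  assumes "\<And>i. ((\<lambda>k. f k i) \<longlongrightarrow> l i) F"
  shows "(f \<longlongrightarrow> l) F"
proof -
  have "limitin (product_topology (\<lambda>i. euclidean) UNIV) f l F"
    unfolding limitin_componentwise using assms by simp
  then show ?thesis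
    by (simp add: euclidean_product_topology)
qed

lemma toda_dom_iff:
  "x \<in> toda_dom n \<longleftrightarrow> (\<forall>i<n-1. 0 < fst x i) \<and> (\<forall>i\<ge>n-1. fst x i = undefined \<and> snd x i = undefined)"
  by (cases x) (auto simp: toda_dom_def toda_dom_a_def toda_dom_p_def PiE_iff extensional_def)

lemma toda_dom_upd_a:
  assumes "x \<in> toda_dom n" "i < n - 1" "0 < t"
  shows "((fst x)(i := t), snd x) \<in> toda_dom n"
  using assms by (auto simp: toda_dom_iff)

lemma toda_dom_upd_p:
  assumes "x \<in> toda_dom n" "i < n - 1"
  shows "(fst x, (snd x)(i := t)) \<in> toda_dom n"
  using assms by (auto simp: toda_dom_iff)

abbreviation has_pd_a :: "nat \<Rightarrow> (coords \<Rightarrow> 'b::real_normed_vector) \<Rightarrow> 'b \<Rightarrow> coords \<Rightarrow> bool" where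
  "has_pd_a i f D x \<equiv> ((\<lambda>t. f ((fst x)(i := t), snd x)) has_vector_derivative D) (at (fst x i))"

abbreviation has_pd_p :: "nat \<Rightarrow> (coords \<Rightarrow> 'b::real_normed_vector) \<Rightarrow> 'b \<Rightarrow> coords \<Rightarrow> bool" where
  "has_pd_p i f D x \<equiv> ((\<lambda>t. f (fst x, (snd x)(i := t))) has_vector_derivative D) (at (snd x i))"

lemma has_pd_a_diff: "diff_a i f x \<longleftrightarrow> has_pd_a i f (pd_a i f x) x"
  unfolding diff_a_def pd_a_def by (rule vector_derivative_works)

lemma has_pd_p_diff: "diff_p i f x \<longleftrightarrow> has_pd_p i f (pd_p i f x) x"
  unfolding diff_p_def pd_p_def by (rule vector_derivative_works)

lemma pd_a_eq: "has_pd_a i f D x \<Longrightarrow> pd_a i f x = D"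
  unfolding pd_a_def by (rule vector_derivative_at)

lemma pd_p_eq: "has_pd_p i f D x \<Longrightarrow> pd_p i f x = D"
  unfolding pd_p_def by (rule vector_derivative_at)

lemma has_pd_a_imp_diff: "has_pd_a i f D x \<Longrightarrow> diff_a i f x"
  unfolding diff_a_def by (auto intro: differentiableI_vector)

lemma has_pd_p_imp_diff: "has_pd_p i f D x \<Longrightarrow> diff_p i f x"
  unfolding diff_p_def by (auto intro: differentiableI_vector)

lemma has_pd_a_cong:
  assumes "has_pd_a i f D x" "x \<in> toda_dom n" "i < n - 1" "\<And>y. y \<in> toda_dom n \<Longrightarrow> f y = g y"
  shows "has_pd_a i g D x"
proof (rule has_vector_derivative_transform_within_open[OF assms(1), of "{0<..}"])
  show "fst x i \<in> {0<..}" using assms by (simp add: toda_dom_iff)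
qed (use assms toda_dom_upd_a in auto)

lemma has_pd_p_cong:
  assumes "has_pd_p i f D x" "x \<in> toda_dom n" "i < n - 1" "\<And>y. y \<in> toda_dom n \<Longrightarrow> f y = g y"
  shows "has_pd_p i g D x"
proof (rule has_vector_derivative_transform_within_open[OF assms(1), of "UNIV"])
qed (use assms toda_dom_upd_p in auto)

lemma pd_a_cong:
  fixes f g :: "coords \<Rightarrow> 'b::real_normed_vector"
  assumes "x \<in> toda_dom n" "i < n - 1" "\<And>y. y \<in> toda_dom n \<Longrightarrow> f y = g y"
  shows "pd_a i f x = pd_a i g x" "diff_a i f x \<longleftrightarrow> diff_a i g x"
proof -
  have *: "has_pd_a i f D x \<longleftrightarrow> has_pd_a i g D x" for D :: 'b
    using has_pd_a_cong[where f = f and g = g and x = x and D = D and i = i and n = n] has_pd_a_cong[where f = g and g = f and x = x and D = D and i = i and n = n] assms by auto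
  show "diff_a i f x \<longleftrightarrow> diff_a i g x"
    using * has_pd_a_diff has_pd_a_imp_diff by blast
  show "pd_a i f x = pd_a i g x"
    unfolding pd_a_def vector_derivative_def by (simp only: *)
qed

lemma pd_p_cong:
  fixes f g :: "coords \<Rightarrow> 'b::real_normed_vector"
  assumes "x \<in> toda_dom n" "i < n - 1" "\<And>y. y \<in> toda_dom n \<Longrightarrow> f y = g y"
  shows "pd_p i f x = pd_p i g x" "diff_p i f x \<longleftrightarrow> diff_p i g x"
proof -
  have *: "has_pd_p i f D x \<longleftrightarrow> has_pd_p i g D x" for D :: 'b
    using has_pd_p_cong[where f = f and g = g and x = x and D = D and i = i and n = n] has_pd_p_cong[where f = g and g = f and x = x and D = D and i = i and n = n] assms by auto
  show "diff_p i f x \<longleftrightarrow> diff_p i g x"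
    using * has_pd_p_diff has_pd_p_imp_diff by blast
  show "pd_p i f x = pd_p i g x"
    unfolding pd_p_def vector_derivative_def by (simp only: *)
qed

lemma toda_Ck_cong:
  assumes "\<And>y. y \<in> toda_dom n \<Longrightarrow> f y = g y"
  shows "toda_Ck n k f \<longleftrightarrow> toda_Ck n k g"
  using assms
proof (induction k arbitrary: f g)
  case 0
  then show ?case by (simp cong: continuous_on_cong)
next
  case (Suc k)
  have c: "continuous_on (toda_dom n) f \<longleftrightarrow> continuous_on (toda_dom n) g"
    using Suc.prems by (simp cong: continuous_on_cong)
  have "toda_Ck n k (pd_a i f) \<longleftrightarrow> toda_Ck n k (pd_a i g)" if "i < n - 1" for i
    by (rule Suc.IH) (rule pd_a_cong(1)[OF _ that Suc.prems])
  moreover have "toda_Ck n k (pd_p i f) \<longleftrightarrow> toda_Ck n k (pd_p i g)" if "i < n - 1" for i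
    by (rule Suc.IH) (rule pd_p_cong(1)[OF _ that Suc.prems])
  ultimately show ?case
    using c pd_a_cong(2)[of _ n _ f g] pd_p_cong(2)[of _ n _ f g] Suc.prems
    by simp
qed

text \<open>
  The partial derivatives produced by \<open>pd_a\<close> and \<open>pd_p\<close> have values off the domain as well, which carry
  no information. It is therefore convenient that a class of functions closed under differentiation
  need only contain functions agreeing with the derivatives on the domain.
\<close>

lemma toda_smooth_coinduct:
  assumes "f \<in> S"
    and cont: "\<And>g. g \<in> S \<Longrightarrow> continuous_on (toda_dom n) g"
    and a: "\<And>g i. g \<in> S \<Longrightarrow> i < n - 1 \<Longrightarrow> \<exists>h\<in>S. \<forall>x\<in>toda_dom n. has_pd_a i g (h x) x"
    and p: "\<And>g i. g \<in> S \<Longrightarrow> i < n - 1 \<Longrightarrow> \<exists>h\<in>S. \<forall>x\<in>toda_dom n. has_pd_p i g (h x) x"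
  shows "toda_smooth n f"
proof -
  have "toda_Ck n k g" if "g \<in> S" for k g
    using that
  proof (induction k arbitrary: g)
    case 0
    then show ?case by (simp add: cont)
  next
    case (Suc k)
    have "(\<forall>x\<in>toda_dom n. diff_a i g x \<and> diff_p i g x) \<and> toda_Ck n k (pd_a i g) \<and> toda_Ck n k (pd_p i g)"
      if i: "i < n - 1" for i
    proof -
      obtain h where h: "h \<in> S" "\<And>x. x \<in> toda_dom n \<Longrightarrow> has_pd_a i g (h x) x" using a Suc.prems i by metis
      obtain h' where h': "h' \<in> S" "\<And>x. x \<in> toda_dom n \<Longrightarrow> has_pd_p i g (h' x) x" using p Suc.prems i by metis
      have "toda_Ck n k (pd_a i g) \<longleftrightarrow> toda_Ck n k h"
        by (rule toda_Ck_cong) (rule pd_a_eq[OF h(2)])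
      moreover have "toda_Ck n k (pd_p i g) \<longleftrightarrow> toda_Ck n k h'"
        by (rule toda_Ck_cong) (rule pd_p_eq[OF h'(2)])
      moreover have "diff_a i g x \<and> diff_p i g x" if "x \<in> toda_dom n" for x
        using has_pd_a_imp_diff[OF h(2)[OF that]] has_pd_p_imp_diff[OF h'(2)[OF that]] by blast
      ultimately show ?thesis
        using h(1) h'(1) Suc.IH by blast
    qed
    then show ?case using cont[OF Suc.prems] by simp
  qed
  then show ?thesis using assms(1) by (simp add: toda_smooth_def)
qed

lemma toda_smooth_cont: "toda_smooth n f \<Longrightarrow> continuous_on (toda_dom n) f"
  by (drule toda_smooth_def[THEN iffD1, THEN spec, of _ _ 0]) simp

lemma toda_smooth_pd:
  assumes "toda_smooth n f" "i < n - 1"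
  shows "toda_smooth n (pd_a i f)" "toda_smooth n (pd_p i f)"
    "\<And>x. x \<in> toda_dom n \<Longrightarrow> has_pd_a i f (pd_a i f x) x"
    "\<And>x. x \<in> toda_dom n \<Longrightarrow> has_pd_p i f (pd_p i f x) x"
proof -
  have *: "toda_Ck n (Suc k) f" for k
    using assms(1) unfolding toda_smooth_def by blast
  show "toda_smooth n (pd_a i f)" "toda_smooth n (pd_p i f)"
    unfolding toda_smooth_def using * assms(2) by auto
  show "\<And>x. x \<in> toda_dom n \<Longrightarrow> has_pd_a i f (pd_a i f x) x"
    "\<And>x. x \<in> toda_dom n \<Longrightarrow> has_pd_p i f (pd_p i f x) x"
    using *[of 0] assms(2) by (auto simp flip: has_pd_a_diff has_pd_p_diff)
qed

lemma toda_smooth_cong: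
  assumes "\<And>y. y \<in> toda_dom n \<Longrightarrow> f y = g y"
  shows "toda_smooth n f \<longleftrightarrow> toda_smooth n g"
proof -
  have "toda_Ck n k f \<longleftrightarrow> toda_Ck n k g" for k
    by (rule toda_Ck_cong) (rule assms)
  then show ?thesis by (simp add: toda_smooth_def)
qed

text \<open>
  The components from \<open>n - 1\<close> on are left alone: on points of \<open>toda_dom n\<close> they are \<open>undefined\<close>, and the
  image must again be such a point.
\<close>

definition scale_a :: "nat \<Rightarrow> (nat \<Rightarrow> real) \<Rightarrow> coords \<Rightarrow> coords" where
  "scale_a n l x = ((\<lambda>i. if i < n - 1 then l i * fst x i else fst x i), snd x)"

lemma scale_a_dom:
  assumes "\<forall>i<n - 1. 0 < l i" "x \<in> toda_dom n"
  shows "scale_a n l x \<in> toda_dom n"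
  using assms by (auto simp: toda_dom_iff scale_a_def)

lemma continuous_on_coords [continuous_intros]:
  "continuous_on S (\<lambda>x::coords. fst x i)" "continuous_on S (\<lambda>x::coords. snd x i)"
  by (rule continuous_on_product_then_coordinatewise[OF continuous_on_fst[OF continuous_on_id]]
      continuous_on_product_then_coordinatewise[OF continuous_on_snd[OF continuous_on_id]])+

lemma continuous_on_scale_a: "continuous_on S (scale_a n l)"
  unfolding scale_a_def
proof (intro continuous_on_Pair continuous_on_coordinatewise_then_product continuous_intros)
  fix i show "continuous_on S (\<lambda>x. if i < n - 1 then l i * fst x i else fst x i)"
    by (cases "i < n - 1") (auto intro!: continuous_intros)
qed

text \<open>
  Every function whose smoothness is at stake below is put together from smooth sections, the
  coordinates \<open>a\<^sub>i\<close>, exponentials and dilations. Since this class is closed under partial derivatives,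
  the coinduction principle gives smoothness of all its members at once.
\<close>

inductive smooth_expr :: "nat \<Rightarrow> (coords \<Rightarrow> complex) \<Rightarrow> bool" for n where
  smooth: "toda_smooth n f \<Longrightarrow> smooth_expr n f"
| const: "smooth_expr n (\<lambda>_. z)"
| coord: "i < n - 1 \<Longrightarrow> smooth_expr n (\<lambda>x. complex_of_real (fst x i))"
| add: "smooth_expr n f \<Longrightarrow> smooth_expr n g \<Longrightarrow> smooth_expr n (\<lambda>x. f x + g x)"
| mult: "smooth_expr n f \<Longrightarrow> smooth_expr n g \<Longrightarrow> smooth_expr n (\<lambda>x. f x * g x)"
| exp: "smooth_expr n f \<Longrightarrow> smooth_expr n (\<lambda>x. exp (f x))"
| scale: "smooth_expr n f \<Longrightarrow> \<forall>i<n - 1. 0 < l i \<Longrightarrow> smooth_expr n (\<lambda>x. f (scale_a n l x))"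

lemma smooth_expr_cont:
  assumes "smooth_expr n f"
  shows "continuous_on (toda_dom n) f"
  using assms
proof (induction rule: smooth_expr.induct)
  case (scale f l)
  have "continuous_on (toda_dom n) (f \<circ> scale_a n l)"
    by (rule continuous_on_compose[OF continuous_on_scale_a continuous_on_subset[OF scale.IH]])
      (use scale.hyps scale_a_dom in blast)
  then show ?case by (simp add: o_def)
qed (simp_all add: toda_smooth_cont continuous_on_coords continuous_on_of_real continuous_on_add continuous_on_mult continuous_on_exp)

lemma has_vector_derivative_exp_comp:
  fixes f :: "real \<Rightarrow> complex"
  assumes "(f has_vector_derivative D) (at t)"
  shows "((\<lambda>t. exp (f t)) has_vector_derivative D * exp (f t)) (at t)"
  using field_vector_diff_chain_at[OF assms, of exp "exp (f t)"] DERIV_exp[of "f t"]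
  by (simp add: o_def)

lemma smooth_expr_pd_a:
  assumes "smooth_expr n f" "i < n - 1"
  shows "\<exists>h. smooth_expr n h \<and> (\<forall>x\<in>toda_dom n. has_pd_a i f (h x) x)"
  using assms(1)
proof (induction rule: smooth_expr.induct)
  case (smooth f)
  then show ?case using toda_smooth_pd[OF smooth assms(2)] smooth_expr.smooth by blast
next
  case (const z)
  show ?case by (intro exI[of _ "\<lambda>_. 0"]) (auto intro: smooth_expr.const)
next
  case (coord j)
  have "has_pd_a i (\<lambda>x. complex_of_real (fst x j)) (if i = j then 1 else 0) x" for x
    by (cases "i = j") (auto intro!: derivative_eq_intros)
  then show ?case by (intro exI[of _ "\<lambda>_. if i = j then 1 else 0"]) (simp only: smooth_expr.const simp_thms ball_triv)
next
  case (add f g)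
  then obtain h k where hk: "smooth_expr n h" "\<forall>x\<in>toda_dom n. has_pd_a i f (h x) x"
    "smooth_expr n k" "\<forall>x\<in>toda_dom n. has_pd_a i g (k x) x" by blast
  have D: "has_pd_a i (\<lambda>x. f x + g x) (h x + k x) x" if "x \<in> toda_dom n" for x
    by (rule has_vector_derivative_add[OF hk(2)[rule_format, OF that] hk(4)[rule_format, OF that]])
  show ?case
  proof (intro exI[of _ "\<lambda>x. h x + k x"] conjI ballI)
    show "smooth_expr n (\<lambda>x. h x + k x)"
      by (rule smooth_expr.add hk)+
  qed (rule D)
next
  case (mult f g)
  then obtain h k where hk: "smooth_expr n h" "\<forall>x\<in>toda_dom n. has_pd_a i f (h x) x"
    "smooth_expr n k" "\<forall>x\<in>toda_dom n. has_pd_a i g (k x) x" by blast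
  have D: "has_pd_a i (\<lambda>x. f x * g x) (f x * k x + h x * g x) x" if "x \<in> toda_dom n" for x
    using has_vector_derivative_mult[OF hk(2)[rule_format, OF that] hk(4)[rule_format, OF that]] by simp
  show ?case
  proof (intro exI[of _ "\<lambda>x. f x * k x + h x * g x"] conjI ballI)
    show "smooth_expr n (\<lambda>x. f x * k x + h x * g x)"
      by (rule smooth_expr.add smooth_expr.mult hk mult.hyps)+
  qed (rule D)
next
  case (exp f)
  then obtain h where h: "smooth_expr n h" "\<forall>x\<in>toda_dom n. has_pd_a i f (h x) x" by blast
  have D: "has_pd_a i (\<lambda>x. exp (f x)) (h x * exp (f x)) x" if "x \<in> toda_dom n" for x
    using has_vector_derivative_exp_comp[OF h(2)[rule_format, OF that]] by simp
  show ?case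
  proof (intro exI[of _ "\<lambda>x. h x * exp (f x)"] conjI ballI)
    show "smooth_expr n (\<lambda>x. h x * exp (f x))"
      by (rule smooth_expr.mult smooth_expr.exp h exp.hyps)+
  qed (rule D)
next
  case (scale f l)
  then obtain h where h: "smooth_expr n h" "\<forall>x\<in>toda_dom n. has_pd_a i f (h x) x" by blast
  have D: "has_pd_a i (\<lambda>x. f (scale_a n l x)) (complex_of_real (l i) * h (scale_a n l x)) x"
    if x: "x \<in> toda_dom n" for x
  proof -
    let ?y = "scale_a n l x"
    have y: "?y \<in> toda_dom n" by (rule scale_a_dom[OF scale.hyps(2) x])
    have eq: "scale_a n l ((fst x)(i := t), snd x) = ((fst ?y)(i := l i * t), snd ?y)" for t
      using assms(2) by (auto simp: scale_a_def)
    have fy: "fst ?y i = l i * fst x i" using assms(2) by (simp add: scale_a_def)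
    have "((\<lambda>t. l i * t) has_vector_derivative l i) (at (fst x i))"
      by (auto intro!: derivative_eq_intros simp: has_real_derivative_iff_has_vector_derivative[symmetric])
    then have "((\<lambda>t. f ((fst ?y)(i := l i * t), snd ?y)) has_vector_derivative l i *\<^sub>R h ?y) (at (fst x i))"
      using vector_diff_chain_at[of "\<lambda>t. l i * t" "l i" "fst x i" "\<lambda>t. f ((fst ?y)(i := t), snd ?y)" "h ?y"]
        h(2)[rule_format, OF y] by (simp add: o_def fy)
    then show ?thesis by (simp only: eq scaleR_conv_of_real)
  qed
  show ?case
  proof (intro exI[of _ "\<lambda>x. complex_of_real (l i) * h (scale_a n l x)"] conjI ballI)
    show "smooth_expr n (\<lambda>x. complex_of_real (l i) * h (scale_a n l x))"
      by (rule smooth_expr.mult smooth_expr.const smooth_expr.scale h scale.hyps)+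
  qed (rule D)
qed

lemma smooth_expr_pd_p:
  assumes "smooth_expr n f" "i < n - 1"
  shows "\<exists>h. smooth_expr n h \<and> (\<forall>x\<in>toda_dom n. has_pd_p i f (h x) x)"
  using assms(1)
proof (induction rule: smooth_expr.induct)
  case (smooth f)
  then show ?case using toda_smooth_pd[OF smooth assms(2)] smooth_expr.smooth by blast
next
  case (const z)
  show ?case by (intro exI[of _ "\<lambda>_. 0"]) (auto intro: smooth_expr.const)
next
  case (coord j)
  show ?case by (intro exI[of _ "\<lambda>_. 0"]) (auto intro: smooth_expr.const)
next
  case (add f g)
  then obtain h k where hk: "smooth_expr n h" "\<forall>x\<in>toda_dom n. has_pd_p i f (h x) x"
    "smooth_expr n k" "\<forall>x\<in>toda_dom n. has_pd_p i g (k x) x" by blast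
  have D: "has_pd_p i (\<lambda>x. f x + g x) (h x + k x) x" if "x \<in> toda_dom n" for x
    by (rule has_vector_derivative_add[OF hk(2)[rule_format, OF that] hk(4)[rule_format, OF that]])
  show ?case
  proof (intro exI[of _ "\<lambda>x. h x + k x"] conjI ballI)
    show "smooth_expr n (\<lambda>x. h x + k x)"
      by (rule smooth_expr.add hk)+
  qed (rule D)
next
  case (mult f g)
  then obtain h k where hk: "smooth_expr n h" "\<forall>x\<in>toda_dom n. has_pd_p i f (h x) x"
    "smooth_expr n k" "\<forall>x\<in>toda_dom n. has_pd_p i g (k x) x" by blast
  have D: "has_pd_p i (\<lambda>x. f x * g x) (f x * k x + h x * g x) x" if "x \<in> toda_dom n" for x
    using has_vector_derivative_mult[OF hk(2)[rule_format, OF that] hk(4)[rule_format, OF that]] by simp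
  show ?case
  proof (intro exI[of _ "\<lambda>x. f x * k x + h x * g x"] conjI ballI)
    show "smooth_expr n (\<lambda>x. f x * k x + h x * g x)"
      by (rule smooth_expr.add smooth_expr.mult hk mult.hyps)+
  qed (rule D)
next
  case (exp f)
  then obtain h where h: "smooth_expr n h" "\<forall>x\<in>toda_dom n. has_pd_p i f (h x) x" by blast
  have D: "has_pd_p i (\<lambda>x. exp (f x)) (h x * exp (f x)) x" if "x \<in> toda_dom n" for x
    using has_vector_derivative_exp_comp[OF h(2)[rule_format, OF that]] by simp
  show ?case
  proof (intro exI[of _ "\<lambda>x. h x * exp (f x)"] conjI ballI)
    show "smooth_expr n (\<lambda>x. h x * exp (f x))"
      by (rule smooth_expr.mult smooth_expr.exp h exp.hyps)+
  qed (rule D)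
next
  case (scale f l)
  then obtain h where h: "smooth_expr n h" "\<forall>x\<in>toda_dom n. has_pd_p i f (h x) x" by blast
  have D: "has_pd_p i (\<lambda>x. f (scale_a n l x)) (h (scale_a n l x)) x"
    if x: "x \<in> toda_dom n" for x
  proof -
    let ?y = "scale_a n l x"
    have "scale_a n l (fst x, (snd x)(i := t)) = (fst ?y, (snd ?y)(i := t))" for t
      by (auto simp: scale_a_def)
    moreover have "snd ?y i = snd x i" by (simp add: scale_a_def)
    ultimately show ?thesis
      using h(2)[rule_format, OF scale_a_dom[OF scale.hyps(2) x]] by simp
  qed
  show ?case
  proof (intro exI[of _ "\<lambda>x. h (scale_a n l x)"] conjI ballI)
    show "smooth_expr n (\<lambda>x. h (scale_a n l x))"
      by (rule smooth_expr.scale h scale.hyps)+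
  qed (rule D)
qed

lemma smooth_expr_smooth:
  assumes "smooth_expr n f"
  shows "toda_smooth n f"
proof (rule toda_smooth_coinduct[of f "{f. smooth_expr n f}"])
  show "f \<in> {f. smooth_expr n f}" using assms by simp
  show "\<And>g. g \<in> {f. smooth_expr n f} \<Longrightarrow> continuous_on (toda_dom n) g"
    using smooth_expr_cont by simp
  show "\<exists>h\<in>{f. smooth_expr n f}. \<forall>x\<in>toda_dom n. has_pd_a i g (h x) x"
    if "g \<in> {f. smooth_expr n f}" "i < n - 1" for g i
    using smooth_expr_pd_a[of n g i] that by blast
  show "\<exists>h\<in>{f. smooth_expr n f}. \<forall>x\<in>toda_dom n. has_pd_p i g (h x) x"
    if "g \<in> {f. smooth_expr n f}" "i < n - 1" for g i
    using smooth_expr_pd_p[of n g i] that by blast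
qed

lemma smooth_expr_sum:
  assumes "\<And>i. i \<in> I \<Longrightarrow> smooth_expr n (f i)"
  shows "smooth_expr n (\<lambda>x. \<Sum>i\<in>I. f i x)"
  using assms by (induction I rule: infinite_finite_induct) (simp_all add: smooth_expr.const smooth_expr.add)

section \<open>Symmetry of second derivatives and the chain rule\<close>

lemma real_mvt_segment:
  fixes f f' :: "real \<Rightarrow> real"
  assumes "\<And>x. x \<in> closed_segment a b \<Longrightarrow> (f has_real_derivative f' x) (at x)"
  shows "\<exists>\<xi>\<in>closed_segment a b. f b - f a = (b - a) * f' \<xi>"
proof (cases a b rule: linorder_cases)
  case less
  have "\<exists>z>a. z < b \<and> f b - f a = (b - a) * f' z"
    by (rule MVT2[OF less]) (rule assms, use less in \<open>simp add: closed_segment_eq_real_ivl\<close>)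
  then obtain z where "a < z" "z < b" "f b - f a = (b - a) * f' z" by blast
  then show ?thesis by (intro bexI[of _ z]) (auto simp: closed_segment_eq_real_ivl)
next
  case greater
  have "\<exists>z>b. z < a \<and> f a - f b = (a - b) * f' z"
    by (rule MVT2[OF greater]) (rule assms, use greater in \<open>simp add: closed_segment_eq_real_ivl\<close>)
  then obtain z where "b < z" "z < a" "f a - f b = (a - b) * f' z" by blast
  then show ?thesis by (intro bexI[of _ z]) (auto simp: closed_segment_eq_real_ivl algebra_simps)
qed auto

text \<open>
  The second difference of \<open>f\<close> over a square of side \<open>h\<close> at \<open>(a, b)\<close> is \<open>h\<^sup>2\<close> times a value of either mixed
  derivative in that square: apply the mean value theorem in one order of the variables and in the
  other. By continuity the two values become equal as \<open>h\<close> tends to \<open>0\<close>.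
\<close>

lemma mixed_partials_commute:
  fixes f :: "real \<Rightarrow> real \<Rightarrow> real"
  assumes r: "0 < r"
    and fu: "\<And>u v. \<bar>u - a\<bar> < r \<Longrightarrow> \<bar>v - b\<bar> < r \<Longrightarrow> ((\<lambda>u. f u v) has_real_derivative fu u v) (at u)"
    and fv: "\<And>u v. \<bar>u - a\<bar> < r \<Longrightarrow> \<bar>v - b\<bar> < r \<Longrightarrow> ((\<lambda>v. f u v) has_real_derivative fv u v) (at v)"
    and fuv: "\<And>u v. \<bar>u - a\<bar> < r \<Longrightarrow> \<bar>v - b\<bar> < r \<Longrightarrow> ((\<lambda>v. fu u v) has_real_derivative fuv u v) (at v)"
    and fvu: "\<And>u v. \<bar>u - a\<bar> < r \<Longrightarrow> \<bar>v - b\<bar> < r \<Longrightarrow> ((\<lambda>u. fv u v) has_real_derivative fvu u v) (at u)"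
    and cuv: "((\<lambda>(u, v). fuv u v) \<longlongrightarrow> fuv a b) (nhds (a, b))"
    and cvu: "((\<lambda>(u, v). fvu u v) \<longlongrightarrow> fvu a b) (nhds (a, b))"
  shows "fuv a b = fvu a b"
proof -
  have ex: "\<exists>z w. dist z (a, b) < 2 * h \<and> dist w (a, b) < 2 * h \<and> (\<lambda>(u, v). fuv u v) z = (\<lambda>(u, v). fvu u v) w"
    if h: "0 < h" "h < r" for h
  proof -
    have "\<exists>\<xi>. a < \<xi> \<and> \<xi> < a + h \<and> (f (a + h) (b + h) - f (a + h) b) - (f a (b + h) - f a b) =
        (a + h - a) * (fu \<xi> (b + h) - fu \<xi> b)"
      using h by (intro MVT2[of a "a + h" "\<lambda>u. f u (b + h) - f u b"]) (auto intro!: derivative_eq_intros fu)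
    then obtain \<xi> where x: "a < \<xi>" "\<xi> < a + h" and
      1: "(f (a + h) (b + h) - f (a + h) b) - (f a (b + h) - f a b) = h * (fu \<xi> (b + h) - fu \<xi> b)" by auto
    have "\<exists>\<eta>. b < \<eta> \<and> \<eta> < b + h \<and> fu \<xi> (b + h) - fu \<xi> b = (b + h - b) * fuv \<xi> \<eta>"
      using h x by (intro MVT2[of b "b + h" "\<lambda>v. fu \<xi> v"]) (auto intro!: fuv)
    then obtain \<eta> where y: "b < \<eta>" "\<eta> < b + h" and 2: "fu \<xi> (b + h) - fu \<xi> b = h * fuv \<xi> \<eta>" by auto
    have "\<exists>\<eta>. b < \<eta> \<and> \<eta> < b + h \<and> (f (a + h) (b + h) - f a (b + h)) - (f (a + h) b - f a b) =
        (b + h - b) * (fv (a + h) \<eta> - fv a \<eta>)"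
      using h by (intro MVT2[of b "b + h" "\<lambda>v. f (a + h) v - f a v"]) (auto intro!: derivative_eq_intros fv)
    then obtain \<eta>' where y': "b < \<eta>'" "\<eta>' < b + h" and
      3: "(f (a + h) (b + h) - f a (b + h)) - (f (a + h) b - f a b) = h * (fv (a + h) \<eta>' - fv a \<eta>')" by auto
    have "\<exists>\<xi>. a < \<xi> \<and> \<xi> < a + h \<and> fv (a + h) \<eta>' - fv a \<eta>' = (a + h - a) * fvu \<xi> \<eta>'"
      using h y' by (intro MVT2[of a "a + h" "\<lambda>u. fv u \<eta>'"]) (auto intro!: fvu)
    then obtain \<xi>' where x': "a < \<xi>'" "\<xi>' < a + h" and 4: "fv (a + h) \<eta>' - fv a \<eta>' = h * fvu \<xi>' \<eta>'" by auto
    have "h * (h * fuv \<xi> \<eta>) = h * (h * fvu \<xi>' \<eta>')"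
      using 1 3 unfolding 2 4 by linarith
    then have "fuv \<xi> \<eta> = fvu \<xi>' \<eta>'" using h by simp
    moreover have near: "dist (u, v) (a, b) < 2 * h" if "a < u" "u < a + h" "b < v" "v < b + h" for u v
    proof -
      have "dist (u, v) (a, b) \<le> dist u a + dist v b"
        by (simp add: dist_Pair_Pair sqrt_sum_squares_le_sum)
      also have "\<dots> < 2 * h" using that by (simp add: dist_real_def)
      finally show ?thesis .
    qed
    ultimately show ?thesis
      by (intro exI[of _ "(\<xi>, \<eta>)"] exI[of _ "(\<xi>', \<eta>')"] conjI near x y x' y') simp
  qed
  show ?thesis
  proof (rule ccontr)
    assume ne: "fuv a b \<noteq> fvu a b"
    define e where "e = dist (fuv a b) (fvu a b) / 2"
    have e: "e > 0" using ne by (simp add: e_def)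
    obtain d1 where d1: "d1 > 0" "\<And>z. dist z (a, b) < d1 \<Longrightarrow> dist ((\<lambda>(u, v). fuv u v) z) (fuv a b) < e"
      using tendstoD[OF cuv e] unfolding eventually_nhds_metric by blast
    obtain d2 where d2: "d2 > 0" "\<And>z. dist z (a, b) < d2 \<Longrightarrow> dist ((\<lambda>(u, v). fvu u v) z) (fvu a b) < e"
      using tendstoD[OF cvu e] unfolding eventually_nhds_metric by blast
    define h where "h = Min {d1, d2, r} / 2"
    have h: "0 < h" "h < r" "2 * h \<le> d1" "2 * h \<le> d2" using d1(1) d2(1) r by (auto simp: h_def)
    obtain z w where "dist z (a, b) < 2 * h" "dist w (a, b) < 2 * h" "(\<lambda>(u, v). fuv u v) z = (\<lambda>(u, v). fvu u v) w"
      using ex[OF h(1,2)] by blast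
    then have "dist ((\<lambda>(u, v). fuv u v) z) (fuv a b) < e" "dist ((\<lambda>(u, v). fuv u v) z) (fvu a b) < e"
      using d1(2)[of z] d2(2)[of w] h(3,4) by (metis less_le_trans)+
    then have "dist (fuv a b) (fvu a b) < 2 * e"
      using dist_triangle2[of "fuv a b" "fvu a b" "(\<lambda>(u, v). fuv u v) z"] by (simp add: dist_commute)
    then show False by (simp add: e_def)
  qed
qed

lemma tendsto_coords:
  fixes y :: "'c \<Rightarrow> coords"
  assumes "\<And>i. ((\<lambda>k. fst (y k) i) \<longlongrightarrow> fst x i) F" "\<And>i. ((\<lambda>k. snd (y k) i) \<longlongrightarrow> snd x i) F"
  shows "(y \<longlongrightarrow> x) F"
proof -
  have "((\<lambda>k. (fst (y k), snd (y k))) \<longlongrightarrow> (fst x, snd x)) F"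
    by (intro tendsto_Pair tendsto_fun_coordinatewise assms)
  then show ?thesis by simp
qed

lemma mixed_pd_a_commute:
  fixes f :: "coords \<Rightarrow> complex"
  assumes f: "toda_smooth n f" and i: "i < n - 1" and j: "j < n - 1" and x: "x \<in> toda_dom n"
  shows "pd_a i (pd_a j f) x = pd_a j (pd_a i f) x"
proof (cases "i = j")
  case ne: False
  define y where "y u v = ((fst x)(i := u, j := v), snd x)" for u v
  have y0: "y (fst x i) (fst x j) = x" by (simp add: y_def)
  have pos: "0 < fst x i" "0 < fst x j" using x i j by (simp_all add: toda_dom_iff)
  have ydom: "y u v \<in> toda_dom n" if "0 < u" "0 < v" for u v
    using x i j that by (auto simp: toda_dom_iff y_def)
  define r where "r = min (fst x i) (fst x j)"
  have r: "0 < r" using pos by (simp add: r_def)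
  have rpos: "0 < u \<and> 0 < v" if "\<bar>u - fst x i\<bar> < r" "\<bar>v - fst x j\<bar> < r" for u v
    using that by (auto simp: r_def)
  have di: "((\<lambda>u. g (y u v)) has_vector_derivative pd_a i g (y u v)) (at u)"
    if "toda_smooth n g" "0 < u" "0 < v" for g :: "coords \<Rightarrow> complex" and u v
    using toda_smooth_pd(3)[OF that(1) i ydom[OF that(2,3)]] ne
    by (simp add: y_def fun_upd_twist[OF ne])
  have dj: "((\<lambda>v. g (y u v)) has_vector_derivative pd_a j g (y u v)) (at v)"
    if "toda_smooth n g" "0 < u" "0 < v" for g :: "coords \<Rightarrow> complex" and u v
    using toda_smooth_pd(3)[OF that(1) j ydom[OF that(2,3)]] by (simp add: y_def)
  have cont: "((\<lambda>(u, v). L (g (y u v))) \<longlongrightarrow> L (g (y (fst x i) (fst x j)))) (nhds (fst x i, fst x j))"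
    if "toda_smooth n g" and L: "bounded_linear L" for g :: "coords \<Rightarrow> complex" and L :: "complex \<Rightarrow> real"
  proof -
    have lim: "((\<lambda>z. y (fst z) (snd z)) \<longlongrightarrow> x) (nhds (fst x i, fst x j))"
    proof (rule tendsto_coords)
      fix k
      have 1: "(fst \<longlongrightarrow> fst x i) (nhds (fst x i, fst x j))" "(snd \<longlongrightarrow> fst x j) (nhds (fst x i, fst x j))"
        using tendsto_fst[OF filterlim_ident[of "nhds (fst x i, fst x j)"]]
          tendsto_snd[OF filterlim_ident[of "nhds (fst x i, fst x j)"]] by simp_all
      show "((\<lambda>z. fst (y (fst z) (snd z)) k) \<longlongrightarrow> fst x k) (nhds (fst x i, fst x j))"
        using 1 by (cases "k = i"; cases "k = j") (simp_all add: y_def)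
      show "((\<lambda>z. snd (y (fst z) (snd z)) k) \<longlongrightarrow> snd x k) (nhds (fst x i, fst x j))"
        by (simp add: y_def)
    qed
    have "open ({0<..} \<times> {0<..} :: (real \<times> real) set)" by (intro open_Times) auto
    then have "\<forall>\<^sub>F z in nhds (fst x i, fst x j). z \<in> {0<..} \<times> {0<..}"
      by (rule eventually_nhds_in_open) (simp add: pos)
    then have "\<forall>\<^sub>F z in nhds (fst x i, fst x j). y (fst z) (snd z) \<in> toda_dom n"
      by (rule eventually_mono) (auto intro: ydom)
    with lim have "((\<lambda>z. g (y (fst z) (snd z))) \<longlongrightarrow> g x) (nhds (fst x i, fst x j))"
      by (rule continuous_on_tendsto_compose[OF toda_smooth_cont[OF that(1)] _ x])
    from bounded_linear.tendsto[OF L this] show ?thesis by (simp add: case_prod_unfold y0)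
  qed
  have "L (pd_a j (pd_a i f) (y (fst x i) (fst x j))) = L (pd_a i (pd_a j f) (y (fst x i) (fst x j)))"
    if L: "bounded_linear L" for L :: "complex \<Rightarrow> real"
  proof (rule mixed_partials_commute[OF r, where f = "\<lambda>u v. L (f (y u v))"
        and fu = "\<lambda>u v. L (pd_a i f (y u v))" and fv = "\<lambda>u v. L (pd_a j f (y u v))"
        and fuv = "\<lambda>u v. L (pd_a j (pd_a i f) (y u v))" and fvu = "\<lambda>u v. L (pd_a i (pd_a j f) (y u v))"])
    fix u v assume "\<bar>u - fst x i\<bar> < r" "\<bar>v - fst x j\<bar> < r"
    then have uv: "0 < u" "0 < v" using rpos by auto
    note LD = bounded_linear.has_vector_derivative[OF L, folded has_real_derivative_iff_has_vector_derivative]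
    note fi = toda_smooth_pd(1)[OF f i] and fj = toda_smooth_pd(1)[OF f j]
    show "((\<lambda>u. L (f (y u v))) has_real_derivative L (pd_a i f (y u v))) (at u)" by (rule LD[OF di[OF f uv]])
    show "((\<lambda>v. L (f (y u v))) has_real_derivative L (pd_a j f (y u v))) (at v)" by (rule LD[OF dj[OF f uv]])
    show "((\<lambda>v. L (pd_a i f (y u v))) has_real_derivative L (pd_a j (pd_a i f) (y u v))) (at v)"
      by (rule LD[OF dj[OF fi uv]])
    show "((\<lambda>u. L (pd_a j f (y u v))) has_real_derivative L (pd_a i (pd_a j f) (y u v))) (at u)"
      by (rule LD[OF di[OF fj uv]])
  next
    show "((\<lambda>(u, v). L (pd_a j (pd_a i f) (y u v))) \<longlongrightarrow> L (pd_a j (pd_a i f) (y (fst x i) (fst x j))))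
        (nhds (fst x i, fst x j))"
      by (rule cont[OF toda_smooth_pd(1)[OF toda_smooth_pd(1)[OF f i] j] L])
    show "((\<lambda>(u, v). L (pd_a i (pd_a j f) (y u v))) \<longlongrightarrow> L (pd_a i (pd_a j f) (y (fst x i) (fst x j))))
        (nhds (fst x i, fst x j))"
      by (rule cont[OF toda_smooth_pd(1)[OF toda_smooth_pd(1)[OF f j] i] L])
  qed
  from this[OF bounded_linear_Re] this[OF bounded_linear_Im] show ?thesis
    unfolding y0 by (simp add: complex_eq_iff)
qed simp

text \<open>
  One step of a telescoping sum: the coordinates below \<open>k\<close> have already been moved along the curve, and
  now coordinate \<open>k\<close> is moved. The mean value theorem turns the increment into a partial derivative at
  an intermediate point, which converges to \<open>x\<close>. It requires real values, so \<open>L\<close> will be the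
  real or the imaginary part.
\<close>

lemma partial_increment_derivative:
  fixes s :: "coords \<Rightarrow> complex" and L :: "complex \<Rightarrow> real"
  assumes s: "toda_smooth n s" and x: "x \<in> toda_dom n" and L: "bounded_linear L" and k: "k < n - 1"
    and y: "\<And>i. i < n - 1 \<Longrightarrow> (y i has_real_derivative y' i) (at 0)" "\<And>i. i < n - 1 \<Longrightarrow> y i 0 = fst x i"
  defines "z \<equiv> \<lambda>k t. ((\<lambda>i. if i < k then y i t else fst x i), snd x)"
  shows "((\<lambda>t. L (s (z (Suc k) t)) - L (s (z k t))) has_real_derivative y' k * L (pd_a k s x)) (at 0)"
proof -
  have ylim: "(y i \<longlongrightarrow> fst x i) (at 0)" if "i < n - 1" for i
    using DERIV_isCont[OF y(1)[OF that]] y(2)[OF that] by (simp add: isCont_def)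
  have xpos: "0 < fst x i" if "i < n - 1" for i using x that by (simp add: toda_dom_iff)
  have "\<forall>\<^sub>F t in at 0. \<forall>i\<in>{..<n - 1}. 0 < y i t"
    by (rule eventually_ball_finite) (auto intro!: order_tendstoD(1)[OF ylim] xpos)
  then have ev: "\<forall>\<^sub>F t in at 0. \<forall>i<n - 1. 0 < y i t" by (rule eventually_mono) simp
  have "\<exists>\<xi>. (\<forall>i<n - 1. 0 < y i t) \<longrightarrow> \<xi> \<in> closed_segment (fst x k) (y k t) \<and>
      L (s (z (Suc k) t)) - L (s (z k t)) = (y k t - fst x k) * L (pd_a k s ((fst (z k t))(k := \<xi>), snd x))" for t
  proof (cases "\<forall>i<n - 1. 0 < y i t")
    case True
    have zd: "((fst (z k t))(k := \<tau>), snd x) \<in> toda_dom n" if "0 < \<tau>" for \<tau>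
      using x k that True by (auto simp: toda_dom_iff z_def)
    have "\<exists>\<xi>\<in>closed_segment (fst x k) (y k t).
        L (s ((fst (z k t))(k := y k t), snd x)) - L (s ((fst (z k t))(k := fst x k), snd x)) =
        (y k t - fst x k) * L (pd_a k s ((fst (z k t))(k := \<xi>), snd x))"
    proof (rule real_mvt_segment)
      fix \<tau> assume "\<tau> \<in> closed_segment (fst x k) (y k t)"
      then have "0 < \<tau>" using xpos[OF k] True k by (auto simp: closed_segment_eq_real_ivl split: if_splits)
      from bounded_linear.has_vector_derivative[OF L toda_smooth_pd(3)[OF s k zd[OF this]]]
      show "((\<lambda>\<tau>. L (s ((fst (z k t))(k := \<tau>), snd x))) has_real_derivative
          L (pd_a k s ((fst (z k t))(k := \<tau>), snd x))) (at \<tau>)"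
        by (simp add: has_real_derivative_iff_has_vector_derivative)
    qed
    moreover have "((fst (z k t))(k := y k t), snd x) = z (Suc k) t"
      by (auto simp: z_def less_Suc_eq)
    moreover have "((fst (z k t))(k := fst x k), snd x) = z k t"
      by (auto simp: z_def)
    ultimately show ?thesis by auto
  qed auto
  then obtain \<xi> where \<xi>: "\<And>t. (\<forall>i<n - 1. 0 < y i t) \<Longrightarrow> \<xi> t \<in> closed_segment (fst x k) (y k t) \<and>
      L (s (z (Suc k) t)) - L (s (z k t)) = (y k t - fst x k) * L (pd_a k s ((fst (z k t))(k := \<xi> t), snd x))"
    by metis
  define w where "w t = ((fst (z k t))(k := \<xi> t), snd x)" for t
  have \<xi>lim: "(\<xi> \<longlongrightarrow> fst x k) (at 0)"
  proof (rule LIM_zero_cancel, rule Lim_null_comparison)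
    show "\<forall>\<^sub>F t in at 0. norm (\<xi> t - fst x k) \<le> norm (y k t - fst x k)"
      using ev by (rule eventually_mono) (drule \<xi>, auto simp: closed_segment_eq_real_ivl split: if_splits)
    show "((\<lambda>t. norm (y k t - fst x k)) \<longlongrightarrow> 0) (at 0)"
      by (rule tendsto_norm_zero[OF LIM_zero[OF ylim[OF k]]])
  qed
  have wlim: "(w \<longlongrightarrow> x) (at 0)"
  proof (rule tendsto_coords)
    fix i
    show "((\<lambda>t. fst (w t) i) \<longlongrightarrow> fst x i) (at 0)"
      using \<xi>lim ylim[of i] k by (cases "i = k"; cases "i < k") (auto simp: w_def z_def)
    show "((\<lambda>t. snd (w t) i) \<longlongrightarrow> snd x i) (at 0)" by (simp add: w_def)
  qed
  have wdom: "\<forall>\<^sub>F t in at 0. w t \<in> toda_dom n"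
    using ev order_tendstoD(1)[OF \<xi>lim xpos[OF k]]
    by eventually_elim (use x k in \<open>auto simp: toda_dom_iff w_def z_def\<close>)
  have Dlim: "((\<lambda>t. L (pd_a k s (w t))) \<longlongrightarrow> L (pd_a k s x)) (at 0)"
    by (rule bounded_linear.tendsto[OF L])
      (rule continuous_on_tendsto_compose[OF toda_smooth_cont[OF toda_smooth_pd(1)[OF s k]] wlim x wdom])
  have quot: "((\<lambda>t. (y k t - y k 0) / (t - 0) * L (pd_a k s (w t))) \<longlongrightarrow> y' k * L (pd_a k s x)) (at 0)" (is "(?Q \<longlongrightarrow> _) _")
    by (intro tendsto_mult Dlim y(1)[OF k, unfolded has_field_derivative_iff])
  have z0: "z (Suc k) 0 = z k 0" using y(2) k by (auto simp: z_def less_Suc_eq)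
  have "\<forall>\<^sub>F t in at 0. (y k t - y k 0) / (t - 0) * L (pd_a k s (w t)) =
      ((L (s (z (Suc k) t)) - L (s (z k t))) - (L (s (z (Suc k) 0)) - L (s (z k 0)))) / (t - 0)"
    using ev by (rule eventually_mono) (use \<xi> y(2)[OF k] z0 in \<open>simp add: w_def\<close>)
  then show ?thesis
    unfolding has_field_derivative_iff by (rule Lim_transform_eventually[OF quot])
qed

text \<open>
  Smoothness is formulated by iterated partial derivatives, so differentiability along a
  curve that moves all \<open>a\<^sub>i\<close> simultaneously has to be deduced from their continuity.
\<close>

lemma chain_rule_a:
  fixes s :: "coords \<Rightarrow> complex"
  assumes s: "toda_smooth n s" and x: "x \<in> toda_dom n"
    and y: "\<And>i. i < n - 1 \<Longrightarrow> (y i has_real_derivative y' i) (at 0)" "\<And>i. i < n - 1 \<Longrightarrow> y i 0 = fst x i"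
  shows "((\<lambda>t. s ((\<lambda>i. if i < n - 1 then y i t else fst x i), snd x)) has_vector_derivative
    (\<Sum>i<n - 1. y' i *\<^sub>R pd_a i s x)) (at 0)"
proof -
  define z where "z k t = ((\<lambda>i. if i < k then y i t else fst x i), snd x)" for k :: nat and t
  have main: "((\<lambda>t. L (s (z k t))) has_real_derivative (\<Sum>i<k. y' i * L (pd_a i s x))) (at 0)"
    if L: "bounded_linear L" and "k \<le> n - 1" for L :: "complex \<Rightarrow> real" and k
    using that(2)
  proof (induction k)
    case 0
    then show ?case by (simp add: z_def)
  next
    case (Suc k)
    then have "k < n - 1" by simp
    from DERIV_add[OF Suc.IH partial_increment_derivative[OF s x L this y, folded z_def]] Suc.prems
    show ?case by (simp add: add.commute)
  qed
  have "((\<lambda>t. Complex (Re (s (z (n - 1) t))) (Im (s (z (n - 1) t)))) has_vector_derivative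
      Complex (\<Sum>i<n - 1. y' i * Re (pd_a i s x)) (\<Sum>i<n - 1. y' i * Im (pd_a i s x))) (at 0)"
    using main[OF bounded_linear_Re, of "n - 1"] main[OF bounded_linear_Im, of "n - 1"]
    by (auto simp: has_vector_derivative_complex_iff)
  moreover have "Complex (\<Sum>i<n - 1. y' i * Re (pd_a i s x)) (\<Sum>i<n - 1. y' i * Im (pd_a i s x)) =
      (\<Sum>i<n - 1. y' i *\<^sub>R pd_a i s x)"
    by (simp add: complex_eq_iff)
  ultimately show ?thesis by (simp add: z_def)
qed

section \<open>The Hamiltonians and the operators of the representation\<close>

lemma mat_trace_mult:
  assumes "A \<in> carrier_mat n n" "B \<in> carrier_mat n n"
  shows "mat_trace (A * B) = (\<Sum>j<n. \<Sum>i<n. A $$ (i, j) * B $$ (j, i))"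
proof -
  have "mat_trace (A * B) = (\<Sum>i<n. \<Sum>j<n. A $$ (i, j) * B $$ (j, i))"
    using assms by (simp add: mat_trace_def scalar_prod_def atLeast0LessThan)
  then show ?thesis by (subst sum.swap)
qed

text \<open>
  In the coordinates the Hamiltonian is \<open>\<phi>\<^sub>\<xi> = (\<Sum>i. diag_diff \<xi> i * p\<^sub>i) + potential\<close>; the second summand is
  a function of the \<open>a\<^sub>i\<close> alone.
\<close>

definition diag_diff :: "real mat \<Rightarrow> nat \<Rightarrow> real" where
  "diag_diff \<xi> i = \<xi> $$ (i, i) - \<xi> $$ (Suc i, Suc i)"

definition potential :: "real \<Rightarrow> nat \<Rightarrow> real mat \<Rightarrow> coords \<Rightarrow> real" where
  "potential c n \<xi> x = \<xi> $$ (n - 1, n - 1) * c + (\<Sum>i<n - 1. \<xi> $$ (Suc i, i) * fst x i)"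

text \<open>
  A bidiagonal \<open>T\<close> pairs only with the diagonal and the first subdiagonal of \<open>\<xi>\<close>. The diagonal entries of
  \<open>T\<close> are differences \<open>p\<^sub>i - p\<^sub>i\<^sub>-\<^sub>1\<close>, and summation by parts moves the difference to \<open>\<xi>\<close>.
\<close>

lemma toda_phi_eq:
  assumes n: "0 < n" and \<xi>: "\<xi> \<in> carrier_mat n n" and x: "x \<in> toda_dom n"
  shows "toda_phi c n \<xi> x = (\<Sum>i<n - 1. diag_diff \<xi> i * snd x i) + potential c n \<xi> x"
proof -
  obtain m where m: "n = Suc m" using n by (cases n) auto
  let ?T = "toda_mat c n x"
  have T: "?T \<in> carrier_mat n n" by (simp add: toda_mat_def)
  let ?b = "\<lambda>j. (if j = m then c else snd x j) - (if j = 0 then 0 else snd x (j - 1))"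
  have inner: "(\<Sum>i<n. \<xi> $$ (i, j) * ?T $$ (j, i)) = \<xi> $$ (j, j) * ?b j + (if j < m then \<xi> $$ (Suc j, j) * fst x j else 0)"
    if j: "j < n" for j
  proof -
    have "(\<Sum>i<n. \<xi> $$ (i, j) * ?T $$ (j, i)) =
        (\<Sum>i<n. (if i = j then \<xi> $$ (j, j) * ?b j else 0) + (if i = Suc j then \<xi> $$ (Suc j, j) * fst x j else 0))"
      using j by (intro sum.cong refl) (auto simp: toda_mat_def m)
    also have "\<dots> = \<xi> $$ (j, j) * ?b j + (if j < m then \<xi> $$ (Suc j, j) * fst x j else 0)"
      using j by (simp add: sum.distrib m)
    finally show ?thesis .
  qed
  have "toda_phi c n \<xi> x = (\<Sum>j<n. \<xi> $$ (j, j) * ?b j + (if j < m then \<xi> $$ (Suc j, j) * fst x j else 0))"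
    unfolding toda_phi_def toda_point_eq[OF n x] mat_trace_mult[OF \<xi> T] by (intro sum.cong refl inner) simp
  also have "\<dots> = (\<Sum>j<Suc m. \<xi> $$ (j, j) * (if j = m then c else snd x j))
      - (\<Sum>j<Suc m. \<xi> $$ (j, j) * (if j = 0 then 0 else snd x (j - 1)))
      + (\<Sum>j<m. \<xi> $$ (Suc j, j) * fst x j)"
    by (simp add: m sum.distrib sum_subtractf right_diff_distrib)
  also have "(\<Sum>j<Suc m. \<xi> $$ (j, j) * (if j = m then c else snd x j)) = (\<Sum>j<m. \<xi> $$ (j, j) * snd x j) + \<xi> $$ (m, m) * c"
    by simp
  also have "(\<Sum>j<Suc m. \<xi> $$ (j, j) * (if j = 0 then 0 else snd x (j - 1))) = (\<Sum>j<m. \<xi> $$ (Suc j, Suc j) * snd x j)"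
    by (subst sum.lessThan_Suc_shift) simp
  finally show ?thesis
    by (simp add: m diag_diff_def potential_def left_diff_distrib sum_subtractf)
qed

lemma has_pd_a_linear:
  fixes k :: "nat \<Rightarrow> real"
  assumes "i < m"
  shows "has_pd_a i (\<lambda>x. \<Sum>j<m. k j * fst x j) (k i) x"
proof -
  have "((\<lambda>t. \<Sum>j<m. k j * ((fst x)(i := t)) j) has_vector_derivative (\<Sum>j<m. if j = i then k i else 0)) (at (fst x i))"
  proof (rule has_vector_derivative_sum)
    fix j
    show "((\<lambda>t. k j * ((fst x)(i := t)) j) has_vector_derivative (if j = i then k i else 0)) (at (fst x i))"
      by (cases "j = i") (auto intro!: derivative_eq_intros simp flip: has_real_derivative_iff_has_vector_derivative)
  qed
  then show ?thesis using assms by simp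
qed

lemma has_pd_p_linear:
  fixes k :: "nat \<Rightarrow> real"
  assumes "i < m"
  shows "has_pd_p i (\<lambda>x. \<Sum>j<m. k j * snd x j) (k i) x"
proof -
  have "((\<lambda>t. \<Sum>j<m. k j * ((snd x)(i := t)) j) has_vector_derivative (\<Sum>j<m. if j = i then k i else 0)) (at (snd x i))"
  proof (rule has_vector_derivative_sum)
    fix j
    show "((\<lambda>t. k j * ((snd x)(i := t)) j) has_vector_derivative (if j = i then k i else 0)) (at (snd x i))"
      by (cases "j = i") (auto intro!: derivative_eq_intros simp flip: has_real_derivative_iff_has_vector_derivative)
  qed
  then show ?thesis using assms by simp
qed

lemma has_pd_a_potential:
  assumes "i < n - 1"
  shows "has_pd_a i (potential c n \<xi>) (\<xi> $$ (Suc i, i)) x"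
  unfolding potential_def
  using has_vector_derivative_add[OF has_vector_derivative_const[of "\<xi> $$ (n - 1, n - 1) * c"] has_pd_a_linear[OF assms]]
  by simp

lemma pd_toda_phi:
  assumes n: "0 < n" and \<xi>: "\<xi> \<in> carrier_mat n n" and x: "x \<in> toda_dom n" and i: "i < n - 1"
  shows "pd_a i (toda_phi c n \<xi>) x = \<xi> $$ (Suc i, i)" "pd_p i (toda_phi c n \<xi>) x = diag_diff \<xi> i"
proof -
  note eq = toda_phi_eq[OF n \<xi>, symmetric]
  have "has_pd_a i (\<lambda>x. (\<Sum>i<n - 1. diag_diff \<xi> i * snd x i) + potential c n \<xi> x) (\<xi> $$ (Suc i, i)) x"
    using has_vector_derivative_add[OF has_vector_derivative_const has_pd_a_potential[OF i]] by simp
  from has_pd_a_cong[OF this x i eq] show "pd_a i (toda_phi c n \<xi>) x = \<xi> $$ (Suc i, i)" by (rule pd_a_eq)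
  have "has_pd_p i (\<lambda>x. (\<Sum>i<n - 1. diag_diff \<xi> i * snd x i) + potential c n \<xi> x) (diag_diff \<xi> i) x"
    using has_vector_derivative_add[OF has_pd_p_linear[OF i] has_vector_derivative_const[of "potential c n \<xi> x"]]
    by (simp add: potential_def)
  from has_pd_p_cong[OF this x i eq] show "pd_p i (toda_phi c n \<xi>) x = diag_diff \<xi> i" by (rule pd_p_eq)
qed

section \<open>Polarized sections\<close>

lemma polarized_pd_p:
  assumes "polarized n s" "i < n - 1" "x \<in> toda_dom n"
  shows "has_pd_p i s 0 x"
proof -
  have eq: "nabla n (\<lambda>_. vec_p i) s x = pd_p i s x"
    using assms(2,3) by (simp add: nabla_def vf_apply_def toda_theta_def vec_p_def if_distrib[where f = "\<lambda>c. c *\<^sub>R _"] cong: if_cong)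
  have "diff_p i s x" "nabla n (\<lambda>_. vec_p i) s x = 0"
    using assms by (auto simp: polarized_def)
  then show ?thesis using eq by (simp add: has_pd_p_diff)
qed

text \<open>
  The coordinates \<open>p\<^sub>i\<close> are exchanged for \<open>q\<^sub>i\<close> one at a time; along each of these lines the derivative
  vanishes.
\<close>

lemma polarized_indep:
  assumes s: "polarized n s" and a: "a \<in> toda_dom_a n" and p: "p \<in> toda_dom_p n" and q: "q \<in> toda_dom_p n"
  shows "s (a, p) = s (a, q)"
proof -
  define r where "r k = (\<lambda>i. if i < k then q i else p i)" for k :: nat
  have rp: "r k \<in> toda_dom_p n" if "k \<le> n - 1" for k
    using p q that by (auto simp: toda_dom_p_def PiE_iff extensional_def r_def)
  have "s (a, r k) = s (a, p)" if "k \<le> n - 1" for k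
    using that
  proof (induction k)
    case 0
    then show ?case by (simp add: r_def)
  next
    case (Suc k)
    have "((\<lambda>t. s (a, (r k)(k := t))) has_vector_derivative 0) (at t)" for t
    proof -
      have "(a, (r k)(k := t)) \<in> toda_dom n"
        using toda_dom_upd_p[of "(a, r k)" n k t] rp[of k] a Suc.prems by (simp add: toda_dom_def)
      from polarized_pd_p[OF s _ this, of k] Suc.prems show ?thesis by simp
    qed
    then obtain z where z: "\<And>t. s (a, (r k)(k := t)) = z"
      using has_vector_derivative_zero_constant[of UNIV "\<lambda>t. s (a, (r k)(k := t))"] by auto
    have "r (Suc k) = (r k)(k := q k)" "r k = (r k)(k := p k)" by (auto simp: r_def fun_eq_iff)
    then have "s (a, r (Suc k)) = s (a, r k)" using z by metis
    then show ?case using Suc by simp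
  qed
  moreover have "r (n - 1) = q"
    using p q by (auto simp: r_def fun_eq_iff toda_dom_p_def PiE_iff extensional_def)
  ultimately show ?thesis by (metis order_refl)
qed

lemma polarizedI:
  assumes s: "\<And>x. x \<notin> toda_dom n \<Longrightarrow> s x = 0"
    and indep: "\<And>a p q. a \<in> toda_dom_a n \<Longrightarrow> p \<in> toda_dom_p n \<Longrightarrow> q \<in> toda_dom_p n \<Longrightarrow> s (a, p) = s (a, q)"
  shows "polarized n s"
  unfolding polarized_def toda_sections_def
proof (intro conjI CollectI allI impI ballI)
  fix i x assume i: "i < n - 1" and x: "x \<in> toda_dom n"
  have "s (fst x, (snd x)(i := t)) = s x" for t
    using toda_dom_upd_p[OF x i, of t] x indep[of "fst x" "(snd x)(i := t)" "snd x"] by (simp add: toda_dom_def mem_Times_iff)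
  then have D: "has_pd_p i s 0 x" by simp
  show "diff_p i s x" by (rule has_pd_p_imp_diff[OF D])
  show "nabla n (\<lambda>_. vec_p i) s x = 0"
    using i x pd_p_eq[OF D]
    by (simp add: nabla_def vf_apply_def toda_theta_def vec_p_def if_distrib[where f = "\<lambda>c. c *\<^sub>R _"] cong: if_cong)
qed (rule s)

lemma polarized_outside: "polarized n s \<Longrightarrow> x \<notin> toda_dom n \<Longrightarrow> s x = 0"
  unfolding polarized_def toda_sections_def by blast

lemma polarized_lin:
  assumes "polarized n s" "polarized n t"
  shows "polarized n (\<lambda>x. z * s x + w * t x)"
proof (rule polarizedI)
  show "z * s (a, p) + w * t (a, p) = z * s (a, q) + w * t (a, q)"
    if "a \<in> toda_dom_a n" "p \<in> toda_dom_p n" "q \<in> toda_dom_p n" for a p q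
    using polarized_indep[OF assms(1) that] polarized_indep[OF assms(2) that] by simp
qed (simp add: polarized_outside[OF assms(1)] polarized_outside[OF assms(2)])

text \<open>
  No differentiability in the \<open>a\<^sub>i\<close> is available here. But \<open>pd_a i s\<close> depends only on the restriction of \<open>s\<close> to
  a line in direction \<open>a\<^sub>i\<close>, including the part where \<open>s\<close> is extended by zero, and these restrictions coincide.
\<close>

lemma polarized_pd_a_indep:
  assumes s: "polarized n s" and i: "i < n - 1"
    and a: "a \<in> toda_dom_a n" and p: "p \<in> toda_dom_p n" and q: "q \<in> toda_dom_p n"
  shows "pd_a i s (a, p) = pd_a i s (a, q)"
proof -
  have "s (a(i := t), p) = s (a(i := t), q)" for t
  proof (cases "a(i := t) \<in> toda_dom_a n")
    case True
    then show ?thesis using polarized_indep[OF s _ p q] by simp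
  next
    case False
    then show ?thesis using polarized_outside[OF s] by (simp add: toda_dom_def)
  qed
  then show ?thesis by (simp add: pd_a_def)
qed

text \<open>
  The action of the vector field \<open>\<Sum>i. d\<^sub>i a\<^sub>i \<partial>/\<partial>a\<^sub>i\<close>. In logarithmic coordinates it has constant
  coefficients, so any two such fields commute.
\<close>

definition euler :: "nat \<Rightarrow> (nat \<Rightarrow> real) \<Rightarrow> (coords \<Rightarrow> complex) \<Rightarrow> coords \<Rightarrow> complex" where
  "euler n d f x = (\<Sum>i<n - 1. complex_of_real (d i * fst x i) * pd_a i f x)"

text \<open>
  The component of \<open>X\<^sub>\<phi>\<close> along \<open>\<partial>/\<partial>a\<^sub>i\<close> is \<open>- a\<^sub>i * diag_diff \<xi> i\<close>. Hence \<open>\<theta>(X\<^sub>\<phi>)\<close> is the negative of the part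
  of \<open>\<phi>\<^sub>\<xi>\<close> that is linear in the \<open>p\<^sub>i\<close>, and only the potential survives. This is why the operator preserves
  the polarization.
\<close>

lemma toda_rho_eq:
  assumes n: "0 < n" and \<xi>: "\<xi> \<in> carrier_mat n n" and s: "polarized n s"
  shows "toda_rho c n \<xi> s x = (if x \<in> toda_dom n
    then - euler n (diag_diff \<xi>) s x + 2 * complex_of_real pi * \<i> * complex_of_real (potential c n \<xi> x) * s x else 0)"
proof (cases "x \<in> toda_dom n")
  case x: True
  let ?X = "ham_vfield (toda_phi c n \<xi>)"
  have X: "fst (?X x) i = - (fst x i * diag_diff \<xi> i)" if "i < n - 1" for i
    using pd_toda_phi[OF n \<xi> x that] by (simp add: ham_vfield_def)
  have "pd_p i s x = 0" if "i < n - 1" for i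
    using polarized_pd_p[OF s that x] by (rule pd_p_eq)
  then have vf: "vf_apply n ?X s x = - euler n (diag_diff \<xi>) s x"
    by (simp add: vf_apply_def euler_def X sum_negf[symmetric] scaleR_conv_of_real mult.commute)
  have "toda_theta n x (?X x) = (\<Sum>i<n - 1. - (diag_diff \<xi> i * snd x i))"
    unfolding toda_theta_def
  proof (rule sum.cong[OF refl])
    fix i assume "i \<in> {..<n - 1}"
    then show "snd x i * (fst (?X x) i / fst x i) = - (diag_diff \<xi> i * snd x i)"
      using x X[of i] by (auto simp: toda_dom_iff)
  qed
  then have "toda_theta n x (?X x) + toda_phi c n \<xi> x = potential c n \<xi> x"
    by (simp add: toda_phi_eq[OF n \<xi> x] sum_negf)
  then have "potential c n \<xi> x = toda_theta n x (?X x) + toda_phi c n \<xi> x" by simp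
  then show ?thesis
    using x by (simp add: toda_rho_def nabla_def vf algebra_simps)
qed (simp add: toda_rho_def nabla_def polarized_outside[OF s])

lemma polarized_toda_rho:
  assumes n: "0 < n" and \<xi>: "\<xi> \<in> carrier_mat n n" and s: "polarized n s"
  shows "polarized n (toda_rho c n \<xi> s)"
proof (rule polarizedI)
  fix a p q assume apq: "a \<in> toda_dom_a n" "p \<in> toda_dom_p n" "q \<in> toda_dom_p n"
  show "toda_rho c n \<xi> s (a, p) = toda_rho c n \<xi> s (a, q)"
    using apq polarized_indep[OF s apq] polarized_pd_a_indep[OF s _ apq]
    by (simp add: toda_rho_eq[OF assms] toda_dom_def euler_def potential_def)
qed (simp add: toda_rho_eq[OF assms])

lemma smooth_polarized_rho:
  assumes n: "0 < n" and \<xi>: "\<xi> \<in> carrier_mat n n" and s: "s \<in> smooth_polarized n"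
  shows "toda_rho c n \<xi> s \<in> smooth_polarized n"
proof -
  have sm: "toda_smooth n s" and pol: "polarized n s" using s by (simp_all add: smooth_polarized_def)
  let ?E = "\<lambda>x. (-1) * (\<Sum>i<n - 1. (complex_of_real (diag_diff \<xi> i) * complex_of_real (fst x i)) * pd_a i s x) +
    (2 * complex_of_real pi * \<i>) * (complex_of_real (\<xi> $$ (n - 1, n - 1) * c)
      + (\<Sum>i<n - 1. complex_of_real (\<xi> $$ (Suc i, i)) * complex_of_real (fst x i))) * s x"
  have "smooth_expr n ?E"
    by (intro smooth_expr.add smooth_expr.mult smooth_expr_sum smooth_expr.const)
      (simp_all add: smooth_expr.coord smooth_expr.smooth[OF sm] smooth_expr.smooth[OF toda_smooth_pd(1)[OF sm]])
  then have "toda_smooth n ?E" by (rule smooth_expr_smooth)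
  moreover have "toda_rho c n \<xi> s x = ?E x" if "x \<in> toda_dom n" for x
    using that by (simp add: toda_rho_eq[OF n \<xi> pol] euler_def potential_def mult.assoc)
  ultimately have "toda_smooth n (toda_rho c n \<xi> s)" by (simp only: toda_smooth_cong[of n "toda_rho c n \<xi> s" ?E])
  then show ?thesis using polarized_toda_rho[OF n \<xi> pol] by (simp add: smooth_polarized_def)
qed

lemma smooth_polarized_lin:
  assumes "s \<in> smooth_polarized n" "t \<in> smooth_polarized n"
  shows "(\<lambda>x. z * s x + w * t x) \<in> smooth_polarized n"
proof -
  have "toda_smooth n (\<lambda>x. z * s x + w * t x)"
    using assms unfolding smooth_polarized_def
    by (intro smooth_expr_smooth smooth_expr.add smooth_expr.mult smooth_expr.const) (simp_all add: smooth_expr.smooth)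
  then show ?thesis using assms polarized_lin by (simp add: smooth_polarized_def)
qed

section \<open>The bracket relation\<close>

lemma has_pd_a_mult:
  fixes f g :: "coords \<Rightarrow> complex"
  assumes "has_pd_a i f D x" "has_pd_a i g E x"
  shows "has_pd_a i (\<lambda>x. f x * g x) (f x * E + D * g x) x"
  using has_vector_derivative_mult[OF assms] by simp

lemma euler_lin:
  assumes f: "toda_smooth n f" and g: "toda_smooth n g" and x: "x \<in> toda_dom n"
  shows "euler n d (\<lambda>x. z * f x + w * g x) x = z * euler n d f x + w * euler n d g x"
proof -
  have "pd_a i (\<lambda>x. z * f x + w * g x) x = z * pd_a i f x + w * pd_a i g x" if i: "i < n - 1" for i
    using has_vector_derivative_add[OF has_vector_derivative_mult_right[OF toda_smooth_pd(3)[OF f i x], of z]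
        has_vector_derivative_mult_right[OF toda_smooth_pd(3)[OF g i x], of w]]
    by (rule pd_a_eq)
  then show ?thesis
    by (simp add: euler_def sum.distrib sum_distrib_left algebra_simps)
qed

lemma euler_cong:
  assumes "x \<in> toda_dom n" "\<And>y. y \<in> toda_dom n \<Longrightarrow> f y = g y"
  shows "euler n d f x = euler n d g x"
  unfolding euler_def using pd_a_cong(1)[OF assms(1) _ assms(2)] by (intro sum.cong) auto

lemma euler_mult:
  assumes f: "toda_smooth n f" and g: "toda_smooth n g" and x: "x \<in> toda_dom n"
  shows "euler n d (\<lambda>x. f x * g x) x = euler n d f x * g x + f x * euler n d g x"
proof -
  have "pd_a i (\<lambda>x. f x * g x) x = f x * pd_a i g x + pd_a i f x * g x" if i: "i < n - 1" for i
    by (rule pd_a_eq[OF has_pd_a_mult[OF toda_smooth_pd(3)[OF f i x] toda_smooth_pd(3)[OF g i x]]])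
  then show ?thesis
    by (simp add: euler_def sum.distrib sum_distrib_left sum_distrib_right algebra_simps)
qed

lemma smooth_euler:
  assumes "toda_smooth n f"
  shows "toda_smooth n (euler n d f)"
proof -
  have "smooth_expr n (\<lambda>x. \<Sum>i<n - 1. (complex_of_real (d i) * complex_of_real (fst x i)) * pd_a i f x)"
    by (intro smooth_expr.add smooth_expr.mult smooth_expr_sum smooth_expr.const)
      (simp_all add: smooth_expr.coord smooth_expr.smooth[OF toda_smooth_pd(1)[OF assms]])
  then show ?thesis unfolding euler_def[abs_def] by (simp add: smooth_expr_smooth)
qed

lemma has_pd_a_euler:
  assumes f: "toda_smooth n f" and i: "i < n - 1" and x: "x \<in> toda_dom n"
  shows "has_pd_a i (euler n d f) (complex_of_real (d i) * pd_a i f x +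
    (\<Sum>j<n - 1. complex_of_real (d j * fst x j) * pd_a i (pd_a j f) x)) x"
proof -
  have coord: "has_pd_a i (\<lambda>x. complex_of_real (d j * fst x j)) (if j = i then complex_of_real (d i) else 0) x" for j
    by (cases "j = i") (auto intro!: derivative_eq_intros)
  have "has_pd_a i (\<lambda>x. \<Sum>j<n - 1. complex_of_real (d j * fst x j) * pd_a j f x)
      (\<Sum>j<n - 1. complex_of_real (d j * fst x j) * pd_a i (pd_a j f) x + (if j = i then complex_of_real (d i) else 0) * pd_a j f x) x"
  proof (rule has_vector_derivative_sum)
    fix j assume "j \<in> {..<n - 1}"
    then have "toda_smooth n (pd_a j f)" using toda_smooth_pd(1)[OF f] by simp
    from has_pd_a_mult[OF coord toda_smooth_pd(3)[OF this i x]]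
    show "has_pd_a i (\<lambda>x. complex_of_real (d j * fst x j) * pd_a j f x)
        (complex_of_real (d j * fst x j) * pd_a i (pd_a j f) x + (if j = i then complex_of_real (d i) else 0) * pd_a j f x) x" .
  qed
  moreover have "(\<Sum>j<n - 1. complex_of_real (d j * fst x j) * pd_a i (pd_a j f) x + (if j = i then complex_of_real (d i) else 0) * pd_a j f x) =
      complex_of_real (d i) * pd_a i f x + (\<Sum>j<n - 1. complex_of_real (d j * fst x j) * pd_a i (pd_a j f) x)"
    using i by (simp add: sum.distrib if_distrib[where f = "\<lambda>c. c * _"] cong: if_cong)
  ultimately show ?thesis by (simp add: euler_def[abs_def])
qed

lemma euler_commute:
  assumes f: "toda_smooth n f" and x: "x \<in> toda_dom n"
  shows "euler n d (euler n e f) x = euler n e (euler n d f) x"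
proof -
  have expand: "euler n d (euler n e f) x = (\<Sum>i<n - 1. complex_of_real (d i * e i * fst x i) * pd_a i f x) +
      (\<Sum>i<n - 1. \<Sum>j<n - 1. complex_of_real (d i * fst x i * (e j * fst x j)) * pd_a i (pd_a j f) x)" for d e
  proof -
    have "euler n d (euler n e f) x = (\<Sum>i<n - 1. complex_of_real (d i * fst x i) * (complex_of_real (e i) * pd_a i f x +
      (\<Sum>j<n - 1. complex_of_real (e j * fst x j) * pd_a i (pd_a j f) x)))"
      unfolding euler_def[of n d] using pd_a_eq[OF has_pd_a_euler[OF f _ x]] by simp
    then show ?thesis by (simp add: sum.distrib sum_distrib_left distrib_left mult.assoc mult.commute mult.left_commute)
  qed
  have "(\<Sum>i<n - 1. \<Sum>j<n - 1. complex_of_real (d i * fst x i * (e j * fst x j)) * pd_a i (pd_a j f) x) =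
      (\<Sum>j<n - 1. \<Sum>i<n - 1. complex_of_real (e j * fst x j * (d i * fst x i)) * pd_a j (pd_a i f) x)"
    by (subst sum.swap) (intro sum.cong refl, simp add: mixed_pd_a_commute[OF f _ _ x] mult.commute)
  then show ?thesis unfolding expand by (simp add: mult.commute mult.left_commute)
qed

lemma smooth_potential: "toda_smooth n (\<lambda>x. complex_of_real (potential c n \<xi> x))"
proof -
  have "smooth_expr n (\<lambda>x. complex_of_real (\<xi> $$ (n - 1, n - 1) * c)
      + (\<Sum>i<n - 1. complex_of_real (\<xi> $$ (Suc i, i)) * complex_of_real (fst x i)))"
    by (intro smooth_expr.add smooth_expr_sum smooth_expr.mult smooth_expr.const) (simp add: smooth_expr.coord)
  then show ?thesis by (simp add: potential_def smooth_expr_smooth)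
qed

lemma euler_potential:
  "euler n d (\<lambda>x. complex_of_real (potential c n \<xi> x)) x =
    complex_of_real (\<Sum>i<n - 1. d i * \<xi> $$ (Suc i, i) * fst x i)"
proof -
  have "pd_a i (\<lambda>x. complex_of_real (potential c n \<xi> x)) x = complex_of_real (\<xi> $$ (Suc i, i))" if "i < n - 1" for i
    by (rule pd_a_eq) (rule bounded_linear.has_vector_derivative[OF bounded_linear_of_real has_pd_a_potential[OF that]])
  then show ?thesis by (simp add: euler_def mult.commute mult.left_commute)
qed

lemma lower_triangular_zero:
  assumes "A \<in> carrier_mat n n" "lower_triangular A" "i < j" "j < n"
  shows "A $$ (i, j) = 0"
  using assms unfolding lower_triangular_def upper_triangular_def by fastforce

lemma lower_triangular_mult_index:
  fixes A B :: "real mat"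
  assumes A: "A \<in> carrier_mat n n" "lower_triangular A" and B: "B \<in> carrier_mat n n" "lower_triangular B"
    and ij: "i < n" "j < n"
  shows "(A * B) $$ (i, j) = (\<Sum>k\<in>{j..i}. A $$ (i, k) * B $$ (k, j))"
proof -
  have "(A * B) $$ (i, j) = (\<Sum>k<n. A $$ (i, k) * B $$ (k, j))"
    using A B ij by (simp add: scalar_prod_def atLeast0LessThan)
  also have "\<dots> = (\<Sum>k\<in>{j..i}. A $$ (i, k) * B $$ (k, j))"
  proof (rule sum.mono_neutral_right)
    show "\<forall>k\<in>{..<n} - {j..i}. A $$ (i, k) * B $$ (k, j) = 0"
      using lower_triangular_zero[OF A] lower_triangular_zero[OF B] ij by (auto simp: not_le)
  qed (use ij in auto)
  finally show ?thesis .
qed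

lemma lower_triangular_mult_diag:
  fixes A B :: "real mat"
  assumes A: "A \<in> carrier_mat n n" "lower_triangular A" and B: "B \<in> carrier_mat n n" "lower_triangular B"
  shows "i < n \<Longrightarrow> (A * B) $$ (i, i) = A $$ (i, i) * B $$ (i, i)"
    "Suc i < n \<Longrightarrow> (A * B) $$ (Suc i, i) = A $$ (Suc i, i) * B $$ (i, i) + A $$ (Suc i, Suc i) * B $$ (Suc i, i)"
  by (simp_all add: lower_triangular_mult_index[OF A B] atLeastAtMostSuc_conv)

text \<open>
  Write \<open>\<rho>(\<xi>) = - E\<^sub>\<xi> + 2\<pi>\<i> V\<^sub>\<xi>\<close> with commuting derivations \<open>E\<^sub>\<xi>\<close>. Then the commutator of \<open>\<rho>(\<xi>)\<close> and \<open>\<rho>(\<eta>)\<close> is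
  multiplication by \<open>2\<pi>\<i> (E\<^sub>\<eta> V\<^sub>\<xi> - E\<^sub>\<xi> V\<^sub>\<eta>)\<close>. On the other side, the commutator of lower triangular matrices has
  zero diagonal, and its first subdiagonal yields exactly this potential.
\<close>

lemma toda_rho_bracket:
  assumes n: "0 < n" and \<xi>: "\<xi> \<in> carrier_mat n n" "lower_triangular \<xi>"
    and \<eta>: "\<eta> \<in> carrier_mat n n" "lower_triangular \<eta>" and s: "s \<in> smooth_polarized n"
  shows "toda_rho c n (\<xi> * \<eta> - \<eta> * \<xi>) s x =
    toda_rho c n \<xi> (toda_rho c n \<eta> s) x - toda_rho c n \<eta> (toda_rho c n \<xi> s) x"
proof (cases "x \<in> toda_dom n")
  case x: True
  have sm: "toda_smooth n s" and pol: "polarized n s" using s by (simp_all add: smooth_polarized_def)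
  let ?I = "2 * complex_of_real pi * \<i>"
  let ?V = "\<lambda>\<xi> x. complex_of_real (potential c n \<xi> x)"
  let ?q = "\<lambda>\<xi> \<eta>. complex_of_real (\<Sum>i<n - 1. diag_diff \<xi> i * \<eta> $$ (Suc i, i) * fst x i)"
  have comp: "toda_rho c n \<xi> (toda_rho c n \<eta> s) x =
      euler n (diag_diff \<xi>) (euler n (diag_diff \<eta>) s) x
      - ?I * (?q \<xi> \<eta> * s x + ?V \<eta> x * euler n (diag_diff \<xi>) s x)
      - ?I * ?V \<xi> x * euler n (diag_diff \<eta>) s x + ?I * ?V \<xi> x * (?I * ?V \<eta> x * s x)"
    if \<xi>: "\<xi> \<in> carrier_mat n n" and \<eta>: "\<eta> \<in> carrier_mat n n" for \<xi> \<eta>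
  proof -
    have smV: "toda_smooth n (\<lambda>x. ?V \<eta> x * s x)"
      by (rule smooth_expr_smooth[OF smooth_expr.mult[OF smooth_expr.smooth[OF smooth_potential] smooth_expr.smooth[OF sm]]])
    have "euler n (diag_diff \<xi>) (toda_rho c n \<eta> s) x =
        euler n (diag_diff \<xi>) (\<lambda>x. (-1) * euler n (diag_diff \<eta>) s x + ?I * (?V \<eta> x * s x)) x"
      by (rule euler_cong[OF x]) (simp add: toda_rho_eq[OF n \<eta> pol])
    also have "\<dots> = (-1) * euler n (diag_diff \<xi>) (euler n (diag_diff \<eta>) s) x
        + ?I * (?q \<xi> \<eta> * s x + ?V \<eta> x * euler n (diag_diff \<xi>) s x)"
      unfolding euler_lin[OF smooth_euler[OF sm] smV x] euler_mult[OF smooth_potential sm x] euler_potential ..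
    finally have E: "euler n (diag_diff \<xi>) (toda_rho c n \<eta> s) x = (-1) * euler n (diag_diff \<xi>) (euler n (diag_diff \<eta>) s) x
        + ?I * (?q \<xi> \<eta> * s x + ?V \<eta> x * euler n (diag_diff \<xi>) s x)" .
    have 1: "toda_rho c n \<eta> s x = - euler n (diag_diff \<eta>) s x + ?I * ?V \<eta> x * s x"
      using x by (simp add: toda_rho_eq[OF n \<eta> pol])
    have "toda_rho c n \<xi> (toda_rho c n \<eta> s) x =
        - euler n (diag_diff \<xi>) (toda_rho c n \<eta> s) x + ?I * ?V \<xi> x * toda_rho c n \<eta> s x"
      unfolding toda_rho_eq[OF n \<xi> polarized_toda_rho[OF n \<eta> pol]] using x by simp
    then show ?thesis unfolding E unfolding 1 by (simp add: algebra_simps)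
  qed
  have C: "\<xi> * \<eta> - \<eta> * \<xi> \<in> carrier_mat n n" using \<xi>(1) \<eta>(1) by (intro minus_carrier_mat mult_carrier_mat)
  have diag0: "(\<xi> * \<eta> - \<eta> * \<xi>) $$ (i, i) = 0" if "i < n" for i
    using that \<xi>(1) \<eta>(1) lower_triangular_mult_diag(1)[OF \<xi> \<eta> that] lower_triangular_mult_diag(1)[OF \<eta> \<xi> that] by simp
  have sub: "(\<xi> * \<eta> - \<eta> * \<xi>) $$ (Suc i, i) = diag_diff \<eta> i * \<xi> $$ (Suc i, i) - diag_diff \<xi> i * \<eta> $$ (Suc i, i)"
    if "Suc i < n" for i
    using that \<xi>(1) \<eta>(1) lower_triangular_mult_diag(2)[OF \<xi> \<eta> that] lower_triangular_mult_diag(2)[OF \<eta> \<xi> that]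
    by (simp add: diag_diff_def algebra_simps)
  have e0: "euler n (diag_diff (\<xi> * \<eta> - \<eta> * \<xi>)) s x = 0"
    unfolding euler_def by (intro sum.neutral) (auto simp: diag_diff_def diag0)
  have "potential c n (\<xi> * \<eta> - \<eta> * \<xi>) x =
      (\<Sum>i<n - 1. diag_diff \<eta> i * \<xi> $$ (Suc i, i) * fst x i) - (\<Sum>i<n - 1. diag_diff \<xi> i * \<eta> $$ (Suc i, i) * fst x i)"
    unfolding potential_def sum_subtractf[symmetric] using n diag0[of "n - 1"]
    by (simp, intro sum.cong) (auto simp: sub left_diff_distrib)
  then have V: "?V (\<xi> * \<eta> - \<eta> * \<xi>) x = ?q \<eta> \<xi> - ?q \<xi> \<eta>" by simp
  have L: "toda_rho c n (\<xi> * \<eta> - \<eta> * \<xi>) s x = ?I * (?q \<eta> \<xi> - ?q \<xi> \<eta>) * s x"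
    unfolding toda_rho_eq[OF n C pol] e0 V using x by simp
  show ?thesis
    unfolding L comp[OF \<xi>(1) \<eta>(1)] comp[OF \<eta>(1) \<xi>(1)] euler_commute[OF sm x, of "diag_diff \<eta>" "diag_diff \<xi>"]
    by (simp only: algebra_simps)
next
  case False
  have pol: "polarized n s" using s by (simp add: smooth_polarized_def)
  have C: "\<xi> * \<eta> - \<eta> * \<xi> \<in> carrier_mat n n" using \<xi>(1) \<eta>(1) by (intro minus_carrier_mat mult_carrier_mat)
  have zero: "toda_rho c n \<zeta> t x = 0" if "\<zeta> \<in> carrier_mat n n" "polarized n t" for \<zeta> t
    by (rule polarized_outside[OF polarized_toda_rho[OF n that] False])
  show ?thesis
    by (simp add: zero[OF C pol] zero[OF \<xi>(1) polarized_toda_rho[OF n \<eta>(1) pol]]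
        zero[OF \<eta>(1) polarized_toda_rho[OF n \<xi>(1) pol]])
qed

lemma lie_algebra_rep_toda_rho:
  assumes n: "0 < n"
  shows "lie_algebra_rep n (smooth_polarized n) (toda_rho c n)"
  unfolding lie_algebra_rep_def
proof (intro conjI ballI allI)
  fix \<xi> s assume \<xi>: "\<xi> \<in> g1_alg n" and s: "s \<in> smooth_polarized n"
  then have c: "\<xi> \<in> carrier_mat n n" by (simp add: g1_alg_def)
  show "toda_rho c n \<xi> s \<in> smooth_polarized n" by (rule smooth_polarized_rho[OF n c s])
  fix t z w assume t: "t \<in> smooth_polarized n"
  have pol: "polarized n s" "polarized n t" and sm: "toda_smooth n s" "toda_smooth n t"
    using s t by (simp_all add: smooth_polarized_def)
  show "toda_rho c n \<xi> (\<lambda>x. z * s x + w * t x) = (\<lambda>x. z * toda_rho c n \<xi> s x + w * toda_rho c n \<xi> t x)"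
  proof
    fix x show "toda_rho c n \<xi> (\<lambda>x. z * s x + w * t x) x = z * toda_rho c n \<xi> s x + w * toda_rho c n \<xi> t x"
      by (simp add: toda_rho_eq[OF n c] pol polarized_lin euler_lin sm algebra_simps)
  qed
next
  fix \<xi> \<eta> s assume "\<xi> \<in> g1_alg n" "\<eta> \<in> g1_alg n" and s: "s \<in> smooth_polarized n"
  then have \<xi>: "\<xi> \<in> carrier_mat n n" "lower_triangular \<xi>" and \<eta>: "\<eta> \<in> carrier_mat n n" "lower_triangular \<eta>"
    by (simp_all add: g1_alg_def)
  have pol: "polarized n s" using s by (simp add: smooth_polarized_def)
  show "toda_rho c n (\<xi> * \<eta> - \<eta> * \<xi>) s = (\<lambda>x. toda_rho c n \<xi> (toda_rho c n \<eta> s) x - toda_rho c n \<eta> (toda_rho c n \<xi> s) x)"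
    by (rule ext) (rule toda_rho_bracket[OF n \<xi> \<eta> s])
  fix \<alpha> \<beta> :: real
  have C: "\<alpha> \<cdot>\<^sub>m \<xi> + \<beta> \<cdot>\<^sub>m \<eta> \<in> carrier_mat n n" using \<xi>(1) \<eta>(1) by simp
  have entry: "(\<alpha> \<cdot>\<^sub>m \<xi> + \<beta> \<cdot>\<^sub>m \<eta>) $$ (i, j) = \<alpha> * \<xi> $$ (i, j) + \<beta> * \<eta> $$ (i, j)" if "i < n" "j < n" for i j
    using that \<xi>(1) \<eta>(1) by simp
  show "toda_rho c n (\<alpha> \<cdot>\<^sub>m \<xi> + \<beta> \<cdot>\<^sub>m \<eta>) s =
      (\<lambda>x. complex_of_real \<alpha> * toda_rho c n \<xi> s x + complex_of_real \<beta> * toda_rho c n \<eta> s x)"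
  proof
    fix x
    have e: "euler n (diag_diff (\<alpha> \<cdot>\<^sub>m \<xi> + \<beta> \<cdot>\<^sub>m \<eta>)) s x =
        complex_of_real \<alpha> * euler n (diag_diff \<xi>) s x + complex_of_real \<beta> * euler n (diag_diff \<eta>) s x"
      unfolding euler_def sum_distrib_left sum.distrib[symmetric]
      by (intro sum.cong refl) (simp add: diag_diff_def entry algebra_simps)
    have "potential c n (\<alpha> \<cdot>\<^sub>m \<xi> + \<beta> \<cdot>\<^sub>m \<eta>) x = (\<alpha> * \<xi> $$ (n - 1, n - 1) + \<beta> * \<eta> $$ (n - 1, n - 1)) * c
        + (\<Sum>i<n - 1. (\<alpha> * \<xi> $$ (Suc i, i) + \<beta> * \<eta> $$ (Suc i, i)) * fst x i)"
      unfolding potential_def using n entry[of "n - 1" "n - 1"] by (simp add: entry)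
    also have "\<dots> = \<alpha> * potential c n \<xi> x + \<beta> * potential c n \<eta> x"
      by (simp add: potential_def sum.distrib sum_distrib_left algebra_simps)
    finally show "toda_rho c n (\<alpha> \<cdot>\<^sub>m \<xi> + \<beta> \<cdot>\<^sub>m \<eta>) s x =
        complex_of_real \<alpha> * toda_rho c n \<xi> s x + complex_of_real \<beta> * toda_rho c n \<eta> s x"
      using e by (simp add: toda_rho_eq[OF n C pol] toda_rho_eq[OF n \<xi>(1) pol] toda_rho_eq[OF n \<eta>(1) pol] algebra_simps)
  qed
qed

section \<open>The group representation\<close>

lemma G1D:
  assumes "g \<in> G1 n"
  shows "g \<in> carrier_mat n n" "lower_triangular g" "i < n \<Longrightarrow> 0 < g $$ (i, i)"
  using assms by (auto simp: G1_def)

lemma G1I: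
  assumes "g \<in> carrier_mat n n" "\<And>i j. i < j \<Longrightarrow> j < n \<Longrightarrow> g $$ (i, j) = 0"
    "\<And>i. i < n \<Longrightarrow> 0 < g $$ (i, i)" "(\<Prod>i<n. g $$ (i, i)) = 1"
  shows "g \<in> G1 n"
proof -
  have "lower_triangular g"
    unfolding lower_triangular_def upper_triangular_def using assms(1,2) by auto
  moreover have "Determinant.det g = 1"
    using det_lower_triangular[OF assms(2,1)] assms(1,4) by (simp add: prod_list_diag_prod atLeast0LessThan)
  ultimately show ?thesis using assms(1,3) by (simp add: G1_def)
qed

lemma one_G1: "1\<^sub>m n \<in> G1 n"
  by (rule G1I) auto

lemma mult_G1:
  assumes g: "g \<in> G1 n" and h: "h \<in> G1 n"
  shows "g * h \<in> G1 n"
proof (rule G1I)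
  note G = G1D(1,2)[OF g] and H = G1D(1,2)[OF h]
  show "g * h \<in> carrier_mat n n" using G(1) H(1) by (rule mult_carrier_mat)
  show "(g * h) $$ (i, j) = 0" if "i < j" "j < n" for i j
    using lower_triangular_mult_index[OF G H, of i j] that by simp
  show "0 < (g * h) $$ (i, i)" if "i < n" for i
    using lower_triangular_mult_diag(1)[OF G H that] G1D(3)[OF g that] G1D(3)[OF h that] by simp
  have det: "(\<Prod>i<n. k $$ (i, i)) = 1" if k: "k \<in> G1 n" for k
  proof -
    have "Determinant.det k = (\<Prod>i<n. k $$ (i, i))"
      using det_lower_triangular[of n k, OF lower_triangular_zero[OF G1D(1,2)[OF k]] G1D(1)[OF k]] G1D(1)[OF k]
      by (simp add: prod_list_diag_prod atLeast0LessThan)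
    then show ?thesis using k by (simp add: G1_def)
  qed
  have "(\<Prod>i<n. (g * h) $$ (i, i)) = (\<Prod>i<n. g $$ (i, i) * h $$ (i, i))"
    by (intro prod.cong refl) (simp only: lower_triangular_mult_diag(1)[OF G H] lessThan_iff)
  then show "(\<Prod>i<n. (g * h) $$ (i, i)) = 1"
    by (simp add: prod.distrib det[OF g] det[OF h])
qed

definition diag_ratio :: "real mat \<Rightarrow> nat \<Rightarrow> real" where
  "diag_ratio g i = g $$ (Suc i, Suc i) / g $$ (i, i)"

text \<open>
  The coefficients \<open>g\<^sub>i\<^sub>+\<^sub>1\<^sub>,\<^sub>i / g\<^sub>i\<^sub>i\<close> form a cocycle over the dilations by \<open>diag_ratio g\<close>, and their
  derivatives at the identity are the coefficients \<open>\<xi>\<^sub>i\<^sub>+\<^sub>1\<^sub>,\<^sub>i\<close> of the potential.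
\<close>

definition phase :: "real \<Rightarrow> nat \<Rightarrow> real mat \<Rightarrow> coords \<Rightarrow> real" where
  "phase c n g x = c * ln (g $$ (n - 1, n - 1)) + (\<Sum>i<n - 1. g $$ (Suc i, i) / g $$ (i, i) * fst x i)"

text \<open>
  The result of integrating \<open>\<rho>\<close>: the first-order part becomes a dilation of the \<open>a\<^sub>i\<close>, the potential a phase.
\<close>

definition toda_rep :: "real \<Rightarrow> nat \<Rightarrow> real mat \<Rightarrow> toda_section \<Rightarrow> toda_section" where
  "toda_rep c n g s x = (if x \<in> toda_dom n
     then exp (2 * complex_of_real pi * \<i> * complex_of_real (phase c n g x)) * s (scale_a n (diag_ratio g) x) else 0)"

lemma diag_ratio_pos: "g \<in> G1 n \<Longrightarrow> \<forall>i<n - 1. 0 < diag_ratio g i"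
  using G1D(3) by (simp add: diag_ratio_def)

lemma scale_a_G1_dom: "g \<in> G1 n \<Longrightarrow> x \<in> toda_dom n \<Longrightarrow> scale_a n (diag_ratio g) x \<in> toda_dom n"
  by (rule scale_a_dom[OF diag_ratio_pos])

lemma toda_rep_mult:
  assumes n: "0 < n" and g: "g \<in> G1 n" and h: "h \<in> G1 n"
  shows "toda_rep c n (g * h) s = toda_rep c n g (toda_rep c n h s)"
proof
  fix x
  note G = G1D(1,2)[OF g] and H = G1D(1,2)[OF h]
  note diag = lower_triangular_mult_diag(1)[OF G H] and sub = lower_triangular_mult_diag(2)[OF G H]
  show "toda_rep c n (g * h) s x = toda_rep c n g (toda_rep c n h s) x"
  proof (cases "x \<in> toda_dom n")
    case x: True
    let ?y = "scale_a n (diag_ratio g) x"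
    have y: "?y \<in> toda_dom n" by (rule scale_a_G1_dom[OF g x])
    have sc: "scale_a n (diag_ratio (g * h)) x = scale_a n (diag_ratio h) ?y"
      by (rule prod_eqI) (auto simp: scale_a_def diag_ratio_def diag fun_eq_iff mult_ac)
    have last: "ln ((g * h) $$ (n - 1, n - 1)) = ln (g $$ (n - 1, n - 1)) + ln (h $$ (n - 1, n - 1))"
      using diag[of "n - 1"] G1D(3)[OF g, of "n - 1"] G1D(3)[OF h, of "n - 1"] n by (simp add: ln_mult)
    have "(g * h) $$ (Suc i, i) / (g * h) $$ (i, i) * fst x i =
        g $$ (Suc i, i) / g $$ (i, i) * fst x i + h $$ (Suc i, i) / h $$ (i, i) * fst ?y i" if i: "i < n - 1" for i
    proof -
      have "0 < g $$ (i, i)" "0 < h $$ (i, i)" using G1D(3)[OF g, of i] G1D(3)[OF h, of i] i by simp_all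
      then show ?thesis using i by (simp add: diag sub scale_a_def diag_ratio_def field_simps)
    qed
    then have ph: "phase c n (g * h) x = phase c n g x + phase c n h ?y"
      unfolding phase_def last by (simp add: sum.distrib distrib_left)
    show ?thesis
      using x y by (simp add: toda_rep_def sc ph distrib_left exp_add mult.assoc)
  qed (simp add: toda_rep_def)
qed

lemma toda_rep_trivial:
  assumes n: "0 < n" and g: "\<And>i. i < n \<Longrightarrow> g $$ (i, i) = 1" "\<And>i. Suc i < n \<Longrightarrow> g $$ (Suc i, i) = 0"
    and s: "s \<in> toda_sections n"
  shows "toda_rep c n g s = s"
proof
  fix x show "toda_rep c n g s x = s x"
  proof (cases "x \<in> toda_dom n")
    case True
    have "scale_a n (diag_ratio g) x = x"
      by (rule prod_eqI) (auto simp: scale_a_def diag_ratio_def g fun_eq_iff)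
    moreover have "phase c n g x = 0" using n by (simp add: phase_def g)
    ultimately show ?thesis using True by (simp add: toda_rep_def)
  next
    case False
    then have "s x = 0" using s unfolding toda_sections_def by blast
    then show ?thesis using False by (simp add: toda_rep_def)
  qed
qed

text \<open>
  The operators see only the diagonal and the first subdiagonal of \<open>g\<close>. So the inverse matrix may be
  replaced by a bidiagonal \<open>h\<close> chosen such that \<open>g * h\<close> and \<open>h * g\<close> have unit diagonal and vanishing first
  subdiagonal.
\<close>

lemma toda_rep_inverse:
  assumes n: "0 < n" and g: "g \<in> G1 n"
  shows "\<exists>h\<in>G1 n. \<forall>s\<in>toda_sections n. toda_rep c n g (toda_rep c n h s) = s \<and> toda_rep c n h (toda_rep c n g s) = s"
proof -
  let ?h = "mat n n (\<lambda>(i, j). if i = j then 1 / g $$ (i, i)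
    else if i = Suc j then - (g $$ (i, j) / (g $$ (i, i) * g $$ (j, j))) else 0)"
  note G = G1D(1,2)[OF g] and pos = G1D(3)[OF g]
  have nz: "g $$ (i, i) \<noteq> 0" if "i < n" for i using pos[OF that] by simp
  have h: "?h \<in> G1 n"
  proof (rule G1I)
    have "Determinant.det g = (\<Prod>i<n. g $$ (i, i))"
      using det_lower_triangular[of n g, OF lower_triangular_zero[OF G] G(1)] G(1)
      by (simp add: prod_list_diag_prod atLeast0LessThan)
    then have "(\<Prod>i<n. g $$ (i, i)) = 1" using g by (simp add: G1_def)
    then show "(\<Prod>i<n. ?h $$ (i, i)) = 1" by (simp add: prod_dividef)
  qed (use pos in auto)
  note H = G1D(1,2)[OF h]
  have "toda_rep c n g (toda_rep c n ?h s) = s" if "s \<in> toda_sections n" for s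
    unfolding toda_rep_mult[OF n g h, symmetric]
    by (rule toda_rep_trivial[OF n _ _ that])
      (simp_all add: lower_triangular_mult_diag[OF G H] nz del: index_mult_mat)
  moreover have "toda_rep c n ?h (toda_rep c n g s) = s" if "s \<in> toda_sections n" for s
    unfolding toda_rep_mult[OF n h g, symmetric]
    by (rule toda_rep_trivial[OF n _ _ that])
      (simp_all add: lower_triangular_mult_diag[OF H G] nz field_simps del: index_mult_mat)
  ultimately show ?thesis using h by blast
qed

lemma toda_rep_lin: "toda_rep c n g (\<lambda>x. z * s x + w * t x) = (\<lambda>x. z * toda_rep c n g s x + w * toda_rep c n g t x)"
  by (rule ext) (simp add: toda_rep_def algebra_simps)

lemma polarized_sections: "polarized n s \<Longrightarrow> s \<in> toda_sections n"
  by (simp add: polarized_def)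

lemma polarized_toda_rep:
  assumes g: "g \<in> G1 n" and s: "polarized n s"
  shows "polarized n (toda_rep c n g s)"
proof (rule polarizedI)
  fix a p q assume apq: "a \<in> toda_dom_a n" "p \<in> toda_dom_p n" "q \<in> toda_dom_p n"
  let ?b = "\<lambda>i. if i < n - 1 then diag_ratio g i * a i else a i"
  have sc: "scale_a n (diag_ratio g) (a, r) = (?b, r)" for r by (auto simp: scale_a_def)
  have b: "?b \<in> toda_dom_a n"
    using scale_a_G1_dom[OF g, of "(a, p)"] apq by (simp add: sc toda_dom_def)
  then show "toda_rep c n g s (a, p) = toda_rep c n g s (a, q)"
    using apq polarized_indep[OF s b apq(2,3)] by (simp add: toda_rep_def sc phase_def toda_dom_def)
qed (simp add: toda_rep_def)

lemma smooth_polarized_rep: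
  assumes g: "g \<in> G1 n" and s: "s \<in> smooth_polarized n"
  shows "toda_rep c n g s \<in> smooth_polarized n"
proof -
  have sm: "toda_smooth n s" and pol: "polarized n s" using s by (simp_all add: smooth_polarized_def)
  let ?E = "\<lambda>x. exp ((2 * complex_of_real pi * \<i>) * (complex_of_real (c * ln (g $$ (n - 1, n - 1)))
      + (\<Sum>i<n - 1. complex_of_real (g $$ (Suc i, i) / g $$ (i, i)) * complex_of_real (fst x i)))) *
      s (scale_a n (diag_ratio g) x)"
  have "smooth_expr n ?E"
    by (intro smooth_expr.add smooth_expr.mult smooth_expr.exp smooth_expr_sum smooth_expr.const
        smooth_expr.scale[OF smooth_expr.smooth[OF sm] diag_ratio_pos[OF g]]) (simp add: smooth_expr.coord)
  then have "toda_smooth n ?E" by (rule smooth_expr_smooth)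
  moreover have "toda_rep c n g s x = ?E x" if "x \<in> toda_dom n" for x
    using that by (simp add: toda_rep_def phase_def)
  ultimately have "toda_smooth n (toda_rep c n g s)" by (simp only: toda_smooth_cong[of n "toda_rep c n g s" ?E])
  then show ?thesis using polarized_toda_rep[OF g pol] by (simp add: smooth_polarized_def)
qed

lemma group_rep_toda_rep:
  assumes "0 < n"
  shows "group_rep n {s. polarized n s} (toda_rep c n)"
  unfolding group_rep_def
  using toda_rep_lin toda_rep_mult[OF assms] polarized_toda_rep
    toda_rep_trivial[OF assms, of "1\<^sub>m n"] polarized_sections
  by simp

section \<open>The infinitesimal action\<close>

lemma pow_mat_entry_bound:
  fixes \<xi> :: "real mat"
  assumes \<xi>: "\<xi> \<in> carrier_mat n n" and M: "\<And>i j. i < n \<Longrightarrow> j < n \<Longrightarrow> \<bar>\<xi> $$ (i, j)\<bar> \<le> M"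
    and ij: "i < n" "j < n"
  shows "\<bar>(\<xi> ^\<^sub>m k) $$ (i, j)\<bar> \<le> (real n * M) ^ k"
  using ij
proof (induction k arbitrary: i j)
  case 0
  then show ?case using \<xi> by simp
next
  case (Suc k)
  have P: "\<xi> ^\<^sub>m k \<in> carrier_mat n n" using \<xi> by simp
  have M0: "0 \<le> M" using M[OF Suc.prems] abs_ge_zero order_trans by blast
  have "(\<xi> ^\<^sub>m Suc k) $$ (i, j) = (\<Sum>l<n. (\<xi> ^\<^sub>m k) $$ (i, l) * \<xi> $$ (l, j))"
    using \<xi> P Suc.prems by (simp add: scalar_prod_def atLeast0LessThan)
  then have "\<bar>(\<xi> ^\<^sub>m Suc k) $$ (i, j)\<bar> \<le> (\<Sum>l<n. \<bar>(\<xi> ^\<^sub>m k) $$ (i, l) * \<xi> $$ (l, j)\<bar>)"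
    by (simp only: sum_abs)
  also have "\<dots> \<le> (\<Sum>l<n. (real n * M) ^ k * M)"
    unfolding abs_mult using Suc.IH[OF Suc.prems(1)] M[OF _ Suc.prems(2)] M0
    by (intro sum_mono mult_mono) simp_all
  also have "\<dots> = (real n * M) ^ Suc k" by simp
  finally show ?case .
qed

lemma smult_pow_mat:
  fixes \<xi> :: "real mat"
  assumes \<xi>: "\<xi> \<in> carrier_mat n n"
  shows "(t \<cdot>\<^sub>m \<xi>) ^\<^sub>m k = t ^ k \<cdot>\<^sub>m (\<xi> ^\<^sub>m k)"
proof (induction k)
  case 0
  show ?case using \<xi> by (intro eq_matI) auto
next
  case (Suc k)
  have P: "\<xi> ^\<^sub>m k \<in> carrier_mat n n" using \<xi> by simp
  show ?case
    using mult_smult_distrib[OF smult_carrier_mat[OF P, of "t ^ k"] \<xi>, of t] mult_smult_assoc_mat[OF P \<xi>, of "t ^ k"]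
    by (simp add: Suc.IH) (rule eq_matI, simp_all add: mult_ac)
qed

text \<open>
  Each entry of \<open>exp (t \<xi>)\<close> is a power series in \<open>t\<close>, everywhere convergent by \<open>pow_mat_entry_bound\<close>; the
  claims read off its first two coefficients.
\<close>

lemma mat_exp_deriv:
  fixes \<xi> :: "real mat"
  assumes \<xi>: "\<xi> \<in> carrier_mat n n" and ij: "i < n" "j < n"
  shows "((\<lambda>t. mat_exp n (t \<cdot>\<^sub>m \<xi>) $$ (i, j)) has_real_derivative \<xi> $$ (i, j)) (at 0)"
    and "mat_exp n (0 \<cdot>\<^sub>m \<xi>) $$ (i, j) = (if i = j then 1 else 0)"
proof -
  define a where "a k = (\<xi> ^\<^sub>m k) $$ (i, j) / fact k" for k
  have eq: "mat_exp n (t \<cdot>\<^sub>m \<xi>) $$ (i, j) = (\<Sum>k. a k * t ^ k)" for t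
  proof -
    have "((t \<cdot>\<^sub>m \<xi>) ^\<^sub>m k) $$ (i, j) / fact k = a k * t ^ k" for k
    proof -
      have "\<xi> ^\<^sub>m k \<in> carrier_mat n n" using \<xi> by simp
      then show ?thesis using ij carrier_matD[of "\<xi> ^\<^sub>m k" n n] by (simp add: smult_pow_mat[OF \<xi>] a_def)
    qed
    then show ?thesis using ij by (simp add: mat_exp_def)
  qed
  define M where "M = (\<Sum>i<n. \<Sum>j<n. \<bar>\<xi> $$ (i, j)\<bar>)"
  have M: "\<bar>\<xi> $$ (i, j)\<bar> \<le> M" if "i < n" "j < n" for i j
  proof -
    have "\<bar>\<xi> $$ (i, j)\<bar> \<le> (\<Sum>j<n. \<bar>\<xi> $$ (i, j)\<bar>)"
      using that by (intro member_le_sum) auto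
    also have "\<dots> \<le> M" unfolding M_def
      using that by (intro member_le_sum[of i "{..<n}" "\<lambda>i. \<Sum>j<n. \<bar>\<xi> $$ (i, j)\<bar>"]) (auto intro: sum_nonneg)
    finally show ?thesis .
  qed
  have summable: "summable (\<lambda>k. a k * t ^ k)" for t
  proof (rule summable_comparison_test'[where N = 0])
    show "summable (\<lambda>k. inverse (fact k) * (real n * M * \<bar>t\<bar>) ^ k)" by (rule summable_exp)
    show "norm (a k * t ^ k) \<le> inverse (fact k) * (real n * M * \<bar>t\<bar>) ^ k" for k
    proof -
      have "norm (a k * t ^ k) = inverse (fact k) * (\<bar>(\<xi> ^\<^sub>m k) $$ (i, j)\<bar> * \<bar>t\<bar> ^ k)"
        by (simp add: a_def abs_mult power_abs divide_inverse)
      also have "\<dots> \<le> inverse (fact k) * ((real n * M) ^ k * \<bar>t\<bar> ^ k)"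
        using pow_mat_entry_bound[OF \<xi> M ij] by (intro mult_left_mono mult_right_mono) simp_all
      finally show ?thesis by (simp add: power_mult_distrib)
    qed
  qed
  have "((\<lambda>t. \<Sum>k. a k * t ^ k) has_real_derivative (\<Sum>k. diffs a k * 0 ^ k)) (at 0)"
    by (rule termdiffs_strong_converges_everywhere[OF summable])
  moreover have "(\<Sum>k. diffs a k * 0 ^ k) = \<xi> $$ (i, j)"
  proof -
    have "\<xi> ^\<^sub>m Suc 0 = \<xi>" using left_mult_one_mat[OF \<xi>] carrier_matD[OF \<xi>] by simp
    then have "diffs a 0 = \<xi> $$ (i, j)" by (simp only: diffs_def a_def) simp
    then show ?thesis by (simp only: powser_zero)
  qed
  ultimately show "((\<lambda>t. mat_exp n (t \<cdot>\<^sub>m \<xi>) $$ (i, j)) has_real_derivative \<xi> $$ (i, j)) (at 0)"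
    by (simp add: eq)
  show "mat_exp n (0 \<cdot>\<^sub>m \<xi>) $$ (i, j) = (if i = j then 1 else 0)"
    unfolding eq powser_zero using ij carrier_matD[OF \<xi>] by (simp add: a_def)
qed

text \<open>
  Product rule: the derivative of the phase is the potential of \<open>\<xi>\<close>, and the dilation factors have
  derivatives \<open>- diag_diff \<xi> i\<close>, which the chain rule turns into the Euler field.
\<close>

lemma toda_rep_derivative:
  assumes n: "0 < n" and \<xi>: "\<xi> \<in> carrier_mat n n" and s: "s \<in> smooth_polarized n" and x: "x \<in> toda_dom n"
  shows "((\<lambda>t. toda_rep c n (mat_exp n (t \<cdot>\<^sub>m \<xi>)) s x) has_vector_derivative toda_rho c n \<xi> s x) (at 0)"
proof -
  have sm: "toda_smooth n s" and pol: "polarized n s" using s by (simp_all add: smooth_polarized_def)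
  define e where "e t i j = mat_exp n (t \<cdot>\<^sub>m \<xi>) $$ (i, j)" for t i j
  note de = mat_exp_deriv(1)[OF \<xi>, folded e_def] and e0 = mat_exp_deriv(2)[OF \<xi>, folded e_def]
  define y where "y i t = e t (Suc i) (Suc i) / e t i i * fst x i" for i t
  have dy: "(y i has_real_derivative - (diag_diff \<xi> i * fst x i)) (at 0)" if "i < n - 1" for i
  proof -
    have "Suc i < n" "i < n" using that by auto
    then show ?thesis unfolding y_def
      by (auto intro!: derivative_eq_intros de simp: e0 diag_diff_def algebra_simps)
  qed
  have y0: "y i 0 = fst x i" if "i < n - 1" for i using that by (simp add: y_def e0)
  define \<phi> where "\<phi> t = c * ln (e t (n - 1) (n - 1)) + (\<Sum>i<n - 1. e t (Suc i) i / e t i i * fst x i)" for t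
  have d\<phi>: "(\<phi> has_real_derivative potential c n \<xi> x) (at 0)"
  proof -
    have 1: "((\<lambda>t. c * ln (e t (n - 1) (n - 1))) has_real_derivative c * \<xi> $$ (n - 1, n - 1)) (at 0)"
      using n by (auto intro!: derivative_eq_intros de simp: e0)
    have 2: "((\<lambda>t. e t (Suc i) i / e t i i * fst x i) has_real_derivative \<xi> $$ (Suc i, i) * fst x i) (at 0)"
      if "i \<in> {..<n - 1}" for i
    proof -
      have "Suc i < n" "i < n" using that by auto
      then show ?thesis by (auto intro!: derivative_eq_intros de simp: e0)
    qed
    show ?thesis
      unfolding \<phi>_def potential_def mult.commute[of "\<xi> $$ (n - 1, n - 1)" c]
      by (rule DERIV_add[OF 1 DERIV_sum]) (rule 2)
  qed
  have \<phi>0: "\<phi> 0 = 0" using n by (simp add: \<phi>_def e0)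
  let ?I = "2 * complex_of_real pi * \<i>"
  have "((\<lambda>t. ?I * complex_of_real (\<phi> t)) has_vector_derivative ?I * complex_of_real (potential c n \<xi> x)) (at 0)"
    using d\<phi> by (intro has_vector_derivative_mult_right bounded_linear.has_vector_derivative[OF bounded_linear_of_real])
      (simp add: has_real_derivative_iff_has_vector_derivative)
  note dexp = has_vector_derivative_exp_comp[OF this]
  let ?z = "\<lambda>t. ((\<lambda>i. if i < n - 1 then y i t else fst x i), snd x)"
  have ds: "((\<lambda>t. s (?z t)) has_vector_derivative (\<Sum>i<n - 1. (- (diag_diff \<xi> i * fst x i)) *\<^sub>R pd_a i s x)) (at 0)"
    by (rule chain_rule_a[OF sm x dy y0])
  have z0: "?z 0 = x" using y0 by (intro prod_eqI) (auto simp: fun_eq_iff)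
  have rep: "toda_rep c n (mat_exp n (t \<cdot>\<^sub>m \<xi>)) s x = exp (?I * complex_of_real (\<phi> t)) * s (?z t)" for t
    using x by (simp add: toda_rep_def phase_def \<phi>_def e_def scale_a_def diag_ratio_def y_def cong: if_cong)
  have "(\<Sum>i<n - 1. (- (diag_diff \<xi> i * fst x i)) *\<^sub>R pd_a i s x) = - euler n (diag_diff \<xi>) s x"
    by (simp add: euler_def scaleR_conv_of_real sum_negf)
  then have "exp (?I * complex_of_real (\<phi> 0)) * (\<Sum>i<n - 1. (- (diag_diff \<xi> i * fst x i)) *\<^sub>R pd_a i s x) +
      ?I * complex_of_real (potential c n \<xi> x) * exp (?I * complex_of_real (\<phi> 0)) * s (?z 0) = toda_rho c n \<xi> s x"
    unfolding z0 using x by (simp add: \<phi>0 toda_rho_eq[OF n \<xi> pol])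
  then show ?thesis
    unfolding rep using has_vector_derivative_mult[OF dexp ds] by simp
qed

section \<open>The Liouville measure\<close>

lemma toda_omega_coordinate:
  assumes "i < n - 1" "j < n - 1"
  shows "toda_omega n x (vec_a i) (vec_p j) = (if i = j then 1 / fst x i else 0)"
    "toda_omega n x (vec_p i) (vec_a j) = (if i = j then - 1 / fst x i else 0)"
    "toda_omega n x (vec_a i) (vec_a j) = 0" "toda_omega n x (vec_p i) (vec_p j) = 0"
proof -
  have "toda_omega n x (vec_a i) (vec_p j) = (\<Sum>k<n - 1. if k = i then (if i = j then 1 / fst x i else 0) else 0)"
    unfolding toda_omega_def by (intro sum.cong) (auto simp: vec_a_def vec_p_def)
  then show "toda_omega n x (vec_a i) (vec_p j) = (if i = j then 1 / fst x i else 0)"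
    using assms by simp
  have "toda_omega n x (vec_p i) (vec_a j) = (\<Sum>k<n - 1. if k = i then (if i = j then - 1 / fst x i else 0) else 0)"
    unfolding toda_omega_def by (intro sum.cong) (auto simp: vec_a_def vec_p_def)
  then show "toda_omega n x (vec_p i) (vec_a j) = (if i = j then - 1 / fst x i else 0)"
    using assms by simp
qed (simp_all add: toda_omega_def vec_a_def vec_p_def)

definition frame :: "nat list \<Rightarrow> tangent list" where
  "frame xs = concat (map (\<lambda>i. [vec_a i, vec_p i]) xs)"

lemma frame_simps [simp]:
  "frame [] = []" "frame (i # xs) = vec_a i # vec_p i # frame xs" "frame (xs @ ys) = frame xs @ frame ys"
  by (simp_all add: frame_def)

lemma length_frame [simp]: "length (frame xs) = 2 * length xs"
  by (induction xs) simp_all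

lemma nth_frame:
  "j < 2 * length xs \<Longrightarrow> frame xs ! j = (if even j then vec_a (xs ! (j div 2)) else vec_p (xs ! (j div 2)))"
proof (induction xs arbitrary: j)
  case (Cons i xs)
  consider "j = 0" | "j = 1" | k where "j = Suc (Suc k)" by (cases j; cases "j - 1") auto
  then show ?case using Cons by cases auto
qed simp

lemma nths_frame_remove:
  assumes "k < length xs"
  shows "nths (frame xs) (- {2 * k, 2 * k + 1}) = frame (take k xs @ drop (Suc k) xs)"
proof -
  have "frame xs = frame (take k xs) @ ([vec_a (xs ! k), vec_p (xs ! k)] @ frame (drop (Suc k) xs))"
    by (subst id_take_nth_drop[OF assms]) simp
  moreover have "nths (frame (take k xs)) (- {2 * k, 2 * k + 1}) = frame (take k xs)"
    using assms by (intro nths_all) (auto simp: min_def)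
  moreover have "nths (frame (drop (Suc k) xs)) {j. j + 2 + 2 * k \<in> - {2 * k, 2 * k + 1}} = frame (drop (Suc k) xs)"
    by (intro nths_all) auto
  ultimately show ?thesis
    using assms by (simp add: nths_append nths_Cons min_def add.commute add.left_commute)
qed

text \<open>
  Expand along the first factor. By duality of the frame, the only pairs of vectors on which \<open>\<omega>\<close> does not
  vanish are \<open>\<partial>/\<partial>a\<^sub>i, \<partial>/\<partial>p\<^sub>i\<close> in adjacent positions, with sign \<open>1\<close>. Each of the \<open>length xs\<close> choices leaves the frame
  of the remaining indices, which produces the factorial.
\<close>

lemma wedge_power_frame:
  assumes "distinct xs" "set xs \<subseteq> {..<n - 1}"
  shows "wedge_power (toda_omega n x) (length xs) (frame xs) = fact (length xs) * (\<Prod>i\<in>set xs. 1 / fst x i)"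
  using assms
proof (induction "length xs" arbitrary: xs)
  case 0
  then show ?case by simp
next
  case (Suc m)
  define T where "T = (\<lambda>(i, j). (-1) ^ (i + j + 1) * toda_omega n x (frame xs ! i) (frame xs ! j) *
      wedge_power (toda_omega n x) m (nths (frame xs) (- {i, j})))"
  have lt: "xs ! k < n - 1" if "k < length xs" for k
    using Suc.prems(2) nth_mem[OF that] by blast
  have zero: "T z = 0" if "z \<in> {(i, j). i < j \<and> j < length (frame xs)} - (\<lambda>k. (2 * k, 2 * k + 1)) ` {..<length xs}" for z
  proof -
    obtain i j where z: "z = (i, j)" by (cases z)
    have ij: "i < j" "j < 2 * length xs" using that z by auto
    have no: "\<not> (\<exists>k<length xs. i = 2 * k \<and> j = 2 * k + 1)" using that z by auto
    have d: "i div 2 < length xs" "j div 2 < length xs" using ij by auto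
    have "toda_omega n x (frame xs ! i) (frame xs ! j) = 0"
    proof (cases "i div 2 = j div 2")
      case True
      then have "i = 2 * (i div 2) \<and> j = 2 * (i div 2) + 1" using ij(1) by presburger
      then show ?thesis using no d(1) by blast
    next
      case False
      then have "xs ! (i div 2) \<noteq> xs ! (j div 2)"
        using d Suc.prems(1) by (simp add: nth_eq_iff_index_eq)
      then show ?thesis using ij lt[OF d(1)] lt[OF d(2)] by (simp add: nth_frame toda_omega_coordinate)
    qed
    then show ?thesis by (simp add: T_def z)
  qed
  have fin: "finite {(i, j). i < j \<and> j < length (frame xs)}"
    by (rule finite_subset[of _ "{..<length (frame xs)} \<times> {..<length (frame xs)}"]) auto
  have "wedge_power (toda_omega n x) (length xs) (frame xs) = sum T {(i, j). i < j \<and> j < length (frame xs)}"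
    by (simp flip: Suc.hyps(2) add: T_def)
  also have "\<dots> = sum T ((\<lambda>k. (2 * k, 2 * k + 1)) ` {..<length xs})"
    by (rule sum.mono_neutral_right[OF fin]) (use zero in auto)
  also have "\<dots> = (\<Sum>k<length xs. T (2 * k, 2 * k + 1))"
    by (subst sum.reindex) (auto simp: inj_on_def)
  also have "\<dots> = (\<Sum>k<length xs. fact m * (\<Prod>i\<in>set xs. 1 / fst x i))"
  proof (rule sum.cong[OF refl])
    fix k assume "k \<in> {..<length xs}"
    then have k: "k < length xs" by simp
    \<comment> \<open>the frame vectors at positions \<open>2 * k\<close> and \<open>2 * k + 1\<close> are those of index \<open>xs ! k\<close>\<close>
    let ?ys = "take k xs @ drop (Suc k) xs"
    have split: "xs = take k xs @ xs ! k # drop (Suc k) xs" by (rule id_take_nth_drop[OF k])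
    have "distinct (take k xs @ xs ! k # drop (Suc k) xs)"
      using Suc.prems(1) by (simp only: split[symmetric])
    then have dys: "distinct ?ys" "xs ! k \<notin> set ?ys" by auto
    have set_xs: "set xs = insert (xs ! k) (set ?ys)"
      by (subst split) simp
    have len: "m = length ?ys" using Suc.hyps(2) k by simp
    have "wedge_power (toda_omega n x) m (frame ?ys) = fact m * (\<Prod>i\<in>set ?ys. 1 / fst x i)"
      using Suc.hyps(1)[OF len dys(1)] set_xs Suc.prems(2) len by auto
    moreover have "toda_omega n x (frame xs ! (2 * k)) (frame xs ! (2 * k + 1)) = 1 / fst x (xs ! k)"
      using k lt[OF k] by (simp add: nth_frame toda_omega_coordinate)
    ultimately show "T (2 * k, 2 * k + 1) = fact m * (\<Prod>i\<in>set xs. 1 / fst x i)"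
      unfolding T_def using dys(2) set_xs by (simp add: nths_frame_remove[OF k, simplified])
  qed
  also have "\<dots> = fact (length xs) * (\<Prod>i\<in>set xs. 1 / fst x i)"
    by (simp flip: Suc.hyps(2))
  finally show ?case .
qed

lemma liouville_density_eq:
  assumes "x \<in> toda_dom n"
  shows "liouville_density n x = fact (n - 1) / (\<Prod>i<n - 1. fst x i)"
proof -
  have "set [0..<n - 1] = {..<n - 1}" by auto
  then have "liouville_density n x = \<bar>fact (n - 1) * (\<Prod>i<n - 1. 1 / fst x i)\<bar>"
    unfolding liouville_density_def
    using wedge_power_frame[of "[0..<n - 1]" n x] by (simp add: frame_def)
  moreover have "0 < (\<Prod>i<n - 1. fst x i)" using assms by (intro prod_pos) (simp add: toda_dom_iff)
  ultimately show ?thesis by (simp add: prod_dividef)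
qed

interpretation lborel_prod: product_sigma_finite "\<lambda>_. lborel :: real measure"
  by standard

lemma sigma_finite_lebesgue_coords: "sigma_finite_measure (lebesgue_coords n)"
  unfolding lebesgue_coords_def by (rule lborel_prod.sigma_finite) simp

lemma space_lebesgue_coords: "space (lebesgue_coords n) = toda_dom_p n"
  by (simp add: lebesgue_coords_def space_PiM toda_dom_p_def)

lemma toda_dom_a_sets [measurable]: "toda_dom_a n \<in> sets (lebesgue_coords n)"
  unfolding lebesgue_coords_def toda_dom_a_def by (rule sets_PiM_I_finite) auto

lemma measurable_lebesgue_coords_component [measurable]:
  "i < n - 1 \<Longrightarrow> (\<lambda>a. a i) \<in> borel_measurable (lebesgue_coords n)"
  unfolding lebesgue_coords_def by measurable

lemma toda_dom_sets [measurable]: "toda_dom n \<in> sets (lebesgue_coords n \<Otimes>\<^sub>M lebesgue_coords n)"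
  unfolding toda_dom_def using sets.top[of "lebesgue_coords n"]
  by (intro pair_measureI toda_dom_a_sets) (simp add: space_lebesgue_coords)

text \<open>
  This relates the \<open>\<sigma>\<close>-algebra of the product over the finite index set to the Borel sets of \<open>nat \<Rightarrow> real\<close>, in
  whose topology sections are continuous; the components outside the index set are constant.
\<close>

lemma measurable_lebesgue_coords_borel: "(\<lambda>a. a) \<in> measurable (lebesgue_coords n) borel"
proof (rule measurable_coordinatewise_then_product)
  fix i show "(\<lambda>a. a i) \<in> borel_measurable (lebesgue_coords n)"
  proof (cases "i < n - 1")
    case True
    then show ?thesis by measurable
  next
    case False
    then have "(\<lambda>a. a i) \<in> borel_measurable (lebesgue_coords n) \<longleftrightarrow>
        (\<lambda>_. undefined :: real) \<in> borel_measurable (lebesgue_coords n)"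
      by (intro measurable_cong) (auto simp: space_lebesgue_coords toda_dom_p_def PiE_iff extensional_def)
    then show ?thesis by simp
  qed
qed

lemma toda_dom_borel: "toda_dom n \<in> sets borel"
proof -
  have [measurable]: "(\<lambda>x::coords. fst x i) \<in> borel_measurable borel" "(\<lambda>x::coords. snd x i) \<in> borel_measurable borel" for i
    by (intro borel_measurable_continuous_onI continuous_on_coords)+
  have "toda_dom n = {x \<in> space borel. (\<forall>i\<in>{..<n-1}. 0 < fst x i) \<and>
      (\<forall>i\<in>{n-1..}. fst x i = undefined \<and> snd x i = undefined)}"
    by (auto simp: toda_dom_iff)
  also have "\<dots> \<in> sets borel" by measurable
  finally show ?thesis .
qed

lemma continuous_section_measurable:
  fixes s :: "coords \<Rightarrow> complex"
  assumes "continuous_on (toda_dom n) s" "s \<in> toda_sections n"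
  shows "s \<in> borel_measurable (lebesgue_coords n \<Otimes>\<^sub>M lebesgue_coords n)"
proof -
  have "(\<lambda>x. indicator (toda_dom n) x *\<^sub>R s x) \<in> borel_measurable borel"
    by (rule borel_measurable_continuous_on_indicator[OF toda_dom_borel assms(1)])
  moreover have "(\<lambda>x. indicator (toda_dom n) x *\<^sub>R s x) = s"
    using assms(2) by (auto simp: toda_sections_def indicator_def fun_eq_iff)
  ultimately have s: "s \<in> borel_measurable borel" by simp
  have "(\<lambda>x. (fst x, snd x)) \<in> measurable (lebesgue_coords n \<Otimes>\<^sub>M lebesgue_coords n) (borel \<Otimes>\<^sub>M borel)"
    by (intro measurable_Pair measurable_compose[OF measurable_fst measurable_lebesgue_coords_borel]
        measurable_compose[OF measurable_snd measurable_lebesgue_coords_borel])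
  then have "(\<lambda>x::coords. x) \<in> measurable (lebesgue_coords n \<Otimes>\<^sub>M lebesgue_coords n) borel"
    by (simp add: borel_prod)
  from measurable_compose[OF this s] show ?thesis .
qed

lemma sets_liouville [measurable_cong]:
  "sets (liouville_measure n) = sets (lebesgue_coords n \<Otimes>\<^sub>M lebesgue_coords n)"
  by (simp add: liouville_measure_def)

lemma liouville_measure_eq:
  "liouville_measure n = density (lebesgue_coords n \<Otimes>\<^sub>M lebesgue_coords n)
     (\<lambda>x. ennreal (fact (n - 1) / (\<Prod>i<n - 1. fst x i)) * indicator (toda_dom n) x)"
proof -
  have "(\<lambda>x. ennreal (liouville_density n x) * indicator (toda_dom n) x) =
      (\<lambda>x. ennreal (fact (n - 1) / (\<Prod>i<n - 1. fst x i)) * indicator (toda_dom n) x)"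
    by (auto simp: indicator_def fun_eq_iff liouville_density_eq)
  then show ?thesis by (simp add: liouville_measure_def)
qed

lemma gauss_lebesgue:
  "(\<integral>\<^sup>+p. ennreal (exp (- (\<Sum>i<n - 1. (p i)\<^sup>2))) \<partial>lebesgue_coords n) = ennreal (sqrt pi ^ (n - 1))"
proof -
  have 1: "(\<integral>\<^sup>+t. ennreal (exp (- t\<^sup>2)) \<partial>lborel) = ennreal (sqrt pi)"
  proof -
    have "has_bochner_integral lborel (\<lambda>t::real. exp (- t\<^sup>2)) (2 *\<^sub>R (sqrt pi / 2))"
      by (rule has_bochner_integral_even_function[OF gaussian_moment_0]) simp
    then show ?thesis
      by (subst nn_integral_eq_integral) (auto simp: has_bochner_integral_iff)
  qed
  have "(\<integral>\<^sup>+p. ennreal (exp (- (\<Sum>i<n - 1. (p i)\<^sup>2))) \<partial>lebesgue_coords n) =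
      (\<integral>\<^sup>+p. (\<Prod>i<n - 1. ennreal (exp (- (p i)\<^sup>2))) \<partial>lebesgue_coords n)"
    by (simp add: prod_ennreal exp_sum[symmetric] sum_negf)
  also have "\<dots> = (\<Prod>i<n - 1. ennreal (sqrt pi))"
    unfolding lebesgue_coords_def
    by (subst lborel_prod.product_nn_integral_prod) (simp_all add: 1)
  finally show ?thesis by (simp add: ennreal_power)
qed

text \<open>
  Tonelli: the integrand is a function of \<open>a\<close> times the Gaussian weight in \<open>p\<close>, whose integral is
  \<open>sqrt pi ^ (n - 1)\<close>.
\<close>

lemma toda_normsq_eq:
  assumes s: "s \<in> borel_measurable (lebesgue_coords n \<Otimes>\<^sub>M lebesgue_coords n)"
    and indep: "\<And>a q. a \<in> toda_dom_a n \<Longrightarrow> q \<in> toda_dom_p n \<Longrightarrow> s (a, q) = s (a, p)"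
    and p: "p \<in> toda_dom_p n"
  shows "toda_normsq n s = ennreal (fact (n - 1) * sqrt pi ^ (n - 1)) *
    (\<integral>\<^sup>+a\<in>toda_dom_a n. ennreal ((cmod (s (a, p)))\<^sup>2 / (\<Prod>i<n - 1. a i)) \<partial>lebesgue_coords n)"
proof -
  let ?P = "lebesgue_coords n"
  let ?w = "\<lambda>q. ennreal (exp (- (\<Sum>i<n - 1. (q i)\<^sup>2)))"
  let ?h = "\<lambda>a. ennreal ((cmod (s (a, p)))\<^sup>2 / (\<Prod>i<n - 1. a i)) * indicator (toda_dom_a n) a"
  interpret P: sigma_finite_measure ?P by (rule sigma_finite_lebesgue_coords)
  note s [measurable]
  have [measurable]: "(\<lambda>a. s (a, p)) \<in> borel_measurable ?P"
    using p by (intro measurable_Pair2'[THEN measurable_compose, OF _ s]) (simp add: space_lebesgue_coords)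
  have "toda_normsq n s = (\<integral>\<^sup>+x. ennreal (fact (n - 1) / (\<Prod>i<n - 1. fst x i)) * indicator (toda_dom n) x *
      ennreal ((cmod (s x))\<^sup>2 * exp (- (\<Sum>i<n - 1. (snd x i)\<^sup>2))) \<partial>(?P \<Otimes>\<^sub>M ?P))"
    unfolding toda_normsq_def liouville_measure_eq by (subst nn_integral_density) simp_all
  also have "\<dots> = (\<integral>\<^sup>+a. \<integral>\<^sup>+q. ennreal (fact (n - 1) / (\<Prod>i<n - 1. a i)) * indicator (toda_dom n) (a, q) *
      ennreal ((cmod (s (a, q)))\<^sup>2 * exp (- (\<Sum>i<n - 1. (q i)\<^sup>2))) \<partial>?P \<partial>?P)"
    by (subst P.nn_integral_fst[symmetric]) simp_all
  also have "\<dots> = (\<integral>\<^sup>+a. \<integral>\<^sup>+q. (ennreal (fact (n - 1)) * ?h a) * ?w q \<partial>?P \<partial>?P)"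
  proof (intro nn_integral_cong)
    fix a q assume "a \<in> space ?P" and q: "q \<in> space ?P"
    show "ennreal (fact (n - 1) / (\<Prod>i<n - 1. a i)) * indicator (toda_dom n) (a, q) *
        ennreal ((cmod (s (a, q)))\<^sup>2 * exp (- (\<Sum>i<n - 1. (q i)\<^sup>2))) = (ennreal (fact (n - 1)) * ?h a) * ?w q"
    proof (cases "a \<in> toda_dom_a n")
      case True
      then have "0 < (\<Prod>i<n - 1. a i)" by (intro prod_pos) (auto simp: toda_dom_a_def PiE_iff)
      then show ?thesis
        using True q indep[OF True] by (simp add: toda_dom_def space_lebesgue_coords flip: ennreal_mult')
    next
      case False
      then show ?thesis by (simp add: toda_dom_def)
    qed
  qed
  also have "\<dots> = (\<integral>\<^sup>+a. (ennreal (fact (n - 1)) * ?h a) * ennreal (sqrt pi ^ (n - 1)) \<partial>?P)"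
    by (intro nn_integral_cong, subst nn_integral_cmult, measurable, simp only: gauss_lebesgue)
  also have "\<dots> = ennreal (fact (n - 1)) * (\<integral>\<^sup>+a. ?h a \<partial>?P) * ennreal (sqrt pi ^ (n - 1))"
    by (simp add: nn_integral_cmult nn_integral_multc)
  finally show ?thesis
    by (simp add: ennreal_mult ac_simps)
qed

lemma lebesgue_coords_scale:
  assumes l: "\<And>i. i < n - 1 \<Longrightarrow> 0 < l i"
  shows "lebesgue_coords n = density (distr (lebesgue_coords n) (lebesgue_coords n)
    (\<lambda>a. \<lambda>i\<in>{..<n - 1}. l i * a i)) (\<lambda>_. ennreal (\<Prod>i<n - 1. l i))"
proof -
  let ?I = "{..<n - 1}" and ?\<sigma> = "\<lambda>a. \<lambda>i\<in>{..<n - 1}. l i * a i"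
  let ?P = "PiM ?I (\<lambda>_. lborel :: real measure)"
  have \<sigma> [measurable]: "?\<sigma> \<in> measurable ?P ?P" by measurable
  have "density (distr ?P ?P ?\<sigma>) (\<lambda>_. ennreal (\<Prod>i<n - 1. l i)) = ?P"
  proof (rule lborel_prod.PiM_eqI)
    fix B :: "nat \<Rightarrow> real set" assume B: "\<And>i. i \<in> ?I \<Longrightarrow> B i \<in> sets lborel"
    have PB: "PiE ?I B \<in> sets ?P" using B by (intro sets_PiM_I_finite) auto
    have pre: "(*) (l i) -` B i \<in> sets lborel" if "i \<in> ?I" for i
      using measurable_sets[of "(*) (l i)" borel borel "B i"] B[OF that] by simp
    have one: "ennreal (l i) * emeasure lborel ((*) (l i) -` B i) = emeasure lborel (B i)" if "i \<in> ?I" for i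
    proof -
      have li: "0 < l i" using l that by simp
      have "emeasure lborel (B i) = emeasure (density (distr lborel borel ((*) (l i))) (\<lambda>_. ennreal \<bar>l i\<bar>)) (B i)"
        using lborel_distr_mult'[of "l i"] li by simp
      also have "\<dots> = ennreal (l i) * emeasure (distr lborel borel ((*) (l i))) (B i)"
        using li B[OF that] by (simp add: emeasure_density_const)
      also have "\<dots> = ennreal (l i) * emeasure lborel ((*) (l i) -` B i)"
        using B[OF that] by (simp add: emeasure_distr)
      finally show ?thesis by simp
    qed
    have "?\<sigma> -` PiE ?I B \<inter> space ?P = PiE ?I (\<lambda>i. (*) (l i) -` B i)"
      by (auto simp: space_PiM PiE_iff)
    moreover have "emeasure ?P (PiE ?I (\<lambda>i. (*) (l i) -` B i)) = (\<Prod>i\<in>?I. emeasure lborel ((*) (l i) -` B i))"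
      by (rule lborel_prod.emeasure_PiM) (simp, rule pre)
    ultimately have "emeasure (density (distr ?P ?P ?\<sigma>) (\<lambda>_. ennreal (\<Prod>i<n - 1. l i))) (PiE ?I B) =
        ennreal (\<Prod>i<n - 1. l i) * (\<Prod>i\<in>?I. emeasure lborel ((*) (l i) -` B i))"
      using PB by (simp add: emeasure_density_const emeasure_distr)
    also have "\<dots> = (\<Prod>i\<in>?I. ennreal (l i) * emeasure lborel ((*) (l i) -` B i))"
    proof -
      have "(\<Prod>i\<in>?I. ennreal (l i)) = ennreal (\<Prod>i<n - 1. l i)"
        using l by (intro prod_ennreal) (simp add: less_imp_le)
      then show ?thesis by (simp add: prod.distrib)
    qed
    also have "\<dots> = (\<Prod>i\<in>?I. emeasure lborel (B i))"
      by (intro prod.cong refl one)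
    finally show "emeasure (density (distr ?P ?P ?\<sigma>) (\<lambda>_. ennreal (\<Prod>i<n - 1. l i))) (PiE ?I B) =
        (\<Prod>i\<in>?I. emeasure lborel (B i))" .
  qed simp_all
  then show ?thesis by (simp add: lebesgue_coords_def)
qed

text \<open>
  \<open>da\<^sub>1 \<cdots> da\<^sub>n\<^sub>-\<^sub>1 / (a\<^sub>1 \<cdots> a\<^sub>n\<^sub>-\<^sub>1)\<close> is the Haar measure of the multiplicative group of positive vectors. This
  is what makes the dilations unitary.
\<close>

lemma scale_invariant_integral:
  assumes l: "\<And>i. i < n - 1 \<Longrightarrow> 0 < l i" and F [measurable]: "F \<in> borel_measurable (lebesgue_coords n)"
  shows "(\<integral>\<^sup>+a\<in>toda_dom_a n. ennreal (F (\<lambda>i\<in>{..<n - 1}. l i * a i) / (\<Prod>i<n - 1. a i)) \<partial>lebesgue_coords n) =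
    (\<integral>\<^sup>+a\<in>toda_dom_a n. ennreal (F a / (\<Prod>i<n - 1. a i)) \<partial>lebesgue_coords n)"
proof -
  let ?P = "lebesgue_coords n" and ?\<sigma> = "\<lambda>a. \<lambda>i\<in>{..<n - 1}. l i * a i"
  let ?L = "\<Prod>i<n - 1. l i"
  have L: "0 < ?L" using l by (intro prod_pos) simp
  let ?G = "\<lambda>a. ennreal (F a / (\<Prod>i<n - 1. a i)) * indicator (toda_dom_a n) a"
  have \<sigma> [measurable]: "?\<sigma> \<in> measurable ?P ?P" unfolding lebesgue_coords_def by measurable
  have "(\<integral>\<^sup>+a. ?G a \<partial>?P) = (\<integral>\<^sup>+a. ?G a \<partial>density (distr ?P ?P ?\<sigma>) (\<lambda>_. ennreal ?L))"
    using lebesgue_coords_scale[of n l, OF l] by simp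
  also have "\<dots> = (\<integral>\<^sup>+a. ennreal ?L * ?G a \<partial>distr ?P ?P ?\<sigma>)"
    by (rule nn_integral_density) measurable
  also have "\<dots> = (\<integral>\<^sup>+a. ennreal ?L * ?G (?\<sigma> a) \<partial>?P)"
    by (rule nn_integral_distr[OF \<sigma>]) measurable
  also have "\<dots> = (\<integral>\<^sup>+a. ennreal (F (?\<sigma> a) / (\<Prod>i<n - 1. a i)) * indicator (toda_dom_a n) a \<partial>?P)"
  proof (rule nn_integral_cong)
    fix a assume a: "a \<in> space ?P"
    have "?\<sigma> a \<in> toda_dom_a n \<longleftrightarrow> a \<in> toda_dom_a n"
      using a l by (auto simp: toda_dom_a_def PiE_iff space_lebesgue_coords toda_dom_p_def zero_less_mult_iff dest: less_asym)
    moreover have "(\<Prod>i<n - 1. ?\<sigma> a i) = ?L * (\<Prod>i<n - 1. a i)"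
      by (simp add: prod.distrib)
    moreover have "ennreal r * ennreal (u / (r * v)) = ennreal (u / v)" if "0 < r" for r u v :: real
      using that by (simp flip: ennreal_mult')
    ultimately show "ennreal ?L * ?G (?\<sigma> a) = ennreal (F (?\<sigma> a) / (\<Prod>i<n - 1. a i)) * indicator (toda_dom_a n) a"
      using L by (simp only: mult.assoc[symmetric] indicator_def)
  qed
  finally show ?thesis by simp
qed


section \<open>Square-integrable functions\<close>

text \<open>
  Riesz: pointwise convergence without loss of norm is convergence in \<open>L\<^sup>2\<close>. Apply Fatou to the non-negative
  functions \<open>2\<bar>u\<^sub>k\<bar>\<^sup>2 + 2\<bar>v\<bar>\<^sup>2 - \<bar>u\<^sub>k - v\<bar>\<^sup>2\<close>, which tend to \<open>4\<bar>v\<bar>\<^sup>2\<close>.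
\<close>

lemma L2_convergence_of_norms:
  fixes u :: "nat \<Rightarrow> 'a \<Rightarrow> complex"
  assumes [measurable]: "\<And>k. u k \<in> borel_measurable M" "v \<in> borel_measurable M"
    and lim: "\<And>x. x \<in> space M \<Longrightarrow> (\<lambda>k. u k x) \<longlonglongrightarrow> v x"
    and norm: "\<And>k. (\<integral>\<^sup>+x. ennreal ((cmod (u k x))\<^sup>2) \<partial>M) = (\<integral>\<^sup>+x. ennreal ((cmod (v x))\<^sup>2) \<partial>M)"
    and fin: "(\<integral>\<^sup>+x. ennreal ((cmod (v x))\<^sup>2) \<partial>M) < \<infinity>"
  shows "(\<lambda>k. \<integral>\<^sup>+x. ennreal ((cmod (u k x - v x))\<^sup>2) \<partial>M) \<longlonglongrightarrow> 0"
proof -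
  let ?J = "\<integral>\<^sup>+x. ennreal ((cmod (v x))\<^sup>2) \<partial>M"
  let ?d = "\<lambda>k. \<integral>\<^sup>+x. ennreal ((cmod (u k x - v x))\<^sup>2) \<partial>M"
  define g where "g k x = 2 * (cmod (u k x))\<^sup>2 + 2 * (cmod (v x))\<^sup>2 - (cmod (u k x - v x))\<^sup>2" for k x
  have g_nonneg: "0 \<le> g k x" for k x
  proof -
    have "(cmod (u k x - v x))\<^sup>2 \<le> (cmod (u k x) + cmod (v x))\<^sup>2"
      by (intro power_mono norm_triangle_ineq4) simp
    also have "\<dots> \<le> 2 * (cmod (u k x))\<^sup>2 + 2 * (cmod (v x))\<^sup>2"
      using sum_squares_bound[of "cmod (u k x)" "cmod (v x)"] by (simp add: power2_sum)
    finally show ?thesis by (simp add: g_def)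
  qed
  have [measurable]: "g k \<in> borel_measurable M" for k
    unfolding g_def by measurable
  have split: "(\<integral>\<^sup>+x. ennreal (g k x) \<partial>M) + ?d k = 4 * ?J" for k
  proof -
    have "(\<integral>\<^sup>+x. ennreal (g k x) \<partial>M) + ?d k = (\<integral>\<^sup>+x. ennreal (g k x) + ennreal ((cmod (u k x - v x))\<^sup>2) \<partial>M)"
      by (subst nn_integral_add) simp_all
    also have "\<dots> = (\<integral>\<^sup>+x. 2 * ennreal ((cmod (u k x))\<^sup>2) + 2 * ennreal ((cmod (v x))\<^sup>2) \<partial>M)"
    proof (rule nn_integral_cong)
      fix x
      have "ennreal (g k x) + ennreal ((cmod (u k x - v x))\<^sup>2) = ennreal (2 * (cmod (u k x))\<^sup>2 + 2 * (cmod (v x))\<^sup>2)"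
        using g_nonneg[of k x] by (simp add: g_def flip: ennreal_plus)
      then show "ennreal (g k x) + ennreal ((cmod (u k x - v x))\<^sup>2) =
          2 * ennreal ((cmod (u k x))\<^sup>2) + 2 * ennreal ((cmod (v x))\<^sup>2)"
        by (simp add: ennreal_plus ennreal_mult)
    qed
    also have "\<dots> = 2 * ?J + 2 * ?J"
      by (simp add: nn_integral_add nn_integral_cmult norm)
    finally show ?thesis by (simp add: mult_2[symmetric] mult.assoc[symmetric])
  qed
  have "4 * ?J = (\<integral>\<^sup>+x. liminf (\<lambda>k. ennreal (g k x)) \<partial>M)"
  proof -
    have "liminf (\<lambda>k. ennreal (g k x)) = 4 * ennreal ((cmod (v x))\<^sup>2)" if "x \<in> space M" for x
    proof -
      have "(\<lambda>k. g k x) \<longlonglongrightarrow> 2 * (cmod (v x))\<^sup>2 + 2 * (cmod (v x))\<^sup>2 - (cmod (v x - v x))\<^sup>2"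
        unfolding g_def by (intro tendsto_intros lim that)
      then have "(\<lambda>k. ennreal (g k x)) \<longlonglongrightarrow> ennreal (4 * (cmod (v x))\<^sup>2)" by (intro tendsto_ennrealI) simp
      from lim_imp_Liminf[OF sequentially_bot this] show ?thesis by (simp add: ennreal_mult)
    qed
    then show ?thesis by (simp add: nn_integral_cmult cong: nn_integral_cong)
  qed
  also have "\<dots> \<le> liminf (\<lambda>k. \<integral>\<^sup>+x. ennreal (g k x) \<partial>M)"
    by (rule nn_integral_liminf) simp
  finally have fatou: "4 * ?J \<le> liminf (\<lambda>k. \<integral>\<^sup>+x. ennreal (g k x) \<partial>M)" .
  have J4: "4 * ?J < \<infinity>" using fin by (simp add: ennreal_mult_less_top)
  show ?thesis
  proof (rule order_tendstoI)
    fix e :: ennreal assume e: "0 < e"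
    show "\<forall>\<^sub>F k in sequentially. ?d k < e"
    proof (cases "4 * ?J < e")
      case True
      have "?d k \<le> 4 * ?J" for k unfolding split[of k, symmetric] by simp
      then show ?thesis using True le_less_trans by (intro always_eventually allI) blast
    next
      case False
      then have "4 * ?J - e < 4 * ?J" using e J4
        by (intro ennreal_between) (auto intro: less_le_trans)
      then have "\<forall>\<^sub>F k in sequentially. 4 * ?J - e < (\<integral>\<^sup>+x. ennreal (g k x) \<partial>M)"
        using fatou by (intro less_LiminfD) (rule less_le_trans)
      then show ?thesis
      proof (rule eventually_mono)
        fix k assume *: "4 * ?J - e < (\<integral>\<^sup>+x. ennreal (g k x) \<partial>M)"
        show "?d k < e"
        proof (rule ccontr)
          assume "\<not> ?d k < e"
          then have "(\<integral>\<^sup>+x. ennreal (g k x) \<partial>M) + e \<le> 4 * ?J"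
            unfolding split[of k, symmetric] by (simp add: add_left_mono)
          from ennreal_minus_mono[OF this order_refl[of e]]
          have "(\<integral>\<^sup>+x. ennreal (g k x) \<partial>M) \<le> 4 * ?J - e"
            using False J4 by (subst (asm) ennreal_add_diff_cancel_right) auto
          then show False using * by simp
        qed
      qed
    qed
  qed simp
qed

section \<open>Isometries of a semi-inner product space act unitarily on its completion\<close>

locale semi_inner_space =
  fixes V :: "('x \<Rightarrow> complex) set" and ip :: "('x \<Rightarrow> complex) \<Rightarrow> ('x \<Rightarrow> complex) \<Rightarrow> complex"
  assumes lin: "\<And>s t z w. s \<in> V \<Longrightarrow> t \<in> V \<Longrightarrow> (\<lambda>x. z * s x + w * t x) \<in> V"
    and ip_lin: "\<And>s t u z w. s \<in> V \<Longrightarrow> t \<in> V \<Longrightarrow> u \<in> V \<Longrightarrow>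
      ip (\<lambda>x. z * s x + w * t x) u = z * ip s u + w * ip t u"
    and ip_cnj: "\<And>s t. s \<in> V \<Longrightarrow> t \<in> V \<Longrightarrow> ip t s = cnj (ip s t)"
    and ip_nonneg: "\<And>s. s \<in> V \<Longrightarrow> 0 \<le> Re (ip s s)"
begin

abbreviation N :: "('x \<Rightarrow> complex) \<Rightarrow> real" where "N \<equiv> ip_norm ip"

abbreviation cls :: "(nat \<Rightarrow> 'x \<Rightarrow> complex) \<Rightarrow> 'x compl" where "cls f \<equiv> null_rel V ip `` {f}"

lemma diffV: "s \<in> V \<Longrightarrow> t \<in> V \<Longrightarrow> (\<lambda>x. s x - t x) \<in> V"
  using lin[of s t 1 "-1"] by simp

lemma ip_lin_right:
  assumes "s \<in> V" "t \<in> V" "u \<in> V"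
  shows "ip u (\<lambda>x. z * s x + w * t x) = cnj z * ip u s + cnj w * ip u t"
proof -
  have "ip u (\<lambda>x. z * s x + w * t x) = cnj (z * ip s u + w * ip t u)"
    using ip_cnj[OF lin[OF assms(1,2)] assms(3)] ip_lin[OF assms] by simp
  then show ?thesis
    using ip_cnj[OF assms(3,1)] ip_cnj[OF assms(3,2)] by simp
qed

lemma N_nonneg: "0 \<le> N s"
  if "s \<in> V"
  using ip_nonneg[OF that] by (simp add: ip_norm_def)

lemma ip_self: "s \<in> V \<Longrightarrow> ip s s = complex_of_real ((N s)\<^sup>2)"
proof -
  assume s: "s \<in> V"
  have "Im (ip s s) = - Im (ip s s)"
    by (subst ip_cnj[OF s s]) simp
  then show ?thesis using ip_nonneg[OF s] by (simp add: ip_norm_def complex_eq_iff)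
qed

lemma N_sq: "s \<in> V \<Longrightarrow> (N s)\<^sup>2 = Re (ip s s)"
  using ip_nonneg[of s] by (simp add: ip_norm_def)

lemma N_lin_sq:
  assumes "s \<in> V" "t \<in> V"
  shows "complex_of_real ((N (\<lambda>x. z * s x + w * t x))\<^sup>2) =
    z * cnj z * ip s s + z * cnj w * ip s t + w * cnj z * cnj (ip s t) + w * cnj w * ip t t"
  using ip_self[OF lin[OF assms, of z w]] assms
  by (simp add: ip_lin ip_lin_right lin ip_cnj[of s t] algebra_simps)

text \<open>
  The inner product is determined by the norm. Consequently convergence of inner products along Cauchy
  sequences, and their invariance under isometries, need only be checked for norms.
\<close>

lemma polarization:
  assumes "s \<in> V" "t \<in> V"
  shows "4 * ip s t = complex_of_real ((N (\<lambda>x. 1 * s x + 1 * t x))\<^sup>2)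
    - complex_of_real ((N (\<lambda>x. 1 * s x + (-1) * t x))\<^sup>2)
    + \<i> * complex_of_real ((N (\<lambda>x. 1 * s x + \<i> * t x))\<^sup>2)
    - \<i> * complex_of_real ((N (\<lambda>x. 1 * s x + (-\<i>) * t x))\<^sup>2)"
  unfolding N_lin_sq[OF assms] by (simp add: algebra_simps)

text \<open>
  The quadratic polynomial \<open>r \<mapsto> \<parallel>s + r t\<parallel>\<^sup>2\<close> is non-negative; it degenerates to a linear one if \<open>t\<close> is a null
  vector. The real part suffices for the triangle inequality.
\<close>

lemma Re_ip_le:
  assumes "s \<in> V" "t \<in> V"
  shows "Re (ip s t) \<le> N s * N t"
proof -
  have quad: "0 \<le> (N s)\<^sup>2 + 2 * r * Re (ip s t) + r\<^sup>2 * (N t)\<^sup>2" for r :: real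
  proof -
    have "(N (\<lambda>x. 1 * s x + complex_of_real r * t x))\<^sup>2 = (N s)\<^sup>2 + 2 * r * Re (ip s t) + r\<^sup>2 * (N t)\<^sup>2"
      unfolding N_sq[OF assms(1)] N_sq[OF assms(2)]
      using arg_cong[OF N_lin_sq[OF assms, of 1 "complex_of_real r"], of Re]
      by (simp add: power2_eq_square[of r])
    then show ?thesis by (metis zero_le_power2)
  qed
  have "(Re (ip s t))\<^sup>2 \<le> (N s)\<^sup>2 * (N t)\<^sup>2"
  proof (cases "N t = 0")
    case True
    have "Re (ip s t) = 0"
    proof (rule ccontr)
      assume "Re (ip s t) \<noteq> 0"
      then have "2 * (- ((N s)\<^sup>2 + 1) / (2 * Re (ip s t))) * Re (ip s t) = - ((N s)\<^sup>2 + 1)" by simp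
      then show False
        using quad[of "- ((N s)\<^sup>2 + 1) / (2 * Re (ip s t))"] True by simp
    qed
    then show ?thesis by simp
  next
    case False
    then have p: "0 < (N t)\<^sup>2" by simp
    define B where "B = Re (ip s t)"
    have "0 \<le> (N s)\<^sup>2 + 2 * (- B / (N t)\<^sup>2) * B + (- B / (N t)\<^sup>2)\<^sup>2 * (N t)\<^sup>2"
      using quad[of "- B / (N t)\<^sup>2"] by (simp add: B_def)
    also have "\<dots> = (N s)\<^sup>2 - B\<^sup>2 / (N t)\<^sup>2"
      using p by (simp add: field_simps power2_eq_square)
    finally show ?thesis using p by (simp add: B_def field_simps)
  qed
  then have "(Re (ip s t))\<^sup>2 \<le> (N s * N t)\<^sup>2" by (simp add: power_mult_distrib)
  then have "\<bar>Re (ip s t)\<bar> \<le> \<bar>N s * N t\<bar>" by (simp add: abs_le_square_iff)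
  then show ?thesis using N_nonneg assms by (simp add: abs_mult)
qed

lemma N_scale:
  assumes s: "s \<in> V"
  shows "N (\<lambda>x. z * s x) = cmod z * N s"
proof -
  have "(N (\<lambda>x. z * s x))\<^sup>2 = Re (z * cnj z * ip s s)"
    using arg_cong[OF N_lin_sq[OF s s, of z 0], of Re] by simp
  also have "\<dots> = (cmod z * N s)\<^sup>2"
    unfolding ip_self[OF s] by (simp add: complex_mult_cnj cmod_def power_mult_distrib)
  finally show ?thesis
    using N_nonneg[OF s] N_nonneg[OF lin[OF s s, of z 0]] by (simp add: power2_eq_iff_nonneg)
qed

lemma N_add: "s \<in> V \<Longrightarrow> t \<in> V \<Longrightarrow> N (\<lambda>x. s x + t x) \<le> N s + N t"
proof -
  assume st: "s \<in> V" "t \<in> V"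
  have "(N (\<lambda>x. s x + t x))\<^sup>2 = (N s)\<^sup>2 + 2 * Re (ip s t) + (N t)\<^sup>2"
    using arg_cong[OF N_lin_sq[OF st, of 1 1], of Re] by (simp add: N_sq st)
  also have "\<dots> \<le> (N s + N t)\<^sup>2"
    using Re_ip_le[OF st] by (simp add: power2_sum)
  finally show ?thesis
    by (rule power2_le_imp_le) (use N_nonneg st in simp)
qed

lemma N_lin_le: "s \<in> V \<Longrightarrow> t \<in> V \<Longrightarrow> N (\<lambda>x. z * s x + w * t x) \<le> cmod z * N s + cmod w * N t"
proof -
  assume st: "s \<in> V" "t \<in> V"
  have "(\<lambda>x. z * s x) \<in> V" "(\<lambda>x. w * t x) \<in> V" using lin[of s s z 0] lin[of t t w 0] st by simp_all
  from N_add[OF this] show ?thesis by (simp add: N_scale st)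
qed

lemma N_sub_commute: "s \<in> V \<Longrightarrow> t \<in> V \<Longrightarrow> N (\<lambda>x. s x - t x) = N (\<lambda>x. t x - s x)"
  using N_scale[OF diffV, of s t "-1"] by simp

lemma N_triangle:
  assumes "s \<in> V" "t \<in> V" "u \<in> V"
  shows "N (\<lambda>x. s x - u x) \<le> N (\<lambda>x. s x - t x) + N (\<lambda>x. t x - u x)"
  using N_add[OF diffV[OF assms(1,2)] diffV[OF assms(2,3)]] by simp

lemma N_diff_le:
  assumes "s \<in> V" "t \<in> V"
  shows "\<bar>N s - N t\<bar> \<le> N (\<lambda>x. s x - t x)"
  using N_add[OF diffV[OF assms] assms(2)] N_add[OF diffV[OF assms(2,1)] assms(1)]
    N_sub_commute[OF assms] by simp

lemma N_zero: "s \<in> V \<Longrightarrow> N (\<lambda>x. s x - s x) = 0"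
  using N_scale[of s 0] by simp

lemma cauchyI:
  assumes "\<And>k. f k \<in> V" "\<And>\<epsilon>. 0 < \<epsilon> \<Longrightarrow> \<exists>M. \<forall>j\<ge>M. \<forall>k\<ge>M. N (\<lambda>x. f j x - f k x) < \<epsilon>"
  shows "f \<in> cauchy_seqs V ip"
  using assms by (auto simp: cauchy_seqs_def)

lemma cauchyD:
  assumes "f \<in> cauchy_seqs V ip"
  shows "f k \<in> V" "0 < \<epsilon> \<Longrightarrow> \<exists>M. \<forall>j\<ge>M. \<forall>k\<ge>M. N (\<lambda>x. f j x - f k x) < \<epsilon>"
  using assms by (auto simp: cauchy_seqs_def)

lemma cauchy_const: "s \<in> V \<Longrightarrow> (\<lambda>_. s) \<in> cauchy_seqs V ip"
  using N_zero[of s] by (intro cauchyI) auto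

lemma cauchy_lin:
  assumes f: "f \<in> cauchy_seqs V ip" and g: "g \<in> cauchy_seqs V ip"
  shows "(\<lambda>k x. z * f k x + w * g k x) \<in> cauchy_seqs V ip"
proof (rule cauchyI)
  note fV = cauchyD(1)[OF f] and gV = cauchyD(1)[OF g]
  show "(\<lambda>x. z * f k x + w * g k x) \<in> V" for k using lin fV gV by blast
  fix \<epsilon> :: real assume e: "0 < \<epsilon>"
  define \<delta> where "\<delta> = \<epsilon> / (cmod z + cmod w + 1)"
  have q: "0 < cmod z + cmod w + 1" by (simp add: add_nonneg_pos)
  then have d: "0 < \<delta>" using e by (simp add: \<delta>_def)
  obtain M1 M2 where M: "\<forall>j\<ge>M1. \<forall>k\<ge>M1. N (\<lambda>x. f j x - f k x) < \<delta>" "\<forall>j\<ge>M2. \<forall>k\<ge>M2. N (\<lambda>x. g j x - g k x) < \<delta>"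
    using cauchyD(2)[OF f d] cauchyD(2)[OF g d] by blast
  have "N (\<lambda>x. (z * f j x + w * g j x) - (z * f k x + w * g k x)) < \<epsilon>"
    if "j \<ge> max M1 M2" "k \<ge> max M1 M2" for j k
  proof -
    have "N (\<lambda>x. z * (f j x - f k x) + w * (g j x - g k x)) \<le>
        cmod z * N (\<lambda>x. f j x - f k x) + cmod w * N (\<lambda>x. g j x - g k x)"
      by (rule N_lin_le) (rule diffV fV gV)+
    also have "\<dots> \<le> cmod z * \<delta> + cmod w * \<delta>"
      using M that by (intro add_mono mult_left_mono) (auto intro!: less_imp_le)
    also have "\<dots> < (cmod z + cmod w + 1) * \<delta>" using d by (simp add: algebra_simps)
    also have "\<dots> = \<epsilon>" using q by (simp add: \<delta>_def)
    finally show ?thesis by (simp add: algebra_simps)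
  qed
  then show "\<exists>M. \<forall>j\<ge>M. \<forall>k\<ge>M. N (\<lambda>x. (z * f j x + w * g j x) - (z * f k x + w * g k x)) < \<epsilon>" by blast
qed

lemma null_relI:
  "f \<in> cauchy_seqs V ip \<Longrightarrow> g \<in> cauchy_seqs V ip \<Longrightarrow> (\<lambda>k. N (\<lambda>x. f k x - g k x)) \<longlonglongrightarrow> 0 \<Longrightarrow>
    (f, g) \<in> null_rel V ip"
  by (simp add: null_rel_def)

lemma null_relD:
  assumes "(f, g) \<in> null_rel V ip"
  shows "f \<in> cauchy_seqs V ip" "g \<in> cauchy_seqs V ip" "(\<lambda>k. N (\<lambda>x. f k x - g k x)) \<longlonglongrightarrow> 0"
  using assms by (simp_all add: null_rel_def)

lemma equiv_null_rel: "equiv (cauchy_seqs V ip) (null_rel V ip)"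
proof (rule equivI)
  show "null_rel V ip \<subseteq> cauchy_seqs V ip \<times> cauchy_seqs V ip" by (auto simp: null_rel_def)
  show "refl_on (cauchy_seqs V ip) (null_rel V ip)"
  proof (rule refl_onI)
    fix f assume f: "f \<in> cauchy_seqs V ip"
    have "(\<lambda>k. N (\<lambda>x. f k x - f k x)) = (\<lambda>_. 0)"
      by (rule ext) (rule N_zero[OF cauchyD(1)[OF f]])
    then show "(f, f) \<in> null_rel V ip" by (intro null_relI f) simp
  qed
  show "sym (null_rel V ip)"
  proof (rule symI)
    fix f g assume fg: "(f, g) \<in> null_rel V ip"
    note D = null_relD[OF fg]
    have "(\<lambda>k. N (\<lambda>x. g k x - f k x)) = (\<lambda>k. N (\<lambda>x. f k x - g k x))"
      by (rule ext) (rule N_sub_commute[OF cauchyD(1)[OF D(2)] cauchyD(1)[OF D(1)]])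
    then show "(g, f) \<in> null_rel V ip" using D by (intro null_relI) simp_all
  qed
  show "trans (null_rel V ip)"
  proof (rule transI)
    fix f g h assume fg: "(f, g) \<in> null_rel V ip" and gh: "(g, h) \<in> null_rel V ip"
    note D = null_relD[OF fg] and E = null_relD[OF gh]
    note W = cauchyD(1)[OF D(1)] cauchyD(1)[OF E(1)] cauchyD(1)[OF E(2)]
    have "(\<lambda>k. N (\<lambda>x. f k x - h k x)) \<longlonglongrightarrow> 0"
    proof (rule Lim_null_comparison)
      show "\<forall>\<^sub>F k in sequentially. norm (N (\<lambda>x. f k x - h k x)) \<le> N (\<lambda>x. f k x - g k x) + N (\<lambda>x. g k x - h k x)"
        using N_triangle[OF W] N_nonneg[OF diffV[OF W(1,3)]] by simp
      show "(\<lambda>k. N (\<lambda>x. f k x - g k x) + N (\<lambda>x. g k x - h k x)) \<longlonglongrightarrow> 0"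
        using tendsto_add[OF D(3) E(3)] by simp
    qed
    then show "(f, h) \<in> null_rel V ip" by (intro null_relI D E)
  qed
qed

lemma cls_self: "f \<in> cauchy_seqs V ip \<Longrightarrow> f \<in> cls f"
  by (rule equiv_class_self[OF equiv_null_rel])

lemma cls_in: "f \<in> cauchy_seqs V ip \<Longrightarrow> cls f \<in> completion V ip"
  unfolding completion_def by (rule quotientI)

lemma completionE:
  assumes "A \<in> completion V ip"
  obtains f where "f \<in> cauchy_seqs V ip" "A = cls f"
  using assms unfolding completion_def by (rule quotientE) blast

lemma null_rel_lin:
  assumes "(f, f') \<in> null_rel V ip" "(g, g') \<in> null_rel V ip"
  shows "((\<lambda>k x. z * f k x + w * g k x), (\<lambda>k x. z * f' k x + w * g' k x)) \<in> null_rel V ip"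
proof (rule null_relI)
  note D = null_relD[OF assms(1)] and E = null_relD[OF assms(2)]
  note W = cauchyD(1)[OF D(1)] cauchyD(1)[OF D(2)] cauchyD(1)[OF E(1)] cauchyD(1)[OF E(2)]
  show "(\<lambda>k x. z * f k x + w * g k x) \<in> cauchy_seqs V ip" "(\<lambda>k x. z * f' k x + w * g' k x) \<in> cauchy_seqs V ip"
    by (rule cauchy_lin D E)+
  show "(\<lambda>k. N (\<lambda>x. (z * f k x + w * g k x) - (z * f' k x + w * g' k x))) \<longlonglongrightarrow> 0"
  proof (rule Lim_null_comparison)
    have "N (\<lambda>x. (z * f k x + w * g k x) - (z * f' k x + w * g' k x)) \<le>
        cmod z * N (\<lambda>x. f k x - f' k x) + cmod w * N (\<lambda>x. g k x - g' k x)" for k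
      using N_lin_le[OF diffV[OF W(1,2)] diffV[OF W(3,4)], of z k k w k k] by (simp add: algebra_simps)
    moreover have "0 \<le> N (\<lambda>x. (z * f k x + w * g k x) - (z * f' k x + w * g' k x))" for k
      by (intro N_nonneg diffV lin W)
    ultimately show "\<forall>\<^sub>F k in sequentially. norm (N (\<lambda>x. (z * f k x + w * g k x) - (z * f' k x + w * g' k x))) \<le>
        cmod z * N (\<lambda>x. f k x - f' k x) + cmod w * N (\<lambda>x. g k x - g' k x)"
      by simp
    show "(\<lambda>k. cmod z * N (\<lambda>x. f k x - f' k x) + cmod w * N (\<lambda>x. g k x - g' k x)) \<longlonglongrightarrow> 0"
      using tendsto_add[OF tendsto_mult_left[OF D(3), of "cmod z"] tendsto_mult_left[OF E(3), of "cmod w"]] by simp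
  qed
qed

lemma compl_lin_cls:
  assumes "f \<in> cauchy_seqs V ip" "g \<in> cauchy_seqs V ip"
  shows "compl_lin V ip z (cls f) w (cls g) = cls (\<lambda>k x. z * f k x + w * g k x)" (is "_ = ?C")
proof -
  have eq: "cls (\<lambda>k x. z * f' k x + w * g' k x) = cls (\<lambda>k x. z * f k x + w * g k x)"
    if "f' \<in> cls f" "g' \<in> cls g" for f' g'
    using equiv_class_eq[OF equiv_null_rel null_rel_lin[of f f' g g' z w]] that by simp
  have "compl_lin V ip z (cls f) w (cls g) = (\<Union>f'\<in>cls f. \<Union>g'\<in>cls g. ?C)"
    unfolding compl_lin_def by (intro SUP_cong refl eq)
  then show ?thesis
    using cls_self[OF assms(1)] cls_self[OF assms(2)] by (simp only: UN_constant) auto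
qed

lemma convergent_N:
  assumes "f \<in> cauchy_seqs V ip"
  shows "convergent (\<lambda>k. N (f k))"
proof (rule Cauchy_convergent, rule CauchyI)
  fix e :: real assume "0 < e"
  then obtain M where "\<forall>j\<ge>M. \<forall>k\<ge>M. N (\<lambda>x. f j x - f k x) < e" using cauchyD(2)[OF assms] by blast
  then show "\<exists>M. \<forall>m\<ge>M. \<forall>n\<ge>M. norm (N (f m) - N (f n)) < e"
    using le_less_trans[OF N_diff_le[OF cauchyD(1)[OF assms] cauchyD(1)[OF assms]]]
    by (intro exI[of _ M]) simp
qed

lemma N_limit_cong:
  assumes "(f, f') \<in> null_rel V ip" "(\<lambda>k. N (f k)) \<longlonglongrightarrow> l"
  shows "(\<lambda>k. N (f' k)) \<longlonglongrightarrow> l"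
proof -
  note D = null_relD[OF assms(1)]
  have "(\<lambda>k. N (f k) - N (f' k)) \<longlonglongrightarrow> 0"
    by (rule Lim_null_comparison[OF _ D(3)]) (simp add: N_diff_le cauchyD(1)[OF D(1)] cauchyD(1)[OF D(2)])
  from tendsto_diff[OF assms(2) this] show ?thesis by simp
qed

lemma inner_limit:
  assumes "f \<in> cauchy_seqs V ip" "g \<in> cauchy_seqs V ip"
  shows "\<exists>l. \<forall>f' g'. (f, f') \<in> null_rel V ip \<longrightarrow> (g, g') \<in> null_rel V ip \<longrightarrow> (\<lambda>k. ip (f' k) (g' k)) \<longlonglongrightarrow> l"
proof -
  have ex: "\<exists>n. \<forall>f' g'. (f, f') \<in> null_rel V ip \<longrightarrow> (g, g') \<in> null_rel V ip \<longrightarrow>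
      (\<lambda>k. N (\<lambda>x. 1 * f' k x + w * g' k x)) \<longlonglongrightarrow> n" for w
  proof -
    obtain n where "(\<lambda>k. N (\<lambda>x. 1 * f k x + w * g k x)) \<longlonglongrightarrow> n"
      using convergent_N[OF cauchy_lin[OF assms, of 1 w]] unfolding convergent_def ..
    then have "(\<lambda>k. N (\<lambda>x. 1 * f' k x + w * g' k x)) \<longlonglongrightarrow> n"
      if "(f, f') \<in> null_rel V ip" "(g, g') \<in> null_rel V ip" for f' g'
      by (rule N_limit_cong[OF null_rel_lin[OF that]])
    then show ?thesis by (intro exI[of _ n] allI impI)
  qed
  obtain n where "\<forall>w f' g'. (f, f') \<in> null_rel V ip \<longrightarrow> (g, g') \<in> null_rel V ip \<longrightarrow>
      (\<lambda>k. N (\<lambda>x. 1 * f' k x + w * g' k x)) \<longlonglongrightarrow> n w" using choice[OF allI[OF ex]] ..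
  note n = this[rule_format]
  define l where "l = (complex_of_real ((n 1)\<^sup>2) - complex_of_real ((n (-1))\<^sup>2)
      + \<i> * complex_of_real ((n \<i>)\<^sup>2) - \<i> * complex_of_real ((n (-\<i>))\<^sup>2)) / 4"
  have "(\<lambda>k. ip (f' k) (g' k)) \<longlonglongrightarrow> l" if "(f, f') \<in> null_rel V ip" "(g, g') \<in> null_rel V ip" for f' g'
  proof -
    note fV = cauchyD(1)[OF null_relD(2)[OF that(1)]] and gV = cauchyD(1)[OF null_relD(2)[OF that(2)]]
    have "(\<lambda>k. ip (f' k) (g' k)) =
      (\<lambda>k. (complex_of_real ((N (\<lambda>x. 1 * f' k x + 1 * g' k x))\<^sup>2) - complex_of_real ((N (\<lambda>x. 1 * f' k x + (-1) * g' k x))\<^sup>2)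
      + \<i> * complex_of_real ((N (\<lambda>x. 1 * f' k x + \<i> * g' k x))\<^sup>2) - \<i> * complex_of_real ((N (\<lambda>x. 1 * f' k x + (-\<i>) * g' k x))\<^sup>2)) / 4)"
    proof
      fix k show "ip (f' k) (g' k) = (complex_of_real ((N (\<lambda>x. 1 * f' k x + 1 * g' k x))\<^sup>2) - complex_of_real ((N (\<lambda>x. 1 * f' k x + (-1) * g' k x))\<^sup>2)
      + \<i> * complex_of_real ((N (\<lambda>x. 1 * f' k x + \<i> * g' k x))\<^sup>2) - \<i> * complex_of_real ((N (\<lambda>x. 1 * f' k x + (-\<i>) * g' k x))\<^sup>2)) / 4"
        unfolding polarization[OF fV gV, symmetric] by simp
    qed
    also have "\<dots> \<longlonglongrightarrow> l"
    proof -
      have q: "(\<lambda>k. complex_of_real ((N (\<lambda>x. 1 * f' k x + w * g' k x))\<^sup>2)) \<longlonglongrightarrow> complex_of_real ((n w)\<^sup>2)" for w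
        by (rule tendsto_of_real[OF tendsto_power[OF n[OF that]]])
      show ?thesis
        unfolding l_def
        by (rule tendsto_divide[OF tendsto_diff[OF tendsto_add[OF tendsto_diff[OF q q] tendsto_mult_left[OF q]]
            tendsto_mult_left[OF q]] tendsto_const]) simp
    qed
    finally show ?thesis .
  qed
  then show ?thesis by (intro exI[of _ l] allI impI)
qed

lemma compl_inner_cls:
  assumes "f \<in> cauchy_seqs V ip" "g \<in> cauchy_seqs V ip"
  shows "(\<lambda>k. ip (f k) (g k)) \<longlonglongrightarrow> compl_inner ip (cls f) (cls g)"
proof -
  obtain l where "\<forall>f' g'. (f, f') \<in> null_rel V ip \<longrightarrow> (g, g') \<in> null_rel V ip \<longrightarrow> (\<lambda>k. ip (f' k) (g' k)) \<longlonglongrightarrow> l"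
    using inner_limit[OF assms] ..
  note l = this[rule_format]
  have ff: "(f, f) \<in> null_rel V ip" "(g, g) \<in> null_rel V ip"
    using cls_self[OF assms(1)] cls_self[OF assms(2)] by simp_all
  have "compl_inner ip (cls f) (cls g) = l"
    unfolding compl_inner_def
  proof (rule the_equality)
    show "\<forall>f'\<in>cls f. \<forall>g'\<in>cls g. (\<lambda>k. ip (f' k) (g' k)) \<longlonglongrightarrow> l" using l by simp
    fix l' assume "\<forall>f'\<in>cls f. \<forall>g'\<in>cls g. (\<lambda>k. ip (f' k) (g' k)) \<longlonglongrightarrow> l'"
    then have "(\<lambda>k. ip (f k) (g k)) \<longlonglongrightarrow> l'" using ff by simp
    then show "l' = l" using l[OF ff] by (rule LIMSEQ_unique)
  qed
  then show ?thesis using l[OF ff] by simp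
qed

lemma compl_dist_cls:
  assumes "f \<in> cauchy_seqs V ip" "g \<in> cauchy_seqs V ip"
  shows "(\<lambda>k. N (\<lambda>x. f k x - g k x)) \<longlonglongrightarrow> compl_dist V ip (cls f) (cls g)"
proof -
  let ?d = "\<lambda>k x. 1 * f k x + (-1) * g k x"
  have d: "?d \<in> cauchy_seqs V ip" by (rule cauchy_lin[OF assms])
  have "(\<lambda>k. sqrt (Re (ip (?d k) (?d k)))) \<longlonglongrightarrow> sqrt (Re (compl_inner ip (cls ?d) (cls ?d)))"
    by (intro tendsto_real_sqrt tendsto_Re compl_inner_cls d)
  then show ?thesis
    by (simp add: compl_dist_def compl_lin_cls[OF assms] Let_def ip_norm_def)
qed

end

text \<open>
  For an isometry \<open>L\<close> of \<open>V\<close> this is its extension by continuity to the completion.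
\<close>

definition compl_map ::
  "('x \<Rightarrow> complex) set \<Rightarrow> (('x \<Rightarrow> complex) \<Rightarrow> ('x \<Rightarrow> complex) \<Rightarrow> complex) \<Rightarrow>
   (('x \<Rightarrow> complex) \<Rightarrow> 'x \<Rightarrow> complex) \<Rightarrow> 'x compl \<Rightarrow> 'x compl" where
  "compl_map V ip L A = (\<Union>f\<in>A. null_rel V ip `` {\<lambda>k. L (f k)})"

locale semi_inner_isometry = semi_inner_space V ip
  for V :: "('x \<Rightarrow> complex) set" and ip +
  fixes L :: "('x \<Rightarrow> complex) \<Rightarrow> 'x \<Rightarrow> complex"
  assumes LV: "\<And>s. s \<in> V \<Longrightarrow> L s \<in> V"
    and L_lin: "\<And>s t z w. s \<in> V \<Longrightarrow> t \<in> V \<Longrightarrow> L (\<lambda>x. z * s x + w * t x) = (\<lambda>x. z * L s x + w * L t x)"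
    and L_norm: "\<And>s. s \<in> V \<Longrightarrow> ip_norm ip (L s) = ip_norm ip s"
begin

lemma L_diff: "s \<in> V \<Longrightarrow> t \<in> V \<Longrightarrow> L (\<lambda>x. s x - t x) = (\<lambda>x. L s x - L t x)"
  using L_lin[of s t 1 "-1"] by simp

lemma L_norm_diff: "s \<in> V \<Longrightarrow> t \<in> V \<Longrightarrow> N (\<lambda>x. L s x - L t x) = N (\<lambda>x. s x - t x)"
  using L_norm[OF diffV, of s t] L_diff[of s t] by simp

lemma L_inner: "s \<in> V \<Longrightarrow> t \<in> V \<Longrightarrow> ip (L s) (L t) = ip s t"
proof -
  assume st: "s \<in> V" "t \<in> V"
  have eq: "N (\<lambda>x. z * L s x + w * L t x) = N (\<lambda>x. z * s x + w * t x)" for z w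
    using L_norm[OF lin[OF st, of z w]] L_lin[OF st, of z w] by simp
  have "4 * ip (L s) (L t) = 4 * ip s t"
    unfolding polarization[OF LV[OF st(1)] LV[OF st(2)]] polarization[OF st] eq ..
  then show ?thesis by simp
qed

lemma cauchy_L: "f \<in> cauchy_seqs V ip \<Longrightarrow> (\<lambda>k. L (f k)) \<in> cauchy_seqs V ip"
  by (rule cauchyI) (simp_all add: LV L_norm_diff cauchyD)

lemma null_rel_L: "(f, g) \<in> null_rel V ip \<Longrightarrow> ((\<lambda>k. L (f k)), (\<lambda>k. L (g k))) \<in> null_rel V ip"
  by (simp add: null_rel_def cauchy_L L_norm_diff cauchyD)

lemma compl_map_cls:
  assumes "f \<in> cauchy_seqs V ip"
  shows "compl_map V ip L (cls f) = cls (\<lambda>k. L (f k))"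
proof -
  have eq: "cls (\<lambda>k. L (g k)) = cls (\<lambda>k. L (f k))" if "g \<in> cls f" for g
    using equiv_class_eq[OF equiv_null_rel null_rel_L[of f g]] that by simp
  have "compl_map V ip L (cls f) = (\<Union>g\<in>cls f. cls (\<lambda>k. L (f k)))"
    unfolding compl_map_def by (intro SUP_cong refl eq)
  then show ?thesis
    using cls_self[OF assms] by (simp only: UN_constant) auto
qed

end

text \<open>
  Isometries map Cauchy sequences to Cauchy sequences and null sequences to null sequences, so all
  algebraic identities pass to the completion term by term. Strong continuity passes by the usual
  \<open>\<epsilon>/4\<close> argument: a Cauchy sequence is replaced by one of its members, at a cost that the isometries do not
  increase.
\<close>

lemma unitary_rep_completion:
  fixes V :: "('x \<Rightarrow> complex) set"
  assumes iso: "\<And>g. g \<in> G1 n \<Longrightarrow> semi_inner_isometry V ip (R g)"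
    and space: "semi_inner_space V ip"
    and one: "\<And>s. s \<in> V \<Longrightarrow> R (1\<^sub>m n) s = s"
    and one_G1: "1\<^sub>m n \<in> G1 n"
    and mult_G1: "\<And>g h. g \<in> G1 n \<Longrightarrow> h \<in> G1 n \<Longrightarrow> g * h \<in> G1 n"
    and mult: "\<And>g h s. g \<in> G1 n \<Longrightarrow> h \<in> G1 n \<Longrightarrow> s \<in> V \<Longrightarrow> R (g * h) s = R g (R h s)"
    and inv: "\<And>g. g \<in> G1 n \<Longrightarrow> \<exists>h\<in>G1 n. \<forall>s\<in>V. R g (R h s) = s \<and> R h (R g s) = s"
    and strong: "\<And>g \<gamma> s. g \<in> G1 n \<Longrightarrow> (\<And>k. \<gamma> k \<in> G1 n) \<Longrightarrow>
      (\<And>i j. i < n \<Longrightarrow> j < n \<Longrightarrow> (\<lambda>k. \<gamma> k $$ (i, j)) \<longlonglongrightarrow> g $$ (i, j)) \<Longrightarrow> s \<in> V \<Longrightarrow>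
      (\<lambda>k. ip_norm ip (\<lambda>x. R (\<gamma> k) s x - R g s x)) \<longlonglongrightarrow> 0"
  shows "unitary_rep n V ip (\<lambda>g. compl_map V ip (R g))"
    and "\<And>g s. g \<in> G1 n \<Longrightarrow> s \<in> V \<Longrightarrow>
      compl_map V ip (R g) (compl_emb V ip s) = compl_emb V ip (R g s)"
proof -
  interpret semi_inner_space V ip by (rule space)
  let ?U = "\<lambda>g. compl_map V ip (R g)"
  note V = cauchyD(1)
  note U = semi_inner_isometry.compl_map_cls[OF iso]
  note RC = semi_inner_isometry.cauchy_L[OF iso]
  note RV = semi_inner_isometry.LV[OF iso]
  show emb: "\<And>g s. g \<in> G1 n \<Longrightarrow> s \<in> V \<Longrightarrow> ?U g (compl_emb V ip s) = compl_emb V ip (R g s)"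
    unfolding compl_emb_def by (rule U[OF _ cauchy_const])
  have Uin: "?U g A \<in> completion V ip" if "g \<in> G1 n" "A \<in> completion V ip" for g A
    using that(2) by (rule completionE) (simp add: U[OF that(1)] cls_in RC[OF that(1)])
  have bij: "bij_betw (?U g) (completion V ip) (completion V ip)" if g: "g \<in> G1 n" for g
  proof -
    obtain h where h: "h \<in> G1 n" "\<And>s. s \<in> V \<Longrightarrow> R g (R h s) = s" "\<And>s. s \<in> V \<Longrightarrow> R h (R g s) = s"
      using inv[OF g] by blast
    have 1: "?U h (?U g A) = A" "?U g (?U h A) = A" if A: "A \<in> completion V ip" for A
    proof -
      obtain f where f: "f \<in> cauchy_seqs V ip" "A = cls f" using A by (rule completionE)
      show "?U h (?U g A) = A" "?U g (?U h A) = A"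
        unfolding f(2) U[OF g f(1)] U[OF h(1) f(1)] U[OF h(1) RC[OF g f(1)]] U[OF g RC[OF h(1) f(1)]]
          h(2)[OF V[OF f(1)]] h(3)[OF V[OF f(1)]] by (rule refl)+
    qed
    show ?thesis
      by (rule bij_betw_byWitness[where f' = "?U h"]) (use 1 Uin[OF g] Uin[OF h(1)] in auto)
  qed
  have linear: "?U g (compl_lin V ip z A w B) = compl_lin V ip z (?U g A) w (?U g B)"
    if g: "g \<in> G1 n" and A: "A \<in> completion V ip" and B: "B \<in> completion V ip" for g A B z w
  proof -
    obtain f where f: "f \<in> cauchy_seqs V ip" "A = cls f" using A by (rule completionE)
    obtain h where h: "h \<in> cauchy_seqs V ip" "B = cls h" using B by (rule completionE)
    show ?thesis
      by (simp add: f(2) h(2) compl_lin_cls f(1) h(1) U[OF g] cauchy_lin RC[OF g]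
          semi_inner_isometry.L_lin[OF iso[OF g]] V)
  qed
  have inner: "compl_inner ip (?U g A) (?U g B) = compl_inner ip A B"
    if g: "g \<in> G1 n" and A: "A \<in> completion V ip" and B: "B \<in> completion V ip" for g A B
  proof -
    obtain f where f: "f \<in> cauchy_seqs V ip" "A = cls f" using A by (rule completionE)
    obtain h where h: "h \<in> cauchy_seqs V ip" "B = cls h" using B by (rule completionE)
    have "(\<lambda>k. ip (f k) (h k)) \<longlonglongrightarrow> compl_inner ip (cls (\<lambda>k. R g (f k))) (cls (\<lambda>k. R g (h k)))"
      using compl_inner_cls[OF RC[OF g f(1)] RC[OF g h(1)]]
      by (simp add: semi_inner_isometry.L_inner[OF iso[OF g]] V f(1) h(1))
    from LIMSEQ_unique[OF this compl_inner_cls[OF f(1) h(1)]] show ?thesis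
      by (simp add: f h U[OF g])
  qed
  have unit: "?U (1\<^sub>m n) A = A" if "A \<in> completion V ip" for A
    using that by (rule completionE) (simp add: U[OF one_G1] one V)
  have comp: "?U (g * h) A = ?U g (?U h A)"
    if g: "g \<in> G1 n" and h: "h \<in> G1 n" and A: "A \<in> completion V ip" for g h A
    using A by (rule completionE) (simp add: U[OF g] U[OF h] U[OF mult_G1[OF g h]] RC[OF h] mult[OF g h] V)
  have cont: "(\<lambda>k. compl_dist V ip (?U (\<gamma> k) A) (?U g A)) \<longlonglongrightarrow> 0"
    if g: "g \<in> G1 n" and \<gamma>: "\<And>k. \<gamma> k \<in> G1 n"
      and lim: "\<And>i j. i < n \<Longrightarrow> j < n \<Longrightarrow> (\<lambda>k. \<gamma> k $$ (i, j)) \<longlonglongrightarrow> g $$ (i, j)"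
      and A: "A \<in> completion V ip" for g \<gamma> A
  proof -
    obtain f where f: "f \<in> cauchy_seqs V ip" "A = cls f" using A by (rule completionE)
    have dist: "(\<lambda>j. N (\<lambda>x. R (\<gamma> k) (f j) x - R g (f j) x)) \<longlonglongrightarrow> compl_dist V ip (?U (\<gamma> k) A) (?U g A)" for k
      using compl_dist_cls[OF RC[OF \<gamma>[of k] f(1)] RC[OF g f(1)]] by (simp add: f(2) U[OF g f(1)] U[OF \<gamma> f(1)])
    have nonneg: "0 \<le> compl_dist V ip (?U (\<gamma> k) A) (?U g A)" for k
      by (rule LIMSEQ_le_const[OF dist]) (intro exI[of _ 0] allI impI N_nonneg diffV RV \<gamma> g V[OF f(1)])
    show ?thesis
    proof (rule LIMSEQ_I)
      fix e :: real assume e: "0 < e"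
      obtain M where M: "\<And>j k. j \<ge> M \<Longrightarrow> k \<ge> M \<Longrightarrow> N (\<lambda>x. f j x - f k x) < e / 4"
        using cauchyD(2)[OF f(1), of "e / 4"] e by auto
      obtain K where K: "\<And>k. k \<ge> K \<Longrightarrow> N (\<lambda>x. R (\<gamma> k) (f M) x - R g (f M) x) < e / 4"
        using LIMSEQ_D[OF strong[OF g \<gamma> lim V[OF f(1), of M]], of "e / 4"] e by fastforce
      have "compl_dist V ip (?U (\<gamma> k) A) (?U g A) \<le> 3 * (e / 4)" if k: "k \<ge> K" for k
      proof (rule LIMSEQ_le_const2[OF dist], intro exI[of _ M] allI impI)
        fix j assume j: "M \<le> j"
        let ?a = "R (\<gamma> k) (f j)" and ?b = "R (\<gamma> k) (f M)" and ?c = "R g (f M)" and ?d = "R g (f j)"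
        note W = RV[OF \<gamma>[of k] V[OF f(1), of j]] RV[OF \<gamma>[of k] V[OF f(1), of M]]
          RV[OF g V[OF f(1), of M]] RV[OF g V[OF f(1), of j]]
        have "N (\<lambda>x. ?a x - ?d x) \<le> N (\<lambda>x. ?a x - ?b x) + (N (\<lambda>x. ?b x - ?c x) + N (\<lambda>x. ?c x - ?d x))"
          using N_triangle[OF W(1,2,4)] N_triangle[OF W(2,3,4)] by linarith
        also have "N (\<lambda>x. ?a x - ?b x) = N (\<lambda>x. f j x - f M x)"
          by (rule semi_inner_isometry.L_norm_diff[OF iso[OF \<gamma>] V[OF f(1)] V[OF f(1)]])
        also have "N (\<lambda>x. ?c x - ?d x) = N (\<lambda>x. f M x - f j x)"
          by (rule semi_inner_isometry.L_norm_diff[OF iso[OF g] V[OF f(1)] V[OF f(1)]])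
        finally show "N (\<lambda>x. ?a x - ?d x) \<le> 3 * (e / 4)"
          using M[OF j order_refl] M[OF order_refl j] K[OF k] by linarith
      qed
      then have "compl_dist V ip (?U (\<gamma> k) A) (?U g A) < e" if "k \<ge> K" for k
        using e that by fastforce
      then show "\<exists>K. \<forall>k\<ge>K. norm (compl_dist V ip (?U (\<gamma> k) A) (?U g A) - 0) < e"
        using nonneg by (intro exI[of _ K]) simp
    qed
  qed
  show "unitary_rep n V ip ?U"
    unfolding unitary_rep_def
    by (intro conjI ballI allI impI; (elim conjE)?) (rule bij linear inner unit comp cont; blast)+
qed

section \<open>The Hilbert space\<close>

text \<open>
  Absorbing the square root of the Gaussian weight into the section turns the inner product into a
  plain \<open>L\<^sup>2\<close> inner product for the Liouville measure.
\<close>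

definition weighted :: "nat \<Rightarrow> toda_section \<Rightarrow> toda_section" where
  "weighted n s x = s x * complex_of_real (exp (- (\<Sum>i<n - 1. (snd x i)\<^sup>2) / 2))"

lemma cmod_weighted: "(cmod (weighted n s x))\<^sup>2 = (cmod (s x))\<^sup>2 * exp (- (\<Sum>i<n - 1. (snd x i)\<^sup>2))"
  by (simp add: weighted_def norm_mult power_mult_distrib flip: exp_double)

lemma weighted_lin: "weighted n (\<lambda>x. z * s x + w * t x) x = z * weighted n s x + w * weighted n t x"
  by (simp add: weighted_def algebra_simps)

lemma toda_normsq_weighted: "toda_normsq n s = (\<integral>\<^sup>+x. ennreal ((cmod (weighted n s x))\<^sup>2) \<partial>liouville_measure n)"
  by (simp add: toda_normsq_def cmod_weighted)

lemma toda_inner_weighted: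
  "toda_inner n s t = (\<integral>x. weighted n s x * cnj (weighted n t x) \<partial>liouville_measure n)"
proof -
  have "weighted n s x * cnj (weighted n t x) =
      s x * cnj (t x) * complex_of_real (exp (- (\<Sum>i<n - 1. (snd x i)\<^sup>2)))" for x
  proof -
    have "exp (- (\<Sum>i<n - 1. (snd x i)\<^sup>2) / 2) * exp (- (\<Sum>i<n - 1. (snd x i)\<^sup>2) / 2) =
        exp (- (\<Sum>i<n - 1. (snd x i)\<^sup>2))"
      by (simp flip: exp_add)
    then show ?thesis
      by (simp add: weighted_def mult_ac flip: of_real_mult)
  qed
  then show ?thesis by (simp add: toda_inner_def)
qed

lemma measurable_smooth_polarized:
  assumes "s \<in> smooth_polarized n"
  shows "s \<in> borel_measurable (lebesgue_coords n \<Otimes>\<^sub>M lebesgue_coords n)"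
  using assms by (intro continuous_section_measurable toda_smooth_cont polarized_sections)
    (simp_all add: smooth_polarized_def)

lemma measurable_weighted:
  assumes "s \<in> smooth_polarized n"
  shows "weighted n s \<in> borel_measurable (liouville_measure n)"
proof -
  note measurable_smooth_polarized[OF assms, measurable]
  show ?thesis unfolding weighted_def[abs_def] by measurable
qed

lemma prehilbertD:
  assumes "s \<in> toda_prehilbert n"
  shows "s \<in> smooth_polarized n" "polarized n s" "toda_smooth n s" "toda_normsq n s < \<infinity>"
    "weighted n s \<in> borel_measurable (liouville_measure n)"
  using assms measurable_weighted by (simp_all add: toda_prehilbert_def smooth_polarized_def)

lemma norm_lin_sq_le:
  fixes a b z w :: complex
  shows "(cmod (z * a + w * b))\<^sup>2 \<le> 2 * (cmod z)\<^sup>2 * (cmod a)\<^sup>2 + 2 * (cmod w)\<^sup>2 * (cmod b)\<^sup>2"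
proof -
  have "(cmod (z * a + w * b))\<^sup>2 \<le> (cmod (z * a) + cmod (w * b))\<^sup>2"
    by (intro power_mono norm_triangle_ineq) simp
  also have "\<dots> \<le> 2 * (cmod (z * a))\<^sup>2 + 2 * (cmod (w * b))\<^sup>2"
    using sum_squares_bound[of "cmod (z * a)" "cmod (w * b)"] by (simp add: power2_sum)
  finally show ?thesis by (simp add: norm_mult power_mult_distrib)
qed

lemma prehilbert_lin:
  assumes s: "s \<in> toda_prehilbert n" and t: "t \<in> toda_prehilbert n"
  shows "(\<lambda>x. z * s x + w * t x) \<in> toda_prehilbert n"
proof -
  note S = prehilbertD[OF s] and T = prehilbertD[OF t]
  note S(5) [measurable] T(5) [measurable]
  have "toda_normsq n (\<lambda>x. z * s x + w * t x) \<le>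
      (\<integral>\<^sup>+x. ennreal (2 * (cmod z)\<^sup>2) * ennreal ((cmod (weighted n s x))\<^sup>2) +
        ennreal (2 * (cmod w)\<^sup>2) * ennreal ((cmod (weighted n t x))\<^sup>2) \<partial>liouville_measure n)"
    unfolding toda_normsq_weighted weighted_lin
    by (intro nn_integral_mono) (simp add: norm_lin_sq_le ennreal_leI flip: ennreal_mult ennreal_plus)
  also have "\<dots> = ennreal (2 * (cmod z)\<^sup>2) * toda_normsq n s + ennreal (2 * (cmod w)\<^sup>2) * toda_normsq n t"
    by (simp add: nn_integral_add nn_integral_cmult toda_normsq_weighted)
  also have "\<dots> < \<infinity>" using S(4) T(4) by (simp add: ennreal_mult_less_top)
  finally show ?thesis using smooth_polarized_lin[OF S(1) T(1)] by (simp add: toda_prehilbert_def)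
qed

lemma integrable_weighted_sq:
  assumes "s \<in> toda_prehilbert n"
  shows "integrable (liouville_measure n) (\<lambda>x. (cmod (weighted n s x))\<^sup>2)"
proof (rule integrableI_bounded)
  note prehilbertD(5)[OF assms, measurable]
  show "(\<lambda>x. (cmod (weighted n s x))\<^sup>2) \<in> borel_measurable (liouville_measure n)" by measurable
  show "(\<integral>\<^sup>+x. ennreal (norm ((cmod (weighted n s x))\<^sup>2)) \<partial>liouville_measure n) < \<infinity>"
    using prehilbertD(4)[OF assms] by (simp add: toda_normsq_weighted)
qed

lemma integrable_weighted_prod:
  assumes s: "s \<in> toda_prehilbert n" and t: "t \<in> toda_prehilbert n"
  shows "integrable (liouville_measure n) (\<lambda>x. weighted n s x * cnj (weighted n t x))"
proof (rule Bochner_Integration.integrable_bound)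
  note prehilbertD(5)[OF s, measurable] prehilbertD(5)[OF t, measurable]
  have [measurable]: "cnj \<in> borel_measurable borel"
    by (intro borel_measurable_continuous_onI continuous_intros)
  show "integrable (liouville_measure n) (\<lambda>x. (cmod (weighted n s x))\<^sup>2 + (cmod (weighted n t x))\<^sup>2)"
    by (intro Bochner_Integration.integrable_add integrable_weighted_sq s t)
  show "(\<lambda>x. weighted n s x * cnj (weighted n t x)) \<in> borel_measurable (liouville_measure n)" by measurable
  have "cmod (weighted n s x * cnj (weighted n t x)) \<le> norm ((cmod (weighted n s x))\<^sup>2 + (cmod (weighted n t x))\<^sup>2)" for x
  proof -
    have "cmod (weighted n s x * cnj (weighted n t x)) = cmod (weighted n s x) * cmod (weighted n t x)"
      by (simp add: norm_mult)
    moreover have "0 \<le> cmod (weighted n s x) * cmod (weighted n t x)" by simp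
    ultimately have "cmod (weighted n s x * cnj (weighted n t x)) \<le> (cmod (weighted n s x))\<^sup>2 + (cmod (weighted n t x))\<^sup>2"
      using sum_squares_bound[of "cmod (weighted n s x)" "cmod (weighted n t x)"] by linarith
    then show ?thesis by simp
  qed
  then show "AE x in liouville_measure n. cmod (weighted n s x * cnj (weighted n t x)) \<le>
      norm ((cmod (weighted n s x))\<^sup>2 + (cmod (weighted n t x))\<^sup>2)" by simp
qed

lemma toda_inner_self:
  assumes s: "s \<in> toda_prehilbert n"
  shows "Re (toda_inner n s s) = enn2real (toda_normsq n s)"
proof -
  note prehilbertD(5)[OF s, measurable]
  have "toda_inner n s s = (\<integral>x. complex_of_real ((cmod (weighted n s x))\<^sup>2) \<partial>liouville_measure n)"
    by (simp only: toda_inner_weighted complex_norm_square)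
  also have "\<dots> = complex_of_real (\<integral>x. (cmod (weighted n s x))\<^sup>2 \<partial>liouville_measure n)"
    by (rule integral_complex_of_real)
  finally have "Re (toda_inner n s s) = (\<integral>x. (cmod (weighted n s x))\<^sup>2 \<partial>liouville_measure n)"
    by simp
  also have "\<dots> = enn2real (toda_normsq n s)"
    unfolding toda_normsq_weighted by (rule integral_eq_nn_integral) simp_all
  finally show ?thesis .
qed

lemma ip_norm_toda: "s \<in> toda_prehilbert n \<Longrightarrow> ip_norm (toda_inner n) s = sqrt (enn2real (toda_normsq n s))"
  by (simp add: ip_norm_def toda_inner_self)

lemma semi_inner_space_toda: "semi_inner_space (toda_prehilbert n) (toda_inner n)"
proof
  fix s t u z w
  assume s: "s \<in> toda_prehilbert n" and t: "t \<in> toda_prehilbert n"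
  show "(\<lambda>x. z * s x + w * t x) \<in> toda_prehilbert n" by (rule prehilbert_lin[OF s t])
  show "toda_inner n t s = cnj (toda_inner n s t)"
    unfolding toda_inner_weighted Bochner_Integration.integral_cnj[symmetric] by (simp add: mult.commute)
  assume u: "u \<in> toda_prehilbert n"
  have "toda_inner n (\<lambda>x. z * s x + w * t x) u =
      (\<integral>x. z * (weighted n s x * cnj (weighted n u x)) + w * (weighted n t x * cnj (weighted n u x)) \<partial>liouville_measure n)"
    unfolding toda_inner_weighted weighted_lin by (simp add: algebra_simps)
  also have "\<dots> = z * toda_inner n s u + w * toda_inner n t u"
    using integrable_weighted_prod[OF s u] integrable_weighted_prod[OF t u] by (simp add: toda_inner_weighted)
  finally show "toda_inner n (\<lambda>x. z * s x + w * t x) u = z * toda_inner n s u + w * toda_inner n t u" .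
next
  fix s assume "s \<in> toda_prehilbert n"
  then show "0 \<le> Re (toda_inner n s s)" by (simp add: toda_inner_self)
qed

lemma toda_normsq_smooth_polarized:
  assumes s: "s \<in> smooth_polarized n" and p: "p \<in> toda_dom_p n"
  shows "toda_normsq n s = ennreal (fact (n - 1) * sqrt pi ^ (n - 1)) *
    (\<integral>\<^sup>+a\<in>toda_dom_a n. ennreal ((cmod (s (a, p)))\<^sup>2 / (\<Prod>i<n - 1. a i)) \<partial>lebesgue_coords n)"
proof (rule toda_normsq_eq[OF measurable_smooth_polarized[OF s] _ p])
  fix a q assume "a \<in> toda_dom_a n" "q \<in> toda_dom_p n"
  then show "s (a, q) = s (a, p)" using s p by (intro polarized_indep) (simp_all add: smooth_polarized_def)
qed

text \<open>
  The phase has modulus one, and the dilation does not change the integral against \<open>da / a\<close>.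
\<close>

lemma toda_normsq_rep:
  assumes g: "g \<in> G1 n" and s: "s \<in> smooth_polarized n"
  shows "toda_normsq n (toda_rep c n g s) = toda_normsq n s"
proof -
  define p :: "nat \<Rightarrow> real" where "p = (\<lambda>i\<in>{..<n - 1}. 0)"
  have p: "p \<in> toda_dom_p n" by (auto simp: p_def toda_dom_p_def)
  have F: "(\<lambda>a. (cmod (s (a, p)))\<^sup>2) \<in> borel_measurable (lebesgue_coords n)"
  proof -
    have "(\<lambda>a. s (a, p)) \<in> borel_measurable (lebesgue_coords n)"
      using p by (intro measurable_Pair2'[THEN measurable_compose, OF _ measurable_smooth_polarized[OF s]])
        (simp add: space_lebesgue_coords)
    then show ?thesis by measurable
  qed
  have "(\<integral>\<^sup>+a\<in>toda_dom_a n. ennreal ((cmod (toda_rep c n g s (a, p)))\<^sup>2 / (\<Prod>i<n - 1. a i)) \<partial>lebesgue_coords n) =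
      (\<integral>\<^sup>+a\<in>toda_dom_a n. ennreal ((cmod (s (\<lambda>i\<in>{..<n - 1}. diag_ratio g i * a i, p)))\<^sup>2 / (\<Prod>i<n - 1. a i)) \<partial>lebesgue_coords n)"
  proof (rule nn_integral_cong)
    fix a
    have "cmod (toda_rep c n g s (a, p)) = cmod (s (\<lambda>i\<in>{..<n - 1}. diag_ratio g i * a i, p))" if a: "a \<in> toda_dom_a n"
    proof -
      have "scale_a n (diag_ratio g) (a, p) = (\<lambda>i\<in>{..<n - 1}. diag_ratio g i * a i, p)"
        using a by (auto simp: scale_a_def toda_dom_a_def PiE_iff extensional_def fun_eq_iff)
      then show ?thesis using a p by (simp add: toda_rep_def toda_dom_def norm_mult)
    qed
    then show "ennreal ((cmod (toda_rep c n g s (a, p)))\<^sup>2 / (\<Prod>i<n - 1. a i)) * indicator (toda_dom_a n) a =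
        ennreal ((cmod (s (\<lambda>i\<in>{..<n - 1}. diag_ratio g i * a i, p)))\<^sup>2 / (\<Prod>i<n - 1. a i)) * indicator (toda_dom_a n) a"
      by (cases "a \<in> toda_dom_a n") simp_all
  qed
  also have "\<dots> = (\<integral>\<^sup>+a\<in>toda_dom_a n. ennreal ((cmod (s (a, p)))\<^sup>2 / (\<Prod>i<n - 1. a i)) \<partial>lebesgue_coords n)"
    using diag_ratio_pos[OF g] by (intro scale_invariant_integral[OF _ F]) simp
  finally show ?thesis
    unfolding toda_normsq_smooth_polarized[OF smooth_polarized_rep[OF g s] p] toda_normsq_smooth_polarized[OF s p]
    by simp
qed

lemma prehilbert_rep:
  assumes "g \<in> G1 n" "s \<in> toda_prehilbert n"
  shows "toda_rep c n g s \<in> toda_prehilbert n"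
  using assms toda_normsq_rep smooth_polarized_rep by (simp add: toda_prehilbert_def)

lemma semi_inner_isometry_rep:
  assumes g: "g \<in> G1 n"
  shows "semi_inner_isometry (toda_prehilbert n) (toda_inner n) (toda_rep c n g)"
proof -
  interpret semi_inner_space "toda_prehilbert n" "toda_inner n" by (rule semi_inner_space_toda)
  show ?thesis
  proof
    fix s assume s: "s \<in> toda_prehilbert n"
    show "toda_rep c n g s \<in> toda_prehilbert n" by (rule prehilbert_rep[OF g s])
    show "ip_norm (toda_inner n) (toda_rep c n g s) = ip_norm (toda_inner n) s"
      by (simp add: ip_norm_toda prehilbert_rep g s toda_normsq_rep prehilbertD(1)[OF s])
    show "toda_rep c n g (\<lambda>x. z * s x + w * t x) = (\<lambda>x. z * toda_rep c n g s x + w * toda_rep c n g t x)" for t z w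
      by (rule toda_rep_lin)
  qed
qed

lemma toda_rep_pointwise_continuous:
  assumes n: "0 < n" and g: "g \<in> G1 n" and \<gamma>: "\<And>k. \<gamma> k \<in> G1 n"
    and lim: "\<And>i j. i < n \<Longrightarrow> j < n \<Longrightarrow> (\<lambda>k. \<gamma> k $$ (i, j)) \<longlonglongrightarrow> g $$ (i, j)"
    and s: "toda_smooth n s"
  shows "(\<lambda>k. toda_rep c n (\<gamma> k) s x) \<longlonglongrightarrow> toda_rep c n g s x"
proof (cases "x \<in> toda_dom n")
  case x: True
  have nz: "g $$ (i, i) \<noteq> 0" if "i < n" for i using G1D(3)[OF g that] by simp
  have ph: "(\<lambda>k. phase c n (\<gamma> k) x) \<longlonglongrightarrow> phase c n g x"
    unfolding phase_def
  proof (intro tendsto_add tendsto_mult tendsto_const tendsto_ln tendsto_sum tendsto_divide)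
    show "g $$ (n - 1, n - 1) \<noteq> 0" using n by (intro nz) simp
    show "g $$ (i, i) \<noteq> 0" if "i \<in> {..<n - 1}" for i using that by (intro nz) simp
  qed (use n in \<open>auto intro!: lim\<close>)
  have ratio: "(\<lambda>k. diag_ratio (\<gamma> k) i) \<longlonglongrightarrow> diag_ratio g i" if "i < n - 1" for i
    unfolding diag_ratio_def using that by (intro tendsto_divide lim nz) auto
  have "(\<lambda>k. scale_a n (diag_ratio (\<gamma> k)) x) \<longlonglongrightarrow> scale_a n (diag_ratio g) x"
  proof (rule tendsto_coords)
    fix i
    show "(\<lambda>k. fst (scale_a n (diag_ratio (\<gamma> k)) x) i) \<longlonglongrightarrow> fst (scale_a n (diag_ratio g) x) i"
      using tendsto_mult_right[OF ratio[of i], of "fst x i"] by (cases "i < n - 1") (simp_all add: scale_a_def)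
    show "(\<lambda>k. snd (scale_a n (diag_ratio (\<gamma> k)) x) i) \<longlonglongrightarrow> snd (scale_a n (diag_ratio g) x) i"
      by (simp add: scale_a_def)
  qed
  then have "(\<lambda>k. s (scale_a n (diag_ratio (\<gamma> k)) x)) \<longlonglongrightarrow> s (scale_a n (diag_ratio g) x)"
    by (rule continuous_on_tendsto_compose[OF toda_smooth_cont[OF s]])
      (simp_all add: scale_a_G1_dom g \<gamma> x)
  then show ?thesis
    using x by (simp add: toda_rep_def) (intro tendsto_mult tendsto_exp tendsto_const tendsto_of_real ph)
qed (simp add: toda_rep_def)

text \<open>
  Continuity of \<open>s\<close> gives pointwise convergence; the norms are all equal by invariance.
\<close>

lemma toda_rep_strongly_continuous:
  assumes n: "0 < n" and g: "g \<in> G1 n" and \<gamma>: "\<And>k. \<gamma> k \<in> G1 n"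
    and lim: "\<And>i j. i < n \<Longrightarrow> j < n \<Longrightarrow> (\<lambda>k. \<gamma> k $$ (i, j)) \<longlonglongrightarrow> g $$ (i, j)"
    and s: "s \<in> toda_prehilbert n"
  shows "(\<lambda>k. ip_norm (toda_inner n) (\<lambda>x. toda_rep c n (\<gamma> k) s x - toda_rep c n g s x)) \<longlonglongrightarrow> 0"
proof -
  note Rg = prehilbert_rep[OF g s, of c] and R\<gamma> = prehilbert_rep[OF \<gamma> s, of c]
  let ?u = "\<lambda>k. weighted n (toda_rep c n (\<gamma> k) s)" and ?v = "weighted n (toda_rep c n g s)"
  let ?d = "\<lambda>k x. toda_rep c n (\<gamma> k) s x - toda_rep c n g s x"
  have d: "?d k \<in> toda_prehilbert n" for k
    using prehilbert_lin[OF R\<gamma>[of k] Rg, of 1 "-1"] by simp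
  have "(\<lambda>k. \<integral>\<^sup>+x. ennreal ((cmod (?u k x - ?v x))\<^sup>2) \<partial>liouville_measure n) \<longlonglongrightarrow> 0"
  proof (rule L2_convergence_of_norms)
    show "(\<lambda>k. ?u k x) \<longlonglongrightarrow> ?v x" for x
      unfolding weighted_def
      by (intro tendsto_mult tendsto_const toda_rep_pointwise_continuous[OF n g \<gamma> lim prehilbertD(3)[OF s]])
    show "(\<integral>\<^sup>+x. ennreal ((cmod (?u k x))\<^sup>2) \<partial>liouville_measure n) = (\<integral>\<^sup>+x. ennreal ((cmod (?v x))\<^sup>2) \<partial>liouville_measure n)" for k
      unfolding toda_normsq_weighted[symmetric] toda_normsq_rep[OF \<gamma> prehilbertD(1)[OF s]] toda_normsq_rep[OF g prehilbertD(1)[OF s]] ..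
  qed (use prehilbertD(4,5)[OF Rg] prehilbertD(5)[OF R\<gamma>] in \<open>simp_all add: toda_normsq_weighted\<close>)
  moreover have "?u k x - ?v x = weighted n (?d k) x" for k x
    by (simp add: weighted_def left_diff_distrib)
  ultimately have "(\<lambda>k. toda_normsq n (?d k)) \<longlonglongrightarrow> 0"
    by (simp add: toda_normsq_weighted)
  then have "(\<lambda>k. sqrt (enn2real (toda_normsq n (?d k)))) \<longlonglongrightarrow> sqrt (enn2real 0)"
    by (intro tendsto_real_sqrt tendsto_enn2real) simp_all
  then show ?thesis by (simp add: ip_norm_toda[OF d])
qed


theorem mainTheorem2:
  fixes n :: nat and c :: real
  assumes "n \<ge> 2"
  shows "(\<forall>\<xi>\<in>g1_alg n. \<forall>s. polarized n s \<longrightarrow> polarized n (toda_rho c n \<xi> s)) \<and>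
    lie_algebra_rep n (smooth_polarized n) (toda_rho c n) \<and>
    (\<exists>R. group_rep n {s. polarized n s} R \<and>
         (\<forall>g\<in>G1 n. \<forall>s\<in>smooth_polarized n. R g s \<in> smooth_polarized n) \<and>
         (\<forall>\<xi>\<in>g1_alg n. \<forall>s\<in>smooth_polarized n. \<forall>x\<in>toda_dom n.
            ((\<lambda>t. R (mat_exp n (t \<cdot>\<^sub>m \<xi>)) s x) has_vector_derivative toda_rho c n \<xi> s x) (at 0)) \<and>
         (\<forall>g\<in>G1 n. \<forall>s\<in>toda_prehilbert n. toda_normsq n (R g s) = toda_normsq n s) \<and>
         (\<exists>U. unitary_rep n (toda_prehilbert n) (toda_inner n) U \<and>
              (\<forall>g\<in>G1 n. \<forall>s\<in>toda_prehilbert n.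
                 U g (compl_emb (toda_prehilbert n) (toda_inner n) s) =
                 compl_emb (toda_prehilbert n) (toda_inner n) (R g s)))) \<and>
    (\<exists>C>0. \<forall>s\<in>smooth_polarized n. \<forall>p\<in>toda_dom_p n.
       toda_normsq n s =
       ennreal C * (\<integral>\<^sup>+a\<in>toda_dom_a n. ennreal ((cmod (s (a, p)))\<^sup>2 / (\<Prod>i<n - 1. a i)) \<partial>lebesgue_coords n))"
proof -
  have n: "0 < n" using assms by simp
  have alg: "\<xi> \<in> carrier_mat n n" if "\<xi> \<in> g1_alg n" for \<xi> using that by (simp add: g1_alg_def)
  let ?V = "toda_prehilbert n" and ?ip = "toda_inner n" and ?R = "toda_rep c n"
  have sec: "s \<in> toda_sections n" if "s \<in> ?V" for s
    by (rule polarized_sections[OF prehilbertD(2)[OF that]])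
  have one: "?R (1\<^sub>m n) s = s" if "s \<in> ?V" for s
    by (rule toda_rep_trivial[OF n _ _ sec[OF that]]) simp_all
  have inv: "\<exists>h\<in>G1 n. \<forall>s\<in>?V. ?R g (?R h s) = s \<and> ?R h (?R g s) = s" if "g \<in> G1 n" for g
    using toda_rep_inverse[OF n that, of c] sec by blast
  have mult: "?R (g * h) s = ?R g (?R h s)" if "g \<in> G1 n" "h \<in> G1 n" "s \<in> ?V" for g h s
    by (rule toda_rep_mult[OF n that(1,2)])
  note unitary = unitary_rep_completion[where V = ?V and ip = ?ip and R = ?R and n = n,
      OF semi_inner_isometry_rep semi_inner_space_toda one one_G1 mult_G1 mult
        inv toda_rep_strongly_continuous[OF n]]
  show ?thesis
  proof (intro conjI ballI allI impI exI[of _ ?R] exI[of _ "\<lambda>g. compl_map ?V ?ip (?R g)"]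
      exI[of _ "fact (n - 1) * sqrt pi ^ (n - 1)"])
    show "polarized n (toda_rho c n \<xi> s)" if "\<xi> \<in> g1_alg n" "polarized n s" for \<xi> s
      by (rule polarized_toda_rho[OF n alg[OF that(1)] that(2)])
    show "lie_algebra_rep n (smooth_polarized n) (toda_rho c n)"
      by (rule lie_algebra_rep_toda_rho[OF n])
    show "group_rep n {s. polarized n s} ?R"
      by (rule group_rep_toda_rep[OF n])
    show "?R g s \<in> smooth_polarized n" if "g \<in> G1 n" "s \<in> smooth_polarized n" for g s
      by (rule smooth_polarized_rep[OF that])
    show "((\<lambda>t. ?R (mat_exp n (t \<cdot>\<^sub>m \<xi>)) s x) has_vector_derivative toda_rho c n \<xi> s x) (at 0)"
      if "\<xi> \<in> g1_alg n" "s \<in> smooth_polarized n" "x \<in> toda_dom n" for \<xi> s x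
      by (rule toda_rep_derivative[OF n alg[OF that(1)] that(2,3)])
    show "toda_normsq n (?R g s) = toda_normsq n s" if "g \<in> G1 n" "s \<in> ?V" for g s
      by (rule toda_normsq_rep[OF that(1) prehilbertD(1)[OF that(2)]])
    show "unitary_rep n ?V ?ip (\<lambda>g. compl_map ?V ?ip (?R g))"
      by (rule unitary(1))
    show "compl_map ?V ?ip (?R g) (compl_emb ?V ?ip s) = compl_emb ?V ?ip (?R g s)"
      if "g \<in> G1 n" "s \<in> ?V" for g s
      by (rule unitary(2)) (assumption | rule that)+
    show "0 < fact (n - 1) * sqrt pi ^ (n - 1)" by simp
    show "toda_normsq n s = ennreal (fact (n - 1) * sqrt pi ^ (n - 1)) *
        (\<integral>\<^sup>+a\<in>toda_dom_a n. ennreal ((cmod (s (a, p)))\<^sup>2 / (\<Prod>i<n - 1. a i)) \<partial>lebesgue_coords n)"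
      if "s \<in> smooth_polarized n" "p \<in> toda_dom_p n" for s p
      by (rule toda_normsq_smooth_polarized[OF that])
  qed
qed

end
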